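(* For each integer $n\geq1$ let $\mathcal{R}_n=(\mathcal{P}(\omega^n)/I_{\omega^n},\triangle,\cap,\mathbf{1})$; these are $\omega^n$-automatic commutative rings. (1) In ZFC + CH, the rings $\mathcal{R}_n$, $n\geq1$, are pairwise isomorphic. (2) In ZFC + AT, the rings $\mathcal{R}_n$, $n\geq 1$, are pairwise non-isomorphic.
   Context: $I_{\omega^n}=\{P\subseteq\omega^n\mid \mathrm{o.t.}(P)<\omega^n\}$ ($\mathrm{o.t.}$ = order type as a suborder of $(\omega^n,<)$); $\mathcal{P}(\omega^n)/I_{\omega^n}$ is the quotient of $\mathcal{P}(\omega^n)$ by $A\approx B\iff A\triangle B\in I_{\omega^n}$, with symmetric difference $\triangle$ as addition, intersection $\cap$ as multiplication and unit $\mathbf{1}=[\omega^n]$. CH is the continuum hypothesis. AT is Just's axiom: for every ${\bf\Sigma}^1_1$-ideal $I$ of subsets of $\omega$ (subsets identified with points of $2^\omega$), every $H:\mathcal{P}(\omega)\to\mathcal{P}(\omega)$ preserving intersections modulo $I$ (i.e. $H(X)\triangle H(Y)\in I$ whenever $X\triangle Y$ is finite, and $H(X\cap Y)\triangle(H(X)\cap H(Y))\in I$), and every uncountable family $\mathcal{A}$ of pairwise almost disjoint infinite subsets of $\omega$, there exist $A\in\mathcal{A}$ and a finite decomposition $A=\bigcup_{i<k}A_i$ with continuous $F_i:\mathcal{P}(A_i)\to\mathcal{P}(\omega)$ such that $F_i(X)\triangle H(X)\in I$ for all $X\subseteq A_i$. A structure is $\omega^n$-automatic if it has a presentation (domain a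 regular $\omega^n$-language modulo an equivalence relation, relations and graphs of operations regular $\omega^n$-languages over product alphabets) by ordinal Büchi automata reading words of length $\omega^n$. *)

theory Defs
  imports
    "HOL-Analysis.Function_Topology"
    "HOL-Analysis.Product_Topology"
    "HOL-Algebra.QuotRing"
begin

unbundle cardinal_syntax

text \<open>
  The ordinal \<open>\<omega>\<^sup>n\<close>: the list \<open>[a\<^sub>1, \<dots>, a\<^sub>n]\<close> stands for
  \<open>\<omega>\<^bsup>n-1\<^esup> \<cdot> a\<^sub>1 + \<dots> + \<omega> \<cdot> a\<^bsub>n-1\<^esub> + a\<^sub>n\<close>, so the order is the lexicographic one.
\<close>

definition omega_pow :: "nat \<Rightarrow> nat list rel"
  where "omega_pow n =
    {(xs, ys). length xs = n \<and> length ys = n \<and> (xs = ys \<or> (xs, ys) \<in> lexn less_than n)}"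

definition omega_pow_set :: "nat \<Rightarrow> nat list set"
  where "omega_pow_set n = {xs. length xs = n}"

definition omega_pow_ideal :: "nat \<Rightarrow> nat list set set"
  where "omega_pow_ideal n =
    {P. P \<subseteq> omega_pow_set n \<and> Restr (omega_pow n) P <o omega_pow n}"

definition omega_pow_equiv :: "nat \<Rightarrow> nat list set rel"
  where "omega_pow_equiv n =
    {(A, B). A \<subseteq> omega_pow_set n \<and> B \<subseteq> omega_pow_set n \<and> sym_diff A B \<in> omega_pow_ideal n}"

definition omega_pow_class :: "nat \<Rightarrow> nat list set \<Rightarrow> nat list set set"
  where "omega_pow_class n A = omega_pow_equiv n `` {A}"

definition omega_pow_ring :: "nat \<Rightarrow> nat list set set ring"
  where "omega_pow_ring n = \<lparr>
    carrier = Pow (omega_pow_set n) // omega_pow_equiv n,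
    mult = (\<lambda>X Y. \<Union>A\<in>X. \<Union>B\<in>Y. omega_pow_class n (A \<inter> B)),
    one = omega_pow_class n (omega_pow_set n),
    zero = omega_pow_class n {},
    add = (\<lambda>X Y. \<Union>A\<in>X. \<Union>B\<in>Y. omega_pow_class n (sym_diff A B))\<rparr>"


text \<open>
  Ordinal Buechi automata. A run on a word of length \<open>\<omega>\<^sup>n\<close> has length \<open>\<omega>\<^sup>n + 1\<close>; its positions
  are \<open>Some p\<close> with \<open>p\<close> in \<open>\<omega>\<^sup>n\<close>, followed by the last position \<open>None\<close>.
\<close>

record ('a, 'q) ordinal_automaton =
  alphabet :: "'a set"
  states :: "'q set"
  initial :: 'q
  succ_trans :: "('q \<times> 'a \<times> 'q) set"
  lim_trans :: "('q set \<times> 'q) set"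
  accepting :: "'q set"

definition wf_automaton :: "('a, 'q) ordinal_automaton \<Rightarrow> bool"
  where "wf_automaton \<A> \<longleftrightarrow>
    finite (alphabet \<A>) \<and> finite (states \<A>) \<and> initial \<A> \<in> states \<A> \<and>
    succ_trans \<A> \<subseteq> states \<A> \<times> alphabet \<A> \<times> states \<A> \<and>
    lim_trans \<A> \<subseteq> Pow (states \<A>) \<times> states \<A> \<and>
    accepting \<A> \<subseteq> states \<A>"

fun pos_less :: "nat \<Rightarrow> nat list option \<Rightarrow> nat list option \<Rightarrow> bool"
  where
    "pos_less n (Some p) (Some q) \<longleftrightarrow> (p, q) \<in> lexn less_than n"
  | "pos_less n (Some p) None \<longleftrightarrow> p \<in> omega_pow_set n"
  | "pos_less n None q \<longleftrightarrow> False"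

definition pos_succ :: "nat \<Rightarrow> nat list option \<Rightarrow> nat list option \<Rightarrow> bool"
  where "pos_succ n p q \<longleftrightarrow> pos_less n p q \<and> \<not> (\<exists>r. pos_less n p r \<and> pos_less n r q)"

definition pos_limit :: "nat \<Rightarrow> nat list option \<Rightarrow> bool"
  where "pos_limit n q \<longleftrightarrow> (\<exists>p. pos_less n p q) \<and> \<not> (\<exists>p. pos_succ n p q)"

definition cofinal_states ::
    "nat \<Rightarrow> (nat list option \<Rightarrow> 'q) \<Rightarrow> nat list option \<Rightarrow> 'q set"
  where "cofinal_states n x \<beta> =
    {q. \<forall>\<mu>. pos_less n \<mu> \<beta> \<longrightarrow> (\<exists>\<nu>. pos_less n \<nu> \<beta> \<and> pos_less n \<mu> \<nu> \<and> x \<nu> = q)}"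

definition is_run ::
    "nat \<Rightarrow> ('a, 'q) ordinal_automaton \<Rightarrow> (nat list \<Rightarrow> 'a) \<Rightarrow> (nat list option \<Rightarrow> 'q) \<Rightarrow> bool"
  where "is_run n \<A> w x \<longleftrightarrow>
    x (Some (replicate n 0)) = initial \<A> \<and>
    (\<forall>p q. pos_succ n (Some p) q \<longrightarrow> (x (Some p), w p, x q) \<in> succ_trans \<A>) \<and>
    (\<forall>q. pos_limit n q \<longrightarrow> (cofinal_states n x q, x q) \<in> lim_trans \<A>)"

definition omega_pow_words :: "nat \<Rightarrow> 'a set \<Rightarrow> (nat list \<Rightarrow> 'a) set"
  where "omega_pow_words n \<Sigma> = omega_pow_set n \<rightarrow>\<^sub>E \<Sigma>"

definition automaton_lang :: "nat \<Rightarrow> ('a, 'q) ordinal_automaton \<Rightarrow> (nat list \<Rightarrow> 'a) set"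
  where "automaton_lang n \<A> =
    {w \<in> omega_pow_words n (alphabet \<A>). \<exists>x. is_run n \<A> w x \<and> x None \<in> accepting \<A>}"

text \<open>Restricting state sets to sets of natural numbers is no loss, since they are finite.\<close>

definition regular_lang :: "nat \<Rightarrow> 'a set \<Rightarrow> (nat list \<Rightarrow> 'a) set \<Rightarrow> bool"
  where "regular_lang n \<Sigma> L \<longleftrightarrow>
    (\<exists>\<A> :: ('a, nat) ordinal_automaton.
      wf_automaton \<A> \<and> alphabet \<A> = \<Sigma> \<and> automaton_lang n \<A> = L)"

text \<open>A \<open>k\<close>-tuple of words is read as one word over the product alphabet \<open>\<Sigma>\<^sup>k\<close>.\<close>

definition convolution :: "nat \<Rightarrow> (nat list \<Rightarrow> 'a) list \<Rightarrow> nat list \<Rightarrow> 'a list"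
  where "convolution n ws = restrict (\<lambda>p. map (\<lambda>w. w p) ws) (omega_pow_set n)"

definition regular_rel :: "nat \<Rightarrow> 'a set \<Rightarrow> nat \<Rightarrow> (nat list \<Rightarrow> 'a) list set \<Rightarrow> bool"
  where "regular_rel n \<Sigma> k R \<longleftrightarrow>
    R \<subseteq> {ws. length ws = k \<and> set ws \<subseteq> omega_pow_words n \<Sigma>} \<and>
    regular_lang n {as. length as = k \<and> set as \<subseteq> \<Sigma>} (convolution n ` R)"

text \<open>
  A relational structure is given by its domain \<open>M\<close> and a list of relations, each with its arity.
  In a presentation, \<open>h\<close> induces an isomorphism from the quotient of the regular language \<open>D\<close> by
  the equivalence relation \<open>h u = h v\<close> onto the structure.
\<close>

definition omega_pow_automatic :: "nat \<Rightarrow> 'm set \<Rightarrow> (nat \<times> 'm list set) list \<Rightarrow> bool"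
  where "omega_pow_automatic n M rels \<longleftrightarrow>
    (\<exists>(\<Sigma> :: nat set) D h.
      finite \<Sigma> \<and> regular_lang n \<Sigma> D \<and> h ` D = M \<and>
      regular_rel n \<Sigma> 2 {[u, v] | u v. u \<in> D \<and> v \<in> D \<and> h u = h v} \<and>
      (\<forall>(k, R) \<in> set rels.
        regular_rel n \<Sigma> k {ws. length ws = k \<and> set ws \<subseteq> D \<and> map h ws \<in> R}))"

definition ring_relations :: "('m, 'b) ring_scheme \<Rightarrow> (nat \<times> 'm list set) list"
  where "ring_relations R =
    [(3, {[x, y, x \<oplus>\<^bsub>R\<^esub> y] | x y. x \<in> carrier R \<and> y \<in> carrier R}),
     (3, {[x, y, x \<otimes>\<^bsub>R\<^esub> y] | x y. x \<in> carrier R \<and> y \<in> carrier R}),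
     (1, {[\<one>\<^bsub>R\<^esub>]})]"


definition continuum_hypothesis :: bool
  where "continuum_hypothesis \<longleftrightarrow> |UNIV :: nat set set| =o cardSuc natLeq"


definition cantor_topology :: "nat set topology"
  where "cantor_topology =
    pullback_topology UNIV (\<lambda>X n. n \<in> X) (product_topology (\<lambda>_. discrete_topology UNIV) UNIV)"

definition baire_topology :: "(nat \<Rightarrow> nat) topology"
  where "baire_topology = product_topology (\<lambda>_. discrete_topology UNIV) UNIV"

text \<open>Boldface \<open>\<Sigma>\<^sup>1\<^sub>1\<close>: projections of closed subsets of \<open>2\<^sup>\<omega> \<times> \<omega>\<^sup>\<omega>\<close>.\<close>

definition analytic :: "nat set set \<Rightarrow> bool"
  where "analytic S \<longleftrightarrow>
    (\<exists>C. closedin (prod_topology cantor_topology baire_topology) C \<and> S = fst ` C)"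

definition set_ideal :: "nat set set \<Rightarrow> bool"
  where "set_ideal I \<longleftrightarrow>
    {} \<in> I \<and> (\<forall>A\<in>I. \<forall>B. B \<subseteq> A \<longrightarrow> B \<in> I) \<and> (\<forall>A\<in>I. \<forall>B\<in>I. A \<union> B \<in> I)"

definition preserves_inter_mod :: "nat set set \<Rightarrow> (nat set \<Rightarrow> nat set) \<Rightarrow> bool"
  where "preserves_inter_mod I H \<longleftrightarrow>
    (\<forall>X Y. finite (sym_diff X Y) \<longrightarrow> sym_diff (H X) (H Y) \<in> I) \<and>
    (\<forall>X Y. sym_diff (H (X \<inter> Y)) (H X \<inter> H Y) \<in> I)"

definition almost_disjoint_family :: "nat set set \<Rightarrow> bool"
  where "almost_disjoint_family \<A> \<longleftrightarrow>
    (\<forall>A\<in>\<A>. infinite A) \<and> (\<forall>A\<in>\<A>. \<forall>B\<in>\<A>. A \<noteq> B \<longrightarrow> finite (A \<inter> B))"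

definition axiom_AT :: bool
  where "axiom_AT \<longleftrightarrow>
    (\<forall>I H \<A>. set_ideal I \<and> analytic I \<and> preserves_inter_mod I H \<and>
        uncountable \<A> \<and> almost_disjoint_family \<A> \<longrightarrow>
      (\<exists>A\<in>\<A>. \<exists>(k :: nat) (As :: nat \<Rightarrow> nat set) (F :: nat \<Rightarrow> nat set \<Rightarrow> nat set).
        A = (\<Union>i<k. As i) \<and>
        (\<forall>i<k. continuous_map (subtopology cantor_topology (Pow (As i))) cantor_topology (F i) \<and>
               (\<forall>X. X \<subseteq> As i \<longrightarrow> sym_diff (F i X) (H X) \<in> I))))"

end

theory Submission
  imports Defs "HOL-Library.Nat_Bijection"
begin

text \<open>
  A subset of \<open>\<omega>\<^bsup>n+1\<^esup>\<close> has smaller order type iff all but finitely many of its sections in \<open>\<omega>\<^sup>n\<close> do, so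
  the ideals are the iterated Fubini powers of the ideal of finite sets. An automaton recognizes the
  ideal by recording at each limit position whether the block just completed has full type.

  Under CH, the rings are isomorphic by a back-and-forth construction of length \<open>\<omega>\<^sub>1\<close>: each
  quotient is a reduced power modulo finite sets, so a countable partial isomorphism can be extended to
  one more element, by treating larger and larger finite subalgebras on later sections.

  Under AT, an isomorphism from the ring for \<open>m\<close> to the one for \<open>n < m\<close> has a continuous lifting on the
  subsets of some set of type \<open>\<omega>\<^sup>m\<close>, hence yields a continuous reduction of the ideal for \<open>m\<close> to the ideal
  for \<open>n\<close>. The ideal for \<open>m\<close> is complete for \<open>\<Sigma>\<^sup>0\<close> at level \<open>2m\<close>, so the complement of the ideal for \<open>n\<close>
  reduces to it and thus to the ideal for \<open>n\<close>; but every continuous map has an argument on which it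
  preserves membership in the latter.
\<close>

section \<open>The ideals as iterated Fubini powers of the ideal of finite sets\<close>

text \<open>Smallness in exponent \<open>n\<close> is a string of \<open>n\<close> quantifiers "for
  almost all coordinates", each worth two Borel levels. The complement of the ideal for
  \<open>n\<close> is at level \<open>2n + 1\<close>, and this stays within \<open>2m\<close>
  exactly because \<open>n < m\<close>. The agreement argument has to let \<open>X\<close> reproduce
  an output that is computed from \<open>X\<close> itself. Literal equality is out of reach, but
  smallness only asks whether a prefix has infinitely many last coordinates, so copying up to an
  injective change of the last coordinate is enough. AT controls neither which almost disjoint set
  is returned nor how it is cut up. So every member of the family used is of full type; then one of
  the finitely many pieces is full, and an embedding of the whole ordinal into that piece makes the
  lifting available for arbitrary sets. CH enters only through well-ordering the subsets of the
  naturals with countable initial segments: at each stage countably many pairs are present, and they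
  are exhausted by an increasing sequence of finite sets. Finitely many sections never affect
  smallness, so each finite set of pairs may be ignored until its turn comes.\<close>

fun omega_small :: "nat \<Rightarrow> nat list set \<Rightarrow> bool"
  where
    "omega_small 0 P \<longleftrightarrow> [] \<notin> P"
  | "omega_small (Suc n) P \<longleftrightarrow> finite {a. \<not> omega_small n {p. a # p \<in> P}}"

lemma omega_small_empty [simp]: "omega_small n {}"
  by (induction n) auto

lemma omega_small_subset: "omega_small n Q \<Longrightarrow> P \<subseteq> Q \<Longrightarrow> omega_small n P"
proof (induction n arbitrary: P Q)
  case (Suc n)
  have "{a. \<not> omega_small n {p. a # p \<in> P}} \<subseteq> {a. \<not> omega_small n {p. a # p \<in> Q}}"
  proof (intro Collect_mono impI notI)
    fix a assume "\<not> omega_small n {p. a # p \<in> P}" "omega_small n {p. a # p \<in> Q}"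
    moreover have "{p. a # p \<in> P} \<subseteq> {p. a # p \<in> Q}"
      using Suc.prems(2) by blast
    ultimately show False
      using Suc.IH by blast
  qed
  then show ?case
    using Suc.prems(1) finite_subset by simp
qed auto

lemma omega_small_Un: "omega_small n (P \<union> Q) \<longleftrightarrow> omega_small n P \<and> omega_small n Q"
proof
  show "omega_small n (P \<union> Q) \<Longrightarrow> omega_small n P \<and> omega_small n Q"
    using omega_small_subset by (meson Un_upper1 Un_upper2)
  show "omega_small n P \<and> omega_small n Q \<Longrightarrow> omega_small n (P \<union> Q)"
  proof (induction n arbitrary: P Q)
    case (Suc n)
    have "{a. \<not> omega_small n {p. a # p \<in> P \<union> Q}}
        \<subseteq> {a. \<not> omega_small n {p. a # p \<in> P}} \<union> {a. \<not> omega_small n {p. a # p \<in> Q}}"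
      using Suc.IH by (auto simp: Collect_disj_eq)
    then show ?case
      using Suc.prems finite_subset by fastforce
  qed auto
qed

lemma omega_small_UN:
  "finite S \<Longrightarrow> omega_small n (\<Union>i\<in>S. P i) \<longleftrightarrow> (\<forall>i\<in>S. omega_small n (P i))"
  by (induction S rule: finite_induct) (auto simp: omega_small_Un)

lemma omega_small_Int_set: "omega_small n (P \<inter> omega_pow_set n) \<longleftrightarrow> omega_small n P"
proof (induction n arbitrary: P)
  case (Suc n)
  have "{p. a # p \<in> P \<inter> omega_pow_set (Suc n)} = {p. a # p \<in> P} \<inter> omega_pow_set n" for a
    by (auto simp: omega_pow_set_def)
  then show ?case
    using Suc.IH by simp
qed (auto simp: omega_pow_set_def)

lemma omega_small_cong:
  assumes "\<And>p. length p = n \<Longrightarrow> p \<in> P \<longleftrightarrow> p \<in> Q"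
  shows "omega_small n P \<longleftrightarrow> omega_small n Q"
proof -
  have "P \<inter> omega_pow_set n = Q \<inter> omega_pow_set n"
    using assms by (auto simp: omega_pow_set_def)
  then show ?thesis
    by (metis omega_small_Int_set)
qed

text \<open>Every section at a point of \<open>A\<close> is again a power of \<open>A\<close>.
  Besides the whole ordinal (\<open>A = UNIV\<close>) this yields the full sets built from
  branches.\<close>

lemma not_omega_small_power:
  assumes "infinite A"
  shows "\<not> omega_small n {p. length p = n \<and> set p \<subseteq> A}"
proof (induction n)
  case (Suc n)
  have "\<not> omega_small n {p. a # p \<in> {p. length p = Suc n \<and> set p \<subseteq> A}}" if "a \<in> A" for a
    using Suc that by simp
  then have "A \<subseteq> {a. \<not> omega_small n {p. a # p \<in> {p. length p = Suc n \<and> set p \<subseteq> A}}}"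
    by blast
  then show ?case
    using assms finite_subset by auto
qed auto

lemma not_omega_small_set: "\<not> omega_small n (omega_pow_set n)"
  using not_omega_small_power[of UNIV n] by (simp add: omega_pow_set_def)

text \<open>Only heads of members of \<open>P\<close> have nonempty sections. In exponent 0 the set
  \<open>{[]}\<close> is finite but not small.\<close>

lemma omega_small_finite:
  assumes "finite P" "n \<ge> 1"
  shows "omega_small n P"
proof -
  obtain k where n: "n = Suc k"
    using assms(2) by (cases n) auto
  have "{a. \<not> omega_small k {p. a # p \<in> P}} \<subseteq> hd ` P"
  proof
    fix a assume "a \<in> {a. \<not> omega_small k {p. a # p \<in> P}}"
    then have "{p. a # p \<in> P} \<noteq> {}"
      using omega_small_empty by (metis mem_Collect_eq)
    then show "a \<in> hd ` P"
      by force
  qed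
  then show ?thesis
    using assms(1) finite_subset by (auto simp: n)
qed

lemma Cons_lexn_less_than_iff [simp]:
  "(a # p, b # q) \<in> lexn less_than (Suc n) \<longleftrightarrow>
    length p = n \<and> length q = n \<and> (a < b \<or> a = b \<and> (p, q) \<in> lexn less_than n)"
  (is "?L \<longleftrightarrow> ?R")
proof
  show "?L \<Longrightarrow> ?R"
    by auto
  assume ?R
  then have "((a, p), (b, q)) \<in> less_than <*lex*> lexn less_than n" "length p = n" "length q = n"
    by auto
  then show ?L
    using image_eqI[of "(a # p, b # q)" "map_prod (\<lambda>(x, xs). x # xs) (\<lambda>(x, xs). x # xs)"
        "((a, p), (b, q))" "less_than <*lex*> lexn less_than n"] by simp
qed

lemma lexn_less_than_SucE:
  assumes "(p, q) \<in> lexn less_than (Suc n)"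
  obtains a p' b q' where "p = a # p'" "q = b # q'" "length p' = n" "length q' = n"
    "a < b \<or> a = b \<and> (p', q') \<in> lexn less_than n"
proof -
  have "length p = Suc n" "length q = Suc n"
    using assms lexn_length by blast+
  then obtain a p' b q' where "p = a # p'" "q = b # q'"
    by (metis length_Suc_conv)
  then show thesis
    using that assms Cons_lexn_less_than_iff by blast
qed

declare lexn.simps(2) [simp del]

text \<open>The infinitely many heads with non-small section are enumerated increasingly, and each
  such section receives a copy from the induction hypothesis. The clause on images, valid in both
  directions, is what later carries a reduction into \<open>D\<close>.\<close>

lemma not_omega_small_embedding:
  assumes "\<not> omega_small n D"
  shows "\<exists>e. (\<forall>p. length p = n \<longrightarrow> e p \<in> D \<and> length (e p) = n)
      \<and> (\<forall>p q. (p, q) \<in> lexn less_than n \<longrightarrow> (e p, e q) \<in> lexn less_than n)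
      \<and> (\<forall>X. omega_small n (e ` (X \<inter> omega_pow_set n)) \<longleftrightarrow> omega_small n X)"
  using assms
proof (induction n arbitrary: D)
  case 0
  then show ?case
    by (intro exI[of _ id]) (auto simp: omega_pow_set_def)
next
  case (Suc n)
  define A where "A = {a. \<not> omega_small n {p. a # p \<in> D}}"
  have inf: "infinite A"
    using Suc.prems by (simp add: A_def)
  have "\<forall>a\<in>A. \<exists>e. (\<forall>p. length p = n \<longrightarrow> a # e p \<in> D \<and> length (e p) = n)
    \<and> (\<forall>p q. (p, q) \<in> lexn less_than n \<longrightarrow> (e p, e q) \<in> lexn less_than n)
    \<and> (\<forall>X. omega_small n (e ` (X \<inter> omega_pow_set n)) \<longleftrightarrow> omega_small n X)"
  proof
    fix a assume "a \<in> A"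
    then have "\<not> omega_small n {p. a # p \<in> D}"
      by (simp add: A_def)
    from Suc.IH[OF this] show "\<exists>e. (\<forall>p. length p = n \<longrightarrow> a # e p \<in> D \<and> length (e p) = n)
    \<and> (\<forall>p q. (p, q) \<in> lexn less_than n \<longrightarrow> (e p, e q) \<in> lexn less_than n)
    \<and> (\<forall>X. omega_small n (e ` (X \<inter> omega_pow_set n)) \<longleftrightarrow> omega_small n X)"
      by simp
  qed
  from bchoice[OF this] obtain e where e:
    "\<And>a p. a \<in> A \<Longrightarrow> length p = n \<Longrightarrow> a # e a p \<in> D \<and> length (e a p) = n"
    "\<And>a p q. a \<in> A \<Longrightarrow> (p, q) \<in> lexn less_than n \<Longrightarrow> (e a p, e a q) \<in> lexn less_than n"
    "\<And>a X. a \<in> A \<Longrightarrow> omega_small n (e a ` (X \<inter> omega_pow_set n)) \<longleftrightarrow> omega_small n X"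
    by blast
  define s where "s = enumerate A"
  have sA: "s j \<in> A" for j
    using inf by (simp add: s_def enumerate_in_set)
  have smono: "strict_mono s"
    using inf by (simp add: s_def strict_mono_enumerate)
  define E where "E p = s (hd p) # e (s (hd p)) (tl p)" for p
  have small: "omega_small (Suc n) (E ` (X \<inter> omega_pow_set (Suc n))) \<longleftrightarrow> omega_small (Suc n) X"
    for X
  proof -
    have sec: "{p. s j # p \<in> E ` (X \<inter> omega_pow_set (Suc n))}
        = e (s j) ` ({p. j # p \<in> X} \<inter> omega_pow_set n)" for j
    proof -
      have "s j # p \<in> E ` (X \<inter> omega_pow_set (Suc n))
          \<longleftrightarrow> p \<in> e (s j) ` ({p. j # p \<in> X} \<inter> omega_pow_set n)" for p
      proof
        assume "s j # p \<in> E ` (X \<inter> omega_pow_set (Suc n))"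
        then obtain r where r: "r \<in> X" "length r = Suc n" "s j # p = E r"
          by (auto simp: omega_pow_set_def)
        then obtain a r' where "r = a # r'"
          by (cases r) auto
        then show "p \<in> e (s j) ` ({p. j # p \<in> X} \<inter> omega_pow_set n)"
          using r smono by (auto simp: E_def omega_pow_set_def strict_mono_eq)
      next
        assume "p \<in> e (s j) ` ({p. j # p \<in> X} \<inter> omega_pow_set n)"
        then show "s j # p \<in> E ` (X \<inter> omega_pow_set (Suc n))"
          by (force simp: E_def omega_pow_set_def)
      qed
      then show ?thesis by blast
    qed
    have empty: "{p. a # p \<in> E ` (X \<inter> omega_pow_set (Suc n))} = {}" if "a \<notin> range s" for a
      using that by (auto simp: E_def)
    have "{a. \<not> omega_small n {p. a # p \<in> E ` (X \<inter> omega_pow_set (Suc n))}}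
        = s ` {j. \<not> omega_small n {p. j # p \<in> X}}"
    proof (intro Set.set_eqI iffI)
      fix a assume a: "a \<in> {a. \<not> omega_small n {p. a # p \<in> E ` (X \<inter> omega_pow_set (Suc n))}}"
      then have "a \<in> range s"
        using empty by (metis mem_Collect_eq omega_small_empty)
      then obtain j where "a = s j" by blast
      then show "a \<in> s ` {j. \<not> omega_small n {p. j # p \<in> X}}"
        using a e(3)[OF sA] by (auto simp only: sec mem_Collect_eq)
    next
      fix a assume "a \<in> s ` {j. \<not> omega_small n {p. j # p \<in> X}}"
      then show "a \<in> {a. \<not> omega_small n {p. a # p \<in> E ` (X \<inter> omega_pow_set (Suc n))}}"
        using e(3)[OF sA] by (auto simp only: sec mem_Collect_eq)
    qed
    moreover have "inj s"
      using smono strict_mono_imp_inj_on by blast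
    ultimately show ?thesis
      by (simp add: finite_image_iff inj_on_subset)
  qed
  have mem: "E p \<in> D \<and> length (E p) = Suc n" if "length p = Suc n" for p
    using that e(1)[OF sA] by (auto simp: E_def)
  have mono: "(E p, E q) \<in> lexn less_than (Suc n)" if "(p, q) \<in> lexn less_than (Suc n)" for p q
    using that by (rule lexn_less_than_SucE)
      (use smono e(1,2)[OF sA] in \<open>auto simp: E_def strict_mono_less\<close>)
  show ?case
    using mem mono small by blast
qed


section \<open>Order types and smallness\<close>

lemma lexn_less_than_not_refl: "(p, p) \<notin> lexn less_than n"
  using wf_lexn[OF wf_less_than, of n] by (simp add: wf_not_refl)

lemma omega_pow_strict_iff:
  "(p, q) \<in> omega_pow n \<and> p \<noteq> q \<longleftrightarrow> (p, q) \<in> lexn less_than n"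
  using lexn_length[of p q less_than n] lexn_less_than_not_refl by (auto simp: omega_pow_def)

lemma lexn_less_than_total:
  "length p = n \<Longrightarrow> length q = n \<Longrightarrow> p = q \<or> (p, q) \<in> lexn less_than n \<or> (q, p) \<in> lexn less_than n"
proof (induction n arbitrary: p q)
  case (Suc n)
  obtain a p' b q' where "p = a # p'" "q = b # q'"
    using Suc.prems by (metis length_Suc_conv)
  then show ?case
    using Suc.IH[of p' q'] Suc.prems by auto
qed auto

lemma trans_lexn_less_than:
  "(p, q) \<in> lexn less_than n \<Longrightarrow> (q, r) \<in> lexn less_than n \<Longrightarrow> (p, r) \<in> lexn less_than n"
  using lexn_transI[of less_than n] by (meson transD trans_less_than)

lemma well_order_on_omega_pow: "well_order_on (omega_pow_set n) (omega_pow n)"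
proof -
  have "refl_on (omega_pow_set n) (omega_pow n)" "omega_pow n \<subseteq> omega_pow_set n \<times> omega_pow_set n"
    by (auto simp: refl_on_def omega_pow_set_def omega_pow_def)
  moreover have "trans (omega_pow n)"
    by (auto simp: trans_def omega_pow_def intro: trans_lexn_less_than)
  moreover have "antisym (omega_pow n)"
    using trans_lexn_less_than lexn_less_than_not_refl
    by (fastforce simp: antisym_def omega_pow_def)
  moreover have "total_on (omega_pow_set n) (omega_pow n)"
    using lexn_less_than_total by (auto simp: total_on_def omega_pow_set_def omega_pow_def)
  moreover have "omega_pow n - Id \<subseteq> lexn less_than n"
    using omega_pow_strict_iff by auto
  then have "wf (omega_pow n - Id)"
    using wf_subset[OF wf_lexn[OF wf_less_than]] by blast
  ultimately show ?thesis
    by (simp add: well_order_on_def linear_order_on_def partial_order_on_def preorder_on_def)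
qed

lemma Field_omega_pow: "Field (omega_pow n) = omega_pow_set n"
  by (rule well_order_on_Field[OF well_order_on_omega_pow, symmetric])

lemma Well_order_omega_pow: "Well_order (omega_pow n)"
  using well_order_on_omega_pow by (simp add: Field_omega_pow)

text \<open>If \<open>x\<close> is least with \<open>f x\<close> below \<open>x\<close>, then
  \<open>f x\<close> is a smaller counterexample.\<close>

lemma strict_mono_below_self:
  assumes "Well_order r" "f ` Field r \<subseteq> Field r"
    and "\<And>x y. (x, y) \<in> r \<Longrightarrow> x \<noteq> y \<Longrightarrow> (f x, f y) \<in> r \<and> f x \<noteq> f y"
    and "x \<in> Field r"
  shows "(x, f x) \<in> r"
proof -
  have "wf (r - Id)"
    using assms(1) by (simp add: well_order_on_def)
  then show ?thesis
    using assms(4)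
  proof (induction x)
    case (less x)
    show ?case
    proof (rule ccontr)
      have tot: "Total r" and anti: "antisym r" and refl: "Refl r"
        using assms(1) by (auto simp: order_on_defs)
      assume neg: "(x, f x) \<notin> r"
      have fx: "f x \<in> Field r"
        using less.prems assms(2) by blast
      have "f x \<noteq> x"
        using refl neg less.prems by (metis refl_onD)
      then have lt: "(f x, x) \<in> r" "f x \<noteq> x"
        using tot neg fx less.prems by (auto simp: total_on_def)
      then have "(f x, f (f x)) \<in> r" "(f (f x), f x) \<in> r" "f (f x) \<noteq> f x"
        using less.IH[of "f x"] fx assms(3) by auto
      then show False
        using anti by (auto dest: antisymD)
    qed
  qed
qed

text \<open>The range of \<open>f\<close> need not be an initial segment, so \<open>f\<close> is not
  itself an embedding of well-orders. If \<open>s\<close> were shorter, it would be isomorphic to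
  the segment of \<open>r\<close> below some \<open>a\<close>, and \<open>f\<close> followed by that
  isomorphism would move \<open>a\<close> below itself.\<close>

lemma ordLeq_strict_monoI:
  assumes r: "Well_order r" and s: "Well_order s" and f: "f ` Field r \<subseteq> Field s"
    and mono: "\<And>x y. (x, y) \<in> r \<Longrightarrow> x \<noteq> y \<Longrightarrow> (f x, f y) \<in> s \<and> f x \<noteq> f y"
  shows "r \<le>o s"
proof (rule ccontr)
  assume "\<not> r \<le>o s"
  then have "s <o r"
    using r s not_ordLeq_iff_ordLess by blast
  then obtain a where a: "a \<in> Field r" "s =o Restr r (underS r a)"
    using ordLess_iff_ordIso_Restr[OF r s] by blast
  then obtain g where g: "BNF_Wellorder_Embedding.iso s (Restr r (underS r a)) g"
    unfolding ordIso_def by blast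
  have sub: "underS r a \<subseteq> Field r"
    by (auto simp: underS_def Field_def)
  have Fld: "Field (Restr r (underS r a)) = underS r a"
    using r sub by (intro Refl_Field_Restr2) (auto simp: order_on_defs)
  have gb: "bij_betw g (Field s) (underS r a)"
    using g Fld by (simp add: BNF_Wellorder_Embedding.iso_def)
  have gs: "(x, y) \<in> s \<Longrightarrow> (g x, g y) \<in> r" for x y
    using embed_compat[of s _ g] g by (auto simp: BNF_Wellorder_Embedding.iso_def compat_def)
  have "(a, (g \<circ> f) a) \<in> r"
  proof (rule strict_mono_below_self[OF r _ _ a(1)])
    show "(g \<circ> f) ` Field r \<subseteq> Field r"
    proof
      fix z assume "z \<in> (g \<circ> f) ` Field r"
      then have "z \<in> underS r a"
        using f gb bij_betw_apply[OF gb] by auto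
      then show "z \<in> Field r"
        using sub by blast
    qed
    fix x y assume xy: "(x, y) \<in> r" "x \<noteq> y"
    then have "f x \<in> Field s" "f y \<in> Field s"
      using mono by (meson FieldI1 FieldI2)+
    then show "((g \<circ> f) x, (g \<circ> f) y) \<in> r \<and> (g \<circ> f) x \<noteq> (g \<circ> f) y"
      using mono[OF xy] gs gb by (auto simp: bij_betw_def inj_on_def)
  qed
  moreover have "(g \<circ> f) a \<in> underS r a"
    using f a(1) bij_betw_apply[OF gb] by auto
  ultimately show False
    using r by (auto simp: underS_def order_on_defs dest: antisymD)
qed

text \<open>The image of the block with head \<open>a\<close> meets only finitely many heads, all at
  least \<open>a\<close>. One of them, \<open>b\<close>, is taken on a set of full type; after
  reparametrizing that set, the tails form a strictly monotone map of exponent \<open>n\<close>, so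
  the section at \<open>b\<close> is not small. As \<open>a\<close> is arbitrary, there are
  infinitely many such \<open>b\<close>.\<close>

lemma not_omega_small_strict_mono_image:
  assumes "\<And>p. length p = n \<Longrightarrow> length (f p) = n"
    and "\<And>p q. (p, q) \<in> lexn less_than n \<Longrightarrow> (f p, f q) \<in> lexn less_than n"
  shows "\<not> omega_small n (f ` omega_pow_set n)"
  using assms
proof (induction n arbitrary: f)
  case 0
  then show ?case
    by (auto simp: omega_pow_set_def)
next
  case (Suc n)
  define P where "P = f ` omega_pow_set (Suc n)"
  have len: "length p = Suc n \<Longrightarrow> length (f p) = Suc n" for p
    using Suc.prems(1) by blast
  have hd_f: "hd (f p) \<le> hd (f q)" if "(p, q) \<in> lexn less_than (Suc n)" for p q
    using Suc.prems(2)[OF that] by (rule lexn_less_than_SucE) auto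
  have ge: "a \<le> hd (f (a # p))" if "length p = n" for a p
  proof -
    have "(a # p, f (a # p)) \<in> omega_pow (Suc n)"
    proof (rule strict_mono_below_self[OF Well_order_omega_pow])
      show "f ` Field (omega_pow (Suc n)) \<subseteq> Field (omega_pow (Suc n))"
        using len by (auto simp: Field_omega_pow omega_pow_set_def)
      show "a # p \<in> Field (omega_pow (Suc n))"
        using that by (auto simp: Field_omega_pow omega_pow_set_def)
      show "(f x, f y) \<in> omega_pow (Suc n) \<and> f x \<noteq> f y" if "(x, y) \<in> omega_pow (Suc n)" "x \<noteq> y"
        for x y
        using that Suc.prems(2) omega_pow_strict_iff by metis
    qed
    then show ?thesis
      by (cases "f (a # p)") (auto simp: omega_pow_def)
  qed
  have step: "\<exists>b\<ge>a. \<not> omega_small n {p. b # p \<in> P}" for a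
  proof -
    \<comment> \<open>The first point of the next block bounds all heads that occur in the image of
      block \<open>a\<close>.\<close>
    define B where "B = hd (f (Suc a # replicate n 0))"
    have le: "hd (f (a # p)) \<le> B" if "length p = n" for p
      unfolding B_def using that by (intro hd_f) auto
    have cover: "(\<Union>b\<in>{a..B}. {p. length p = n \<and> hd (f (a # p)) = b}) = omega_pow_set n"
      using le ge by (auto simp: omega_pow_set_def)
    then obtain b where b: "b \<in> {a..B}" "\<not> omega_small n {p. length p = n \<and> hd (f (a # p)) = b}"
      using omega_small_UN[of "{a..B}" n "\<lambda>b. {p. length p = n \<and> hd (f (a # p)) = b}"]
        not_omega_small_set by auto
    obtain e where
      e_mem: "\<forall>p. length p = n \<longrightarrow> e p \<in> {p. length p = n \<and> hd (f (a # p)) = b} \<and> length (e p) = n"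
      and e_mono: "\<forall>p q. (p, q) \<in> lexn less_than n \<longrightarrow> (e p, e q) \<in> lexn less_than n"
      using not_omega_small_embedding[OF b(2)] by blast
    have e: "length (e p) = n \<and> hd (f (a # e p)) = b" if "length p = n" for p
      using e_mem that by simp
    \<comment> \<open>On the points \<open>a # e p\<close> the head of the value is constantly
      \<open>b\<close>, so strict monotonicity passes to the tails.\<close>
    define g where "g p = tl (f (a # e p))" for p
    have f_eq: "f (a # e p) = b # g p" if "length p = n" for p
      using len[of "a # e p"] e[OF that] by (cases "f (a # e p)") (auto simp: g_def)
    have "\<not> omega_small n (g ` omega_pow_set n)"
    proof (rule Suc.IH)
      show "length (g p) = n" if "length p = n" for p
        using len[of "a # e p"] e[OF that] that by (simp add: g_def)
      fix p q assume pq: "(p, q) \<in> lexn less_than n"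
      then have "length p = n" "length q = n"
        using lexn_length by blast+
      moreover have "(f (a # e p), f (a # e q)) \<in> lexn less_than (Suc n)"
        using Suc.prems(2)[of "a # e p" "a # e q"] e_mono pq lexn_length[of "e p" "e q" less_than n]
        by auto
      ultimately show "(g p, g q) \<in> lexn less_than n"
        using f_eq by auto
    qed
    moreover have "g ` omega_pow_set n \<subseteq> {p. b # p \<in> P}"
    proof
      fix z assume "z \<in> g ` omega_pow_set n"
      then obtain p where p: "length p = n" "z = g p"
        by (auto simp: omega_pow_set_def)
      then have "f (a # e p) \<in> P"
        using e by (simp add: P_def omega_pow_set_def)
      then show "z \<in> {p. b # p \<in> P}"
        using p f_eq by simp
    qed
    ultimately show ?thesis
      using omega_small_subset b(1) by (metis atLeastAtMost_iff)
  qed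
  then have "infinite {b. \<not> omega_small n {p. b # p \<in> P}}"
    by (auto simp: infinite_nat_iff_unbounded_le)
  then show ?case
    by (simp add: P_def)
qed

text \<open>By comparability of well-orders, a set has smaller type iff the ordinal does not embed
  into it. An embedding has non-small range, and conversely a non-small set contains a strictly
  monotone copy of the ordinal.\<close>

lemma omega_pow_ideal_iff:
  "P \<in> omega_pow_ideal n \<longleftrightarrow> P \<subseteq> omega_pow_set n \<and> omega_small n P"
proof (cases "P \<subseteq> omega_pow_set n")
  case True
  have W: "Well_order (Restr (omega_pow n) P)"
    using Well_order_Restr Well_order_omega_pow by blast
  have Fld: "Field (Restr (omega_pow n) P) = P"
    using True Refl_Field_Restr2[of "omega_pow n" P] well_order_on_omega_pow[of n]
    by (simp add: Field_omega_pow order_on_defs)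
  have "omega_pow n \<le>o Restr (omega_pow n) P \<longleftrightarrow> \<not> omega_small n P"
  proof
    assume "omega_pow n \<le>o Restr (omega_pow n) P"
    then obtain f where f: "embed (omega_pow n) (Restr (omega_pow n) P) f"
      by (auto simp: ordLeq_def)
    have sub: "f ` omega_pow_set n \<subseteq> P"
      using embed_Field[OF f] by (simp add: Fld Field_omega_pow)
    have inj: "inj_on f (omega_pow_set n)"
      using embed_inj_on[OF Well_order_omega_pow f] by (simp add: Field_omega_pow)
    have "\<not> omega_small n (f ` omega_pow_set n)"
    proof (rule not_omega_small_strict_mono_image)
      show "length (f p) = n" if "length p = n" for p
        using that sub True by (auto simp: omega_pow_set_def)
      fix p q assume pq: "(p, q) \<in> lexn less_than n"
      then have "(p, q) \<in> omega_pow n" "p \<noteq> q"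
        using omega_pow_strict_iff by auto
      then have "(f p, f q) \<in> omega_pow n"
        using embed_compat[OF f] by (auto simp: compat_def)
      moreover have "f p \<noteq> f q"
        using inj pq \<open>p \<noteq> q\<close> lexn_length by (fastforce simp: inj_on_def omega_pow_set_def)
      ultimately show "(f p, f q) \<in> lexn less_than n"
        using omega_pow_strict_iff by blast
    qed
    then show "\<not> omega_small n P"
      using omega_small_subset sub by blast
  next
    assume "\<not> omega_small n P"
    then obtain e where e: "\<forall>p. length p = n \<longrightarrow> e p \<in> P \<and> length (e p) = n"
      "\<forall>p q. (p, q) \<in> lexn less_than n \<longrightarrow> (e p, e q) \<in> lexn less_than n"
      using not_omega_small_embedding[of n P] by blast
    show "omega_pow n \<le>o Restr (omega_pow n) P"
    proof (rule ordLeq_strict_monoI[OF Well_order_omega_pow W])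
      show "e ` Field (omega_pow n) \<subseteq> Field (Restr (omega_pow n) P)"
        using e(1) by (auto simp: Fld Field_omega_pow omega_pow_set_def)
      fix p q assume pq: "(p, q) \<in> omega_pow n" "p \<noteq> q"
      then have "(e p, e q) \<in> omega_pow n" "e p \<noteq> e q"
        using e(2) omega_pow_strict_iff by metis+
      moreover have "length p = n" "length q = n"
        using pq by (auto simp: omega_pow_def)
      ultimately show "(e p, e q) \<in> Restr (omega_pow n) P \<and> e p \<noteq> e q"
        using e(1) by auto
    qed
  qed
  then show ?thesis
    using True W Well_order_omega_pow not_ordLess_iff_ordLeq
    by (auto simp: omega_pow_ideal_def)
qed (simp add: omega_pow_ideal_def)

section \<open>The quotient rings\<close>

lemma omega_pow_equiv_iff:
  "(A, B) \<in> omega_pow_equiv n \<longleftrightarrow>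
    A \<subseteq> omega_pow_set n \<and> B \<subseteq> omega_pow_set n \<and> omega_small n (sym_diff A B)"
  by (auto simp: omega_pow_equiv_def omega_pow_ideal_iff)

lemma equiv_omega_pow: "equiv (Pow (omega_pow_set n)) (omega_pow_equiv n)"
proof (rule equivI)
  show "omega_pow_equiv n \<subseteq> Pow (omega_pow_set n) \<times> Pow (omega_pow_set n)"
    by (auto simp: omega_pow_equiv_iff)
  show "refl_on (Pow (omega_pow_set n)) (omega_pow_equiv n)"
    by (auto simp: refl_on_def omega_pow_equiv_iff)
  show "sym (omega_pow_equiv n)"
    by (auto simp: sym_def omega_pow_equiv_iff Un_commute)
  show "trans (omega_pow_equiv n)"
  proof (rule transI)
    fix A B C assume "(A, B) \<in> omega_pow_equiv n" "(B, C) \<in> omega_pow_equiv n"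
    moreover have "sym_diff A C \<subseteq> sym_diff A B \<union> sym_diff B C"
      by auto
    ultimately show "(A, C) \<in> omega_pow_equiv n"
      using omega_small_subset[of n "sym_diff A B \<union> sym_diff B C" "sym_diff A C"]
      by (simp add: omega_pow_equiv_iff omega_small_Un)
  qed
qed

lemma omega_pow_class_eq_iff:
  assumes "A \<subseteq> omega_pow_set n" "B \<subseteq> omega_pow_set n"
  shows "omega_pow_class n A = omega_pow_class n B \<longleftrightarrow> omega_small n (sym_diff A B)"
  using assms eq_equiv_class_iff[OF equiv_omega_pow, of A n B]
  by (simp add: omega_pow_class_def omega_pow_equiv_iff)

lemma carrier_omega_pow_ring:
  "carrier (omega_pow_ring n) = omega_pow_class n ` Pow (omega_pow_set n)"
  by (auto simp: omega_pow_ring_def omega_pow_class_def quotient_def)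

lemma omega_pow_class_mem: "A \<in> omega_pow_class n B \<longleftrightarrow> (B, A) \<in> omega_pow_equiv n"
  by (simp add: omega_pow_class_def)

lemma omega_pow_class_self: "A \<subseteq> omega_pow_set n \<Longrightarrow> A \<in> omega_pow_class n A"
  by (simp add: omega_pow_class_mem omega_pow_equiv_iff)

text \<open>The ring operations are unions over all representatives. The second condition on
  \<open>f\<close>, true of every pointwise Boolean operation, makes small changes of the arguments
  cause small changes of the value, so all classes in the union coincide.\<close>

lemma UN_omega_pow_class:
  assumes A: "A \<subseteq> omega_pow_set n" and B: "B \<subseteq> omega_pow_set n"
    and f: "\<And>C D. f C D \<subseteq> C \<union> D"
      "\<And>C D. sym_diff (f A B) (f C D) \<subseteq> sym_diff A C \<union> sym_diff B D"
  shows "(\<Union>C\<in>omega_pow_class n A. \<Union>D\<in>omega_pow_class n B. omega_pow_class n (f C D))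
    = omega_pow_class n (f A B)"
proof -
  have "omega_pow_class n (f C D) = omega_pow_class n (f A B)"
    if "C \<in> omega_pow_class n A" "D \<in> omega_pow_class n B" for C D
  proof -
    have CD: "C \<subseteq> omega_pow_set n" "D \<subseteq> omega_pow_set n"
      "omega_small n (sym_diff A C \<union> sym_diff B D)"
      using that by (auto simp: omega_pow_class_mem omega_pow_equiv_iff omega_small_Un)
    then have "omega_small n (sym_diff (f A B) (f C D))"
      using omega_small_subset f(2) by metis
    moreover have "f A B \<subseteq> omega_pow_set n" "f C D \<subseteq> omega_pow_set n"
      using A B CD f(1) by (meson Un_least order_trans)+
    ultimately show ?thesis
      using omega_pow_class_eq_iff by metis
  qed
  then show ?thesis
    using omega_pow_class_self[OF A] omega_pow_class_self[OF B] by blast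
qed

lemma mult_omega_pow_class:
  assumes "A \<subseteq> omega_pow_set n" "B \<subseteq> omega_pow_set n"
  shows "omega_pow_class n A \<otimes>\<^bsub>omega_pow_ring n\<^esub> omega_pow_class n B = omega_pow_class n (A \<inter> B)"
  using UN_omega_pow_class[OF assms, of "(\<inter>)"] by (auto simp: omega_pow_ring_def)

lemma add_omega_pow_class:
  assumes "A \<subseteq> omega_pow_set n" "B \<subseteq> omega_pow_set n"
  shows "omega_pow_class n A \<oplus>\<^bsub>omega_pow_ring n\<^esub> omega_pow_class n B = omega_pow_class n (sym_diff A B)"
  using UN_omega_pow_class[OF assms, of sym_diff] by (auto simp: omega_pow_ring_def)

lemma one_omega_pow_ring: "\<one>\<^bsub>omega_pow_ring n\<^esub> = omega_pow_class n (omega_pow_set n)"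
  and zero_omega_pow_ring: "\<zero>\<^bsub>omega_pow_ring n\<^esub> = omega_pow_class n {}"
  by (simp_all add: omega_pow_ring_def)

lemma cring_omega_pow_ring: "cring (omega_pow_ring n)"
proof -
  let ?R = "omega_pow_ring n" and ?S = "omega_pow_set n" and ?c = "omega_pow_class n"
  have sub: "sym_diff A B \<subseteq> ?S" "A \<inter> B \<subseteq> ?S" if "A \<subseteq> ?S" "B \<subseteq> ?S" for A B
    using that by auto
  note ops = mult_omega_pow_class add_omega_pow_class one_omega_pow_ring zero_omega_pow_ring
  have carrierE: "\<exists>A \<subseteq> ?S. x = ?c A" if "x \<in> carrier ?R" for x
    using that by (auto simp: carrier_omega_pow_ring)
  have carrierI: "?c A \<in> carrier ?R" if "A \<subseteq> ?S" for A
    using that by (auto simp: carrier_omega_pow_ring)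
  have closed: "x \<oplus>\<^bsub>?R\<^esub> y \<in> carrier ?R" "x \<otimes>\<^bsub>?R\<^esub> y \<in> carrier ?R"
    if "x \<in> carrier ?R" "y \<in> carrier ?R" for x y
    using that[THEN carrierE] by (auto simp only: ops intro!: carrierI sub)
  have units: "\<zero>\<^bsub>?R\<^esub> \<in> carrier ?R" "\<one>\<^bsub>?R\<^esub> \<in> carrier ?R"
    by (simp_all add: ops carrierI)
  have comm: "x \<oplus>\<^bsub>?R\<^esub> y = y \<oplus>\<^bsub>?R\<^esub> x" "x \<otimes>\<^bsub>?R\<^esub> y = y \<otimes>\<^bsub>?R\<^esub> x"
    if "x \<in> carrier ?R" "y \<in> carrier ?R" for x y
    using that[THEN carrierE] by (auto simp only: ops Un_commute Int_commute)
  have ternary: "(x \<oplus>\<^bsub>?R\<^esub> y) \<oplus>\<^bsub>?R\<^esub> z = x \<oplus>\<^bsub>?R\<^esub> (y \<oplus>\<^bsub>?R\<^esub> z)"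
    "(x \<otimes>\<^bsub>?R\<^esub> y) \<otimes>\<^bsub>?R\<^esub> z = x \<otimes>\<^bsub>?R\<^esub> (y \<otimes>\<^bsub>?R\<^esub> z)"
    "(x \<oplus>\<^bsub>?R\<^esub> y) \<otimes>\<^bsub>?R\<^esub> z = x \<otimes>\<^bsub>?R\<^esub> z \<oplus>\<^bsub>?R\<^esub> y \<otimes>\<^bsub>?R\<^esub> z"
    if "x \<in> carrier ?R" "y \<in> carrier ?R" "z \<in> carrier ?R" for x y z
  proof -
    from that[THEN carrierE] obtain A B C
      where *: "A \<subseteq> ?S" "B \<subseteq> ?S" "C \<subseteq> ?S" "x = ?c A" "y = ?c B" "z = ?c C"
      by blast
    have sets: "sym_diff (sym_diff A B) C = sym_diff A (sym_diff B C)"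
      "sym_diff A B \<inter> C = sym_diff (A \<inter> C) (B \<inter> C)"
      by auto
    note sub' = sub[OF *(1,2)] sub[OF *(2,3)] sub[OF *(1,3)]
    show "(x \<oplus>\<^bsub>?R\<^esub> y) \<oplus>\<^bsub>?R\<^esub> z = x \<oplus>\<^bsub>?R\<^esub> (y \<oplus>\<^bsub>?R\<^esub> z)"
      by (simp only: * ops sub' sets)
    show "(x \<otimes>\<^bsub>?R\<^esub> y) \<otimes>\<^bsub>?R\<^esub> z = x \<otimes>\<^bsub>?R\<^esub> (y \<otimes>\<^bsub>?R\<^esub> z)"
      by (simp only: * ops sub' Int_assoc)
    show "(x \<oplus>\<^bsub>?R\<^esub> y) \<otimes>\<^bsub>?R\<^esub> z = x \<otimes>\<^bsub>?R\<^esub> z \<oplus>\<^bsub>?R\<^esub> y \<otimes>\<^bsub>?R\<^esub> z"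
      by (simp only: * ops sub' sets)
  qed
  \<comment> \<open>The last identity supplies the additive inverses: each element is its own
    negative.\<close>
  have unary: "\<zero>\<^bsub>?R\<^esub> \<oplus>\<^bsub>?R\<^esub> x = x" "\<one>\<^bsub>?R\<^esub> \<otimes>\<^bsub>?R\<^esub> x = x" "x \<oplus>\<^bsub>?R\<^esub> x = \<zero>\<^bsub>?R\<^esub>"
    if "x \<in> carrier ?R" for x
  proof -
    from that[THEN carrierE] obtain A where *: "A \<subseteq> ?S" "x = ?c A"
      by blast
    have sets: "sym_diff {} A = A" "?S \<inter> A = A" "sym_diff A A = {}"
      using *(1) by auto
    show "\<zero>\<^bsub>?R\<^esub> \<oplus>\<^bsub>?R\<^esub> x = x" "\<one>\<^bsub>?R\<^esub> \<otimes>\<^bsub>?R\<^esub> x = x" "x \<oplus>\<^bsub>?R\<^esub> x = \<zero>\<^bsub>?R\<^esub>"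
      using *(1) sets by (simp_all add: *(2) ops)
  qed
  show ?thesis
  proof (rule cringI)
    show "abelian_group ?R"
      by (rule abelian_groupI) (assumption | rule closed units ternary comm unary bexI)+
    show "comm_monoid ?R"
      by (rule comm_monoidI) (assumption | rule closed units ternary comm unary bexI)+
  qed (rule ternary)
qed

section \<open>An automaton for the ideal\<close>

text \<open>
  Position \<open>block_end q k\<close> is the supremum of the block \<open>{q @ r | length r = k}\<close> of type \<open>\<omega>\<^sup>k\<close>; every
  position but the first one is of this form, with \<open>k\<close> its limit rank.
\<close>

definition block_end :: "nat list \<Rightarrow> nat \<Rightarrow> nat list option"
  where "block_end q k =
    (if q = [] then None else Some (butlast q @ Suc (last q) # replicate k 0))"

lemma block_end_Nil [simp]: "block_end [] k = None"
  and block_end_snoc [simp]: "block_end (q @ [a]) k = Some (q @ Suc a # replicate k 0)"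
  by (simp_all add: block_end_def)

lemma not_lexn_replicate_zero: "(r, replicate k 0) \<notin> lexn less_than k"
proof (induction k arbitrary: r)
  case (Suc k)
  then show ?case
    by (auto elim: lexn_less_than_SucE)
qed simp

text \<open>Nothing is below a list of zeros, so the coordinates after the prefix cannot decide the
  comparison.\<close>

lemma lexn_block_end_iff:
  assumes "length p = Suc (length q) + k"
  shows "(p, q @ Suc a # replicate k 0) \<in> lexn less_than (Suc (length q) + k) \<longleftrightarrow>
    take (Suc (length q)) p = q @ [a] \<or> (take (Suc (length q)) p, q @ [a]) \<in> lexn less_than (Suc (length q))"
  using assms
proof (induction q arbitrary: p)
  case Nil
  then obtain b r where "p = b # r"
    by (cases p) auto
  then show ?case
    using Nil not_lexn_replicate_zero by auto
next
  case (Cons c q)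
  then obtain b r where p: "p = b # r"
    by (cases p) auto
  then show ?case
    using Cons.IH[of r] Cons.prems by auto
qed

text \<open>Treats both kinds of ends at once: for \<open>q = []\<close> the end is
  \<open>None\<close> and the prefix condition is void.\<close>

lemma pos_less_block_end_iff:
  assumes "length q + k = n"
  shows "pos_less n \<mu> (block_end q k) \<longleftrightarrow>
    (\<exists>p. \<mu> = Some p \<and> length p = n \<and>
      (take (length q) p = q \<or> (take (length q) p, q) \<in> lexn less_than (length q)))"
proof (cases \<mu>)
  case (Some p)
  show ?thesis
  proof (cases q rule: rev_cases)
    case Nil
    then show ?thesis
      using Some assms by (auto simp: omega_pow_set_def)
  next
    case (snoc q' a)
    have "length p = n" if "(p, q' @ Suc a # replicate k 0) \<in> lexn less_than n"
      using that lexn_length by blast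
    then show ?thesis
      using Some snoc lexn_block_end_iff[of p q' k a] assms by auto
  qed
qed simp

lemma nonzero_list_decomp:
  assumes "p \<noteq> replicate (length p) (0 :: nat)"
  obtains q a k where "p = q @ Suc a # replicate k 0"
proof -
  have "\<exists>q a k. p = q @ Suc a # replicate k 0"
    using assms
  proof (induction p rule: rev_induct)
    case (snoc b p)
    show ?case
    proof (cases b)
      case 0
      then have "p \<noteq> replicate (length p) 0"
        using snoc.prems by (metis length_append_singleton replicate_Suc replicate_append_same)
      then obtain q a k where "p = q @ Suc a # replicate k 0"
        using snoc.IH by blast
      then have "p @ [b] = q @ Suc a # replicate (Suc k) 0"
        using 0 by (simp add: replicate_append_same)
      then show ?thesis by blast
    next
      case (Suc a)
      then show ?thesis
        by (metis append_Cons append_Nil replicate_0)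
    qed
  qed simp
  then show thesis
    using that by blast
qed

lemma position_cases:
  assumes "\<beta> = None \<or> \<beta> = Some p \<and> length p = n"
  obtains (zero) "\<beta> = Some (replicate n 0)" | (block) q k where "length q + k = n" "\<beta> = block_end q k"
proof (cases \<beta>)
  case None
  then show ?thesis
    using block[of "[]" n] by simp
next
  case (Some p')
  then have p': "p' = p" "length p = n"
    using assms by auto
  show ?thesis
  proof (cases "p = replicate n 0")
    case True
    then show ?thesis
      using zero Some p' by simp
  next
    case False
    then obtain q a k where "p = q @ Suc a # replicate k 0"
      using nonzero_list_decomp p' by metis
    then show ?thesis
      using block[of "q @ [a]" k] Some p' by simp
  qed
qed

section \<open>Successor and limit positions\<close>

lemma pos_less_left_Some: "pos_less n \<mu> \<beta> \<Longrightarrow> \<exists>p. \<mu> = Some p \<and> length p = n"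
  by (cases \<mu>; cases \<beta>) (auto simp: omega_pow_set_def dest: lexn_length)

lemma pos_less_right_valid: "pos_less n \<mu> \<beta> \<Longrightarrow> \<exists>p. \<beta> = None \<or> \<beta> = Some p \<and> length p = n"
  by (cases \<mu>; cases \<beta>) (auto simp: omega_pow_set_def dest: lexn_length)

lemma not_pos_less_zero: "\<not> pos_less n \<mu> (Some (replicate n 0))"
  using not_lexn_replicate_zero by (cases \<mu>) auto

text \<open>With head 1 for \<open>None\<close> and head 0 for all other positions, the order maps
  into the lexicographic order on lists of length \<open>Suc n\<close>.\<close>

lemma wf_pos_less: "wf {(\<mu>, \<nu>). pos_less n \<mu> \<nu>}"
proof -
  define f where "f \<mu> = (case \<mu> of None \<Rightarrow> 1 # replicate n 0 | Some p \<Rightarrow> 0 # p)"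
    for \<mu> :: "nat list option"
  have "(f \<mu>, f \<nu>) \<in> lexn less_than (Suc n)" if "pos_less n \<mu> \<nu>" for \<mu> \<nu>
    using that lexn_length by (cases \<mu>; cases \<nu>) (fastforce simp: f_def omega_pow_set_def)+
  then have "{(\<mu>, \<nu>). pos_less n \<mu> \<nu>} \<subseteq> inv_image (lexn less_than (Suc n)) f"
    by (auto simp: inv_image_def)
  then show ?thesis
    using wf_subset wf_inv_image wf_lexn wf_less_than by metis
qed

lemma pos_less_block_end_self:
  "length p = n \<Longrightarrow> pos_less n (Some p) (block_end p 0)"
  using pos_less_block_end_iff[of p 0 n] by simp

lemma block_end_le:
  assumes "pos_less n (Some p) \<beta>" "n \<ge> 1"
  shows "\<beta> = block_end p 0 \<or> pos_less n (block_end p 0) \<beta>"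
proof -
  have len: "length p = n"
    using assms(1) pos_less_left_Some by auto
  then obtain q a where p: "p = q @ [a]"
    using assms(2) by (cases p rule: rev_cases) auto
  show ?thesis
  proof (cases \<beta>)
    case None
    then show ?thesis
      using p len by (simp add: omega_pow_set_def)
  next
    case (Some r)
    have lt: "(p, r) \<in> lexn less_than n"
      using assms(1) Some by simp
    then have r: "length r = n"
      using lexn_length by blast
    have "\<not> pos_less n (Some r) (block_end p 0)"
    proof
      assume "pos_less n (Some r) (block_end p 0)"
      then have "r = p \<or> (r, p) \<in> lexn less_than n"
        using r len pos_less_block_end_iff[of p 0 n "Some r"] by simp
      then show False
        using lt trans_lexn_less_than[OF lt, of p] lexn_less_than_not_refl by blast
    qed
    then show ?thesis
      using lexn_less_than_total[of r n "q @ [Suc a]"] Some r p len by auto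
  qed
qed

lemma pos_succ_imp_block_end:
  assumes "pos_succ n (Some p) \<beta>" "n \<ge> 1"
  shows "length p = n" "\<beta> = block_end p 0"
proof -
  have lt: "pos_less n (Some p) \<beta>"
    using assms(1) by (simp add: pos_succ_def)
  show len: "length p = n"
    using pos_less_left_Some[OF lt] by simp
  show "\<beta> = block_end p 0"
    using block_end_le[OF lt assms(2)] assms(1) pos_less_block_end_self[OF len]
    by (auto simp: pos_succ_def)
qed

lemma pos_succ_block_end:
  assumes "length p = n" "n \<ge> 1"
  shows "pos_succ n (Some p) (block_end p 0)"
proof -
  have "\<not> pos_less n r (block_end p 0)" if r: "pos_less n (Some p) r" for r
  proof
    assume lt: "pos_less n r (block_end p 0)"
    have "r = block_end p 0 \<or> pos_less n (block_end p 0) r"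
      using block_end_le[OF r assms(2)] .
    then show False
      using lt wf_pos_less[of n] by (auto dest: wf_not_sym wf_not_refl)
  qed
  then show ?thesis
    using pos_less_block_end_self[OF assms(1)] by (auto simp: pos_succ_def)
qed

lemma pos_limitE:
  assumes "pos_limit n \<beta>" "n \<ge> 1"
  obtains q j where "length q + Suc j = n" "\<beta> = block_end q (Suc j)"
proof -
  obtain \<mu> where \<mu>: "pos_less n \<mu> \<beta>"
    using assms(1) by (auto simp: pos_limit_def)
  obtain p where "\<beta> = None \<or> \<beta> = Some p \<and> length p = n"
    using pos_less_right_valid[OF \<mu>] by blast
  then show thesis
  proof (cases rule: position_cases)
    case zero
    then show ?thesis
      using \<mu> not_pos_less_zero by blast
  next
    case (block q k)
    have "k \<noteq> 0"
    proof
      assume "k = 0"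
      then have "pos_succ n (Some q) \<beta>"
        using block pos_succ_block_end[of q n] assms(2) by simp
      then show False
        using assms(1) by (auto simp: pos_limit_def)
    qed
    then show ?thesis
      using that block by (metis not0_implies_Suc)
  qed
qed

text \<open>The end of a block of rank \<open>Suc j\<close> sees cofinally only states of rank at
  most \<open>j\<close>, and at least one of rank \<open>j\<close>, so \<open>S\<close> determines
  \<open>j\<close>; the odd state of rank \<open>j\<close> is in \<open>S\<close> iff infinitely
  many sub-blocks are full. A successor position ends a one-point block, so its state is the truth
  value of the letter just read.\<close>

definition small_automaton ::
    "nat \<Rightarrow> 'a set \<Rightarrow> ('a \<Rightarrow> bool) \<Rightarrow> ('a, nat) ordinal_automaton"
  where "small_automaton n \<Sigma> \<phi> = \<lparr>
    alphabet = \<Sigma>,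
    states = {..<2 * n + 2},
    initial = 0,
    succ_trans = {(q, a, of_bool (\<phi> a)) | q a. q < 2 * n + 2 \<and> a \<in> \<Sigma>},
    lim_trans = {(S, 2 * Suc j + of_bool (2 * j + 1 \<in> S)) | S j.
      j < n \<and> S \<subseteq> {..<2 * j + 2} \<and> (2 * j \<in> S \<or> 2 * j + 1 \<in> S)},
    accepting = {2 * n}\<rparr>"

text \<open>
  The state at \<open>block_end q k\<close> is \<open>2k\<close> or \<open>2k + 1\<close>; it is odd iff the letters satisfying \<open>\<phi>\<close> form a
  set of full order type inside that block.
\<close>

definition trailing_zeros :: "nat list \<Rightarrow> nat"
  where "trailing_zeros p = length (takeWhile (\<lambda>i. i = 0) (rev p))"

definition block_state :: "('a \<Rightarrow> bool) \<Rightarrow> (nat list \<Rightarrow> 'a) \<Rightarrow> nat list \<Rightarrow> nat \<Rightarrow> nat"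
  where "block_state \<phi> w q k = 2 * k + of_bool (\<not> omega_small k {r. \<phi> (w (q @ r))})"

text \<open>Inverts \<open>block_end\<close>: the trailing zeros give the rank, and lowering the
  last nonzero coordinate gives the block. The all-zero position ends no block and gets the initial
  state.\<close>

definition small_run :: "nat \<Rightarrow> ('a \<Rightarrow> bool) \<Rightarrow> (nat list \<Rightarrow> 'a) \<Rightarrow> nat list option \<Rightarrow> nat"
  where "small_run n \<phi> w \<beta> = (case \<beta> of None \<Rightarrow> block_state \<phi> w [] n
    | Some p \<Rightarrow> let k = trailing_zeros p; l = length p - Suc k in
        if k = length p then 0 else block_state \<phi> w (take l p @ [p ! l - 1]) k)"

lemma trailing_zeros_simps [simp]:
  "trailing_zeros (q @ Suc a # replicate k 0) = k"
  "trailing_zeros (replicate k 0) = k"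
  by (simp_all add: trailing_zeros_def takeWhile_append)

lemma small_run_block_end:
  assumes "length q + k = n"
  shows "small_run n \<phi> w (block_end q k) = block_state \<phi> w q k"
  using assms by (cases q rule: rev_cases) (auto simp: small_run_def Let_def nth_append)

lemma small_run_zero: "small_run n \<phi> w (Some (replicate n 0)) = 0"
  by (simp add: small_run_def Let_def)

lemma block_state_div: "block_state \<phi> w q k div 2 = k"
  by (simp add: block_state_def)

text \<open>The ends of the sub-blocks \<open>q @ [a]\<close> are cofinal below the limit, and each
  position strictly between the start of a sub-block and the limit is the end of a block inside
  \<open>q\<close> of rank at most \<open>j\<close>. So full sub-blocks are infinite in number iff
  the odd state of rank \<open>j\<close> recurs cofinally.\<close>

lemma cofinal_states_small_run:
  fixes \<phi> :: "'a \<Rightarrow> bool" and w :: "nat list \<Rightarrow> 'a" and q :: "nat list" and j n :: nat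
  assumes n: "length q + Suc j = n"
  defines "S \<equiv> cofinal_states n (small_run n \<phi> w) (block_end q (Suc j))"
  shows "S \<subseteq> {..<2 * j + 2}" "2 * j \<in> S \<or> 2 * j + 1 \<in> S"
    "2 * j + 1 \<in> S \<longleftrightarrow> \<not> omega_small (Suc j) {r. \<phi> (w (q @ r))}"
proof -
  let ?\<beta> = "block_end q (Suc j)" and ?x = "small_run n \<phi> w"
  let ?bad = "\<lambda>a. \<not> omega_small j {r. \<phi> (w (q @ a # r))}"
  have below: "pos_less n (Some (q @ r)) ?\<beta>" if "length r = Suc j" for r
    using that n by (subst pos_less_block_end_iff) auto
  \<comment> \<open>Once past the start of a sub-block, a position below the end of block
    \<open>q\<close> cannot have a smaller prefix, so its prefix is \<open>q\<close>.\<close>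
  have above: "\<exists>r. \<nu> = Some (q @ r) \<and> length r = Suc j \<and> (b0 # replicate j 0, r) \<in> lexn less_than (Suc j)"
    if "pos_less n \<nu> ?\<beta>" "pos_less n (Some (q @ b0 # replicate j 0)) \<nu>" for \<nu> b0
  proof -
    from that(1) obtain p where p: "\<nu> = Some p" "length p = n"
      "take (length q) p = q \<or> (take (length q) p, q) \<in> lexn less_than (length q)"
      unfolding pos_less_block_end_iff[OF n] by blast
    have less: "(q @ b0 # replicate j 0, p) \<in> lexn less_than n"
      using that(2) p by simp
    have *: "(q @ s, p) \<in> lexn less_than (length q + k) \<Longrightarrow>
        take (length q) p = q \<or> (take (length q) p, q) \<in> lexn less_than (length q) \<Longrightarrow>
        \<exists>r. p = q @ r \<and> (s, r) \<in> lexn less_than k" for s k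
    proof (induction q arbitrary: p)
      case (Cons c q)
      from Cons.prems(1) obtain b p' where p: "p = b # p'"
        by (auto elim: lexn_less_than_SucE)
      then have "(q @ s, p') \<in> lexn less_than (length q + k)" "b = c"
        "take (length q) p' = q \<or> (take (length q) p', q) \<in> lexn less_than (length q)"
        using Cons.prems by auto
      then show ?case
        using Cons.IH[of p'] p by auto
    qed simp
    then obtain r where "p = q @ r" "(b0 # replicate j 0, r) \<in> lexn less_than (Suc j)"
      using less p(3) n by blast
    then show ?thesis
      using p lexn_length by blast
  qed
  have state: "?x (Some (q @ Suc a # replicate j 0)) = 2 * j + of_bool (?bad a)" for a
    using small_run_block_end[of "q @ [a]" j n \<phi> w] n by (simp add: block_state_def)
  \<comment> \<open>It suffices that \<open>a\<close> reaches the coordinate that follows the prefix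
    in \<open>\<mu>\<close>.\<close>
  have cofinal: "\<exists>b. \<forall>a\<ge>b. pos_less n \<mu> (Some (q @ Suc a # replicate j 0))" if "pos_less n \<mu> ?\<beta>" for \<mu>
  proof -
    from that obtain p where p: "\<mu> = Some p" "length p = n"
      "take (length q) p = q \<or> (take (length q) p, q) \<in> lexn less_than (length q)"
      unfolding pos_less_block_end_iff[OF n] by blast
    have "(p, q @ Suc a # replicate j 0) \<in> lexn less_than n" if "p ! length q \<le> a" for a
    proof -
      have "\<lbrakk>length p = length q + Suc j;
        take (length q) p = q \<or> (take (length q) p, q) \<in> lexn less_than (length q); p ! length q \<le> a\<rbrakk>
        \<Longrightarrow> (p, q @ Suc a # replicate j 0) \<in> lexn less_than (length q + Suc j)"
      proof (induction q arbitrary: p)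
        case Nil
        then show ?case by (cases p) auto
      next
        case (Cons c q)
        then show ?case by (cases p) auto
      qed
      then show ?thesis
        using p n that by simp
    qed
    then show ?thesis
      using p by auto
  qed
  have small_iff: "omega_small (Suc j) {r. \<phi> (w (q @ r))} \<longleftrightarrow> finite {a. ?bad a}"
    by simp
  have visit: "s \<in> S" if "infinite {a. 2 * j + of_bool (?bad a) = s}" for s
    unfolding S_def cofinal_states_def
  proof (intro CollectI allI impI)
    fix \<mu> assume "pos_less n \<mu> ?\<beta>"
    then obtain b where b: "\<forall>a\<ge>b. pos_less n \<mu> (Some (q @ Suc a # replicate j 0))"
      using cofinal by blast
    obtain a where "a \<ge> b" "2 * j + of_bool (?bad a) = s"
      using \<open>infinite {a. 2 * j + of_bool (?bad a) = s}\<close> by (auto simp: infinite_nat_iff_unbounded_le)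
    then show "\<exists>\<nu>. pos_less n \<nu> ?\<beta> \<and> pos_less n \<mu> \<nu> \<and> ?x \<nu> = s"
      using b below[of "Suc a # replicate j 0"] state by (intro exI[of _ "Some (q @ Suc a # replicate j 0)"]) auto
  qed
  have visited: "\<exists>r' a k. ?x (Some (q @ r' @ Suc a # replicate k 0)) = s \<and> length r' + k = j
      \<and> s = block_state \<phi> w (q @ r' @ [a]) k
      \<and> (b # replicate j 0, r' @ Suc a # replicate k 0) \<in> lexn less_than (Suc j)"
    if s: "s \<in> S" for s b
  proof -
    have "pos_less n (Some (q @ b # replicate j 0)) ?\<beta>"
      by (rule below) simp
    then obtain \<nu> where "pos_less n \<nu> ?\<beta>" "pos_less n (Some (q @ b # replicate j 0)) \<nu>" "?x \<nu> = s"
      using s unfolding S_def cofinal_states_def by blast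
    then obtain r where r: "?x (Some (q @ r)) = s" "length r = Suc j"
      "(b # replicate j 0, r) \<in> lexn less_than (Suc j)"
      using above by blast
    have "r \<noteq> replicate (length r) 0"
      using r not_lexn_replicate_zero by metis
    then obtain r' a k where r': "r = r' @ Suc a # replicate k 0"
      using nonzero_list_decomp by blast
    then show ?thesis
      using r n small_run_block_end[of "q @ r' @ [a]" k n \<phi> w] block_end_snoc[of "q @ r'" a k]
      by (intro exI[of _ r'] exI[of _ a] exI[of _ k]) auto
  qed
  show "S \<subseteq> {..<2 * j + 2}"
  proof
    fix s assume "s \<in> S"
    then obtain r' a k where "length r' + k = j" "s = block_state \<phi> w (q @ r' @ [a]) k"
      using visited by blast
    then show "s \<in> {..<2 * j + 2}"
      by (auto simp: block_state_def)
  qed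
  show iff: "2 * j + 1 \<in> S \<longleftrightarrow> \<not> omega_small (Suc j) {r. \<phi> (w (q @ r))}"
  proof
    assume "\<not> omega_small (Suc j) {r. \<phi> (w (q @ r))}"
    then show "2 * j + 1 \<in> S"
      by (intro visit) simp
  next
    assume S: "2 * j + 1 \<in> S"
    have "\<exists>a\<ge>b. ?bad a" for b
    proof -
      obtain r' a k where *: "length r' + k = j" "2 * j + 1 = block_state \<phi> w (q @ r' @ [a]) k"
        "(Suc b # replicate j 0, r' @ Suc a # replicate k 0) \<in> lexn less_than (Suc j)"
        using visited[OF S] by blast
      \<comment> \<open>Halving a state recovers its rank. Hence the odd state of rank
        \<open>j\<close> comes from no smaller block: \<open>r'\<close> is empty and sub-block
        \<open>a\<close> itself is full.\<close>
      have "k = (2 * j + 1) div 2"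
        by (simp only: *(2) block_state_div)
      then have "k = j"
        by simp
      then have "r' = []" "?bad a"
        using * by (auto simp: block_state_def split: if_splits)
      then show ?thesis
        using *(3) \<open>k = j\<close> by (intro exI[of _ a]) auto
    qed
    then have "infinite {a. ?bad a}"
      by (auto simp: infinite_nat_iff_unbounded_le)
    then show "\<not> omega_small (Suc j) {r. \<phi> (w (q @ r))}"
      by simp
  qed
  show "2 * j \<in> S \<or> 2 * j + 1 \<in> S"
  proof (cases "2 * j + 1 \<in> S")
    case False
    then have "finite {a. ?bad a}"
      using iff by simp
    then have "infinite (- {a. ?bad a})"
      using finite_compl infinite_UNIV_nat by auto
    moreover have "- {a. ?bad a} = {a. 2 * j + of_bool (?bad a) = 2 * j}"
      by auto
    ultimately show ?thesis
      using visit by metis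
  qed simp
qed

lemma is_run_small_run:
  assumes w: "w \<in> omega_pow_words n \<Sigma>" and "n \<ge> 1"
  shows "is_run n (small_automaton n \<Sigma> \<phi>) w (small_run n \<phi> w)"
  unfolding is_run_def
proof (intro conjI allI impI)
  show "small_run n \<phi> w (Some (replicate n 0)) = initial (small_automaton n \<Sigma> \<phi>)"
    by (simp add: small_automaton_def small_run_zero)
next
  fix p \<beta> assume "pos_succ n (Some p) \<beta>"
  then have p: "length p = n" "\<beta> = block_end p 0"
    using pos_succ_imp_block_end assms(2) by blast+
  have "small_run n \<phi> w \<beta> = of_bool (\<phi> (w p))"
    using p small_run_block_end[of p 0 n \<phi> w] by (simp add: block_state_def)
  moreover have "w p \<in> \<Sigma>"
    using w p by (auto simp: omega_pow_words_def omega_pow_set_def)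
  moreover have "small_run n \<phi> w (Some p) < 2 * n + 2"
  proof -
    have "trailing_zeros p \<le> n"
      using length_takeWhile_le[of _ "rev p"] p(1) by (simp add: trailing_zeros_def)
    moreover have "block_state \<phi> w q k < 2 * n + 2" if "k \<le> n" for q k
      using that by (simp add: block_state_def)
    ultimately show ?thesis
      by (simp add: small_run_def Let_def)
  qed
  ultimately show "(small_run n \<phi> w (Some p), w p, small_run n \<phi> w \<beta>)
      \<in> succ_trans (small_automaton n \<Sigma> \<phi>)"
    by (auto simp: small_automaton_def)
next
  fix \<beta> assume "pos_limit n \<beta>"
  then obtain q j where q: "length q + Suc j = n" "\<beta> = block_end q (Suc j)"
    using pos_limitE assms(2) by metis
  have "small_run n \<phi> w \<beta> = block_state \<phi> w q (Suc j)"
    using q small_run_block_end by metis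
  then show "(cofinal_states n (small_run n \<phi> w) \<beta>, small_run n \<phi> w \<beta>)
      \<in> lim_trans (small_automaton n \<Sigma> \<phi>)"
    using cofinal_states_small_run[OF q(1), of \<phi> w] q
    by (auto simp: small_automaton_def block_state_def intro!: exI[of _ j])
qed

text \<open>\<open>S\<close> meets \<open>{2 * j, 2 * j + 1}\<close> and has no larger element,
  which fixes \<open>j\<close> and thereby the target.\<close>

lemma lim_trans_small_automaton_functional:
  assumes "(S, s) \<in> lim_trans (small_automaton n \<Sigma> \<phi>)" "(S, t) \<in> lim_trans (small_automaton n \<Sigma> \<phi>)"
  shows "s = t"
proof -
  obtain i j where *: "s = 2 * Suc i + of_bool (2 * i + 1 \<in> S)" "t = 2 * Suc j + of_bool (2 * j + 1 \<in> S)"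
    "S \<subseteq> {..<2 * i + 2}" "S \<subseteq> {..<2 * j + 2}"
    "2 * i \<in> S \<or> 2 * i + 1 \<in> S" "2 * j \<in> S \<or> 2 * j + 1 \<in> S"
    using assms by (auto simp: small_automaton_def)
  have "2 * i < 2 * j + 2"
    using *(4,5) by (metis lessThan_iff subsetD add_lessD1)
  moreover have "2 * j < 2 * i + 2"
    using *(3,6) by (metis lessThan_iff subsetD add_lessD1)
  ultimately have "i = j"
    by simp
  then show ?thesis
    using *(1,2) by simp
qed

text \<open>A successor state depends only on the letter, a limit state only on states at earlier
  positions. So whether an accepting run exists can be read off from the single run
  \<open>small_run\<close> at \<open>None\<close>.\<close>

lemma small_automaton_run_unique:
  assumes x: "is_run n (small_automaton n \<Sigma> \<phi>) w x" and y: "is_run n (small_automaton n \<Sigma> \<phi>) w y"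
    and "n \<ge> 1" and "\<beta> = None \<or> \<beta> = Some p \<and> length p = n"
  shows "x \<beta> = y \<beta>"
  using wf_pos_less[of n] assms(4)
proof (induction \<beta> arbitrary: p)
  case (less \<beta>)
  have IH: "x \<mu> = y \<mu>" if "pos_less n \<mu> \<beta>" for \<mu>
    using less.IH that pos_less_left_Some[OF that] by auto
  show ?case
  proof (cases "pos_limit n \<beta>")
    case True
    have "cofinal_states n x \<beta> = cofinal_states n y \<beta>"
      unfolding cofinal_states_def using IH by (simp cong: conj_cong)
    moreover have "(cofinal_states n x \<beta>, x \<beta>) \<in> lim_trans (small_automaton n \<Sigma> \<phi>)"
      "(cofinal_states n y \<beta>, y \<beta>) \<in> lim_trans (small_automaton n \<Sigma> \<phi>)"
      using x y True by (auto simp: is_run_def)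
    ultimately show ?thesis
      using lim_trans_small_automaton_functional by metis
  next
    case no_limit: False
    show ?thesis
    proof (cases "\<exists>\<mu>. pos_succ n \<mu> \<beta>")
      case True
      then obtain r where "pos_succ n (Some r) \<beta>"
        using pos_less_left_Some by (metis pos_succ_def)
      then have "(x (Some r), w r, x \<beta>) \<in> succ_trans (small_automaton n \<Sigma> \<phi>)"
        "(y (Some r), w r, y \<beta>) \<in> succ_trans (small_automaton n \<Sigma> \<phi>)"
        using x y by (auto simp: is_run_def)
      then show ?thesis
        by (auto simp: small_automaton_def)
    next
      case False
      then have min: "\<not> pos_less n \<mu> \<beta>" for \<mu>
        using no_limit by (auto simp: pos_limit_def)
      from less.prems show ?thesis
      proof (cases rule: position_cases)
        case zero
        then show ?thesis
          using x y by (simp add: is_run_def)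
      next
        case (block q k)
        then have "pos_less n (Some (q @ replicate k 0)) \<beta>"
          by (simp add: pos_less_block_end_iff)
        then show ?thesis
          using min by blast
      qed
    qed
  qed
qed

lemma regular_lang_omega_small:
  assumes "finite \<Sigma>" "n \<ge> 1"
  shows "regular_lang n \<Sigma> {w \<in> omega_pow_words n \<Sigma>. omega_small n {p. \<phi> (w p)}}"
proof -
  let ?A = "small_automaton n \<Sigma> \<phi>"
  have alph: "alphabet ?A = \<Sigma>"
    by (simp add: small_automaton_def)
  have "wf_automaton ?A"
    using assms by (auto simp: wf_automaton_def small_automaton_def)
  moreover have "automaton_lang n ?A = {w \<in> omega_pow_words n \<Sigma>. omega_small n {p. \<phi> (w p)}}"
  proof -
    have "(\<exists>x. is_run n ?A w x \<and> x None \<in> accepting ?A) \<longleftrightarrow> omega_small n {p. \<phi> (w p)}"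
      if w: "w \<in> omega_pow_words n \<Sigma>" for w
    proof -
      have run: "is_run n ?A w (small_run n \<phi> w)"
        using is_run_small_run w assms(2) by blast
      have "(\<exists>x. is_run n ?A w x \<and> x None \<in> accepting ?A) \<longleftrightarrow> small_run n \<phi> w None \<in> accepting ?A"
        using small_automaton_run_unique[OF _ run assms(2), of _ None] run by metis
      also have "\<dots> \<longleftrightarrow> omega_small n {p. \<phi> (w p)}"
        by (simp add: small_run_def block_state_def small_automaton_def)
      finally show ?thesis .
    qed
    then show ?thesis
      unfolding automaton_lang_def alph by blast
  qed
  ultimately show ?thesis
    unfolding regular_lang_def using alph by blast
qed

text \<open>Convolution maps tuples of words bijectively to words over the product alphabet, and
  there the relation becomes the language of \<open>small_automaton\<close> for a predicate on
  tuples of letters.\<close>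

lemma regular_rel_omega_small:
  assumes "finite \<Sigma>" "n \<ge> 1"
  shows "regular_rel n \<Sigma> k
    {ws. length ws = k \<and> set ws \<subseteq> omega_pow_words n \<Sigma> \<and> omega_small n {p. \<phi> (map (\<lambda>w. w p) ws)}}"
    (is "regular_rel n \<Sigma> k ?R")
proof -
  let ?T = "{as. length as = k \<and> set as \<subseteq> \<Sigma>}"
  have fin: "finite ?T"
    using finite_lists_length_eq[OF assms(1)] by (simp add: conj_commute)
  have "convolution n ` ?R = {v \<in> omega_pow_words n ?T. omega_small n {p. \<phi> (v p)}}"
  proof (intro subset_antisym subsetI)
    fix v assume "v \<in> convolution n ` ?R"
    then obtain ws where ws: "length ws = k" "set ws \<subseteq> omega_pow_words n \<Sigma>"
      "omega_small n {p. \<phi> (map (\<lambda>w. w p) ws)}" "v = convolution n ws"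
      by blast
    have "v \<in> omega_pow_words n ?T"
      using ws by (fastforce simp: convolution_def omega_pow_words_def)
    moreover have "omega_small n {p. \<phi> (v p)}"
      using ws(3) by (subst omega_small_cong[where Q = "{p. \<phi> (map (\<lambda>w. w p) ws)}"])
        (auto simp: ws(4) convolution_def omega_pow_set_def)
    ultimately show "v \<in> {v \<in> omega_pow_words n ?T. omega_small n {p. \<phi> (v p)}}"
      by blast
  next
    fix v assume v: "v \<in> {v \<in> omega_pow_words n ?T. omega_small n {p. \<phi> (v p)}}"
    then have vT: "length (v p) = k \<and> set (v p) \<subseteq> \<Sigma>" if "p \<in> omega_pow_set n" for p
      using that by (auto simp: omega_pow_words_def)
    \<comment> \<open>The component words of \<open>v\<close>, made extensional by the
      restriction.\<close>
    define ws where "ws = map (\<lambda>i. restrict (\<lambda>p. v p ! i) (omega_pow_set n)) [0..<k]"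
    have val: "map (\<lambda>w. w p) ws = v p" if "p \<in> omega_pow_set n" for p
      using that vT by (auto simp: ws_def intro!: nth_equalityI)
    have "set ws \<subseteq> omega_pow_words n \<Sigma>"
      using vT by (fastforce simp: ws_def omega_pow_words_def)
    moreover have "omega_small n {p. \<phi> (map (\<lambda>w. w p) ws)}"
      using v by (subst omega_small_cong[where Q = "{p. \<phi> (v p)}"])
        (auto simp: val omega_pow_set_def)
    moreover have "convolution n ws = v"
    proof
      fix p
      have "v \<in> omega_pow_set n \<rightarrow>\<^sub>E ?T"
        using v by (simp add: omega_pow_words_def)
      then show "convolution n ws p = v p"
        using PiE_arb[of v _ _ p] val[of p]
        by (cases "p \<in> omega_pow_set n") (simp_all add: convolution_def)
    qed
    moreover have "length ws = k"
      by (simp add: ws_def)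
    ultimately have "ws \<in> ?R" "v = convolution n ws"
      by simp_all
    then show "v \<in> convolution n ` ?R"
      by (rule rev_image_eqI)
  qed
  then have "regular_lang n ?T (convolution n ` ?R)"
    using regular_lang_omega_small[OF fin assms(2), of \<phi>] by simp
  then show ?thesis
    unfolding regular_rel_def by blast
qed

text \<open>Binary words present sets as characteristic functions. Equality of classes, both
  operations and the unit then all say that a set of erroneous positions, recognizable letter by
  letter, is small; the predicates given to \<open>rel\<close> describe these errors.\<close>

lemma omega_pow_automatic_ring:
  assumes n: "n \<ge> 1"
  shows "omega_pow_automatic n (carrier (omega_pow_ring n)) (ring_relations (omega_pow_ring n))"
proof -
  let ?R = "omega_pow_ring n" and ?\<Sigma> = "{0, 1} :: nat set"
  let ?D = "omega_pow_words n ?\<Sigma>"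
  define U where "U u = {p \<in> omega_pow_set n. u p = (1::nat)}" for u
  define h where "h u = omega_pow_class n (U u)" for u
  have U: "U u \<subseteq> omega_pow_set n" for u
    by (auto simp: U_def)
  have fin: "finite ?\<Sigma>" by simp
  have hD: "h ` ?D = carrier ?R"
  proof -
    have "omega_pow_class n A \<in> h ` ?D" if A: "A \<subseteq> omega_pow_set n" for A
    proof -
      define u where "u = restrict (\<lambda>p. of_bool (p \<in> A) :: nat) (omega_pow_set n)"
      have "U u = A"
        using A by (auto simp: U_def u_def)
      moreover have "u \<in> ?D"
        by (auto simp: u_def omega_pow_words_def)
      ultimately show ?thesis
        by (auto simp: h_def)
    qed
    then show ?thesis
      using U by (auto simp: carrier_omega_pow_ring h_def)
  qed
  have h_eq: "h u = omega_pow_class n B \<longleftrightarrow> omega_small n {p. (u p = 1) \<noteq> (p \<in> B)}"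
    if "B \<subseteq> omega_pow_set n" for u B
    using that U[of u] unfolding h_def
    by (subst omega_pow_class_eq_iff) (auto simp: U_def omega_pow_set_def intro!: omega_small_cong)
  have rel: "regular_rel n ?\<Sigma> k {ws. length ws = k \<and> set ws \<subseteq> ?D \<and> map h ws \<in> Q}"
    if "\<And>ws. length ws = k \<Longrightarrow> set ws \<subseteq> ?D \<Longrightarrow> map h ws \<in> Q \<longleftrightarrow> omega_small n {p. \<phi> (map (\<lambda>w. w p) ws)}"
    for k Q \<phi>
  proof -
    have "{ws. length ws = k \<and> set ws \<subseteq> ?D \<and> map h ws \<in> Q}
        = {ws. length ws = k \<and> set ws \<subseteq> ?D \<and> omega_small n {p. \<phi> (map (\<lambda>w. w p) ws)}}"
      using that by blast
    then show ?thesis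
      using regular_rel_omega_small[OF fin n] by simp
  qed
  have hc: "h u \<in> carrier ?R" for u
    using U by (auto simp: carrier_omega_pow_ring h_def)
  have len3: "\<exists>u v x. ws = [u, v, x]" if "length ws = 3" for ws :: "(nat list \<Rightarrow> nat) list"
    using that by (auto simp: numeral_3_eq_3 length_Suc_conv)
  \<comment> \<open>For the constantly false predicate the smallness condition is void.\<close>
  have "regular_lang n ?\<Sigma> ?D"
    using regular_lang_omega_small[OF fin n, of "\<lambda>_. False"] by simp
  moreover have "regular_rel n ?\<Sigma> 2 {[u, v] | u v. u \<in> ?D \<and> v \<in> ?D \<and> h u = h v}"
  proof -
    have "{[u, v] | u v. u \<in> ?D \<and> v \<in> ?D \<and> h u = h v}
      = {ws. length ws = 2 \<and> set ws \<subseteq> ?D \<and> map h ws \<in> {xs. xs ! 0 = xs ! 1}}"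
      by (auto simp: numeral_2_eq_2 length_Suc_conv)
    moreover have "h u = h v \<longleftrightarrow> omega_small n {p. (u p = 1) \<noteq> (v p = 1)}" for u v
      unfolding h_def[of v]
      by (subst h_eq[OF U]) (auto simp: U_def omega_pow_set_def intro!: omega_small_cong)
    then have "regular_rel n ?\<Sigma> 2 {ws. length ws = 2 \<and> set ws \<subseteq> ?D \<and> map h ws \<in> {xs. xs ! 0 = xs ! 1}}"
      by (intro rel[where \<phi> = "\<lambda>as. (as ! 0 = 1) \<noteq> (as ! 1 = 1)"])
        (clarsimp simp: numeral_2_eq_2 length_Suc_conv)
    ultimately show ?thesis
      by simp
  qed
  moreover have "regular_rel n ?\<Sigma> 3 {ws. length ws = 3 \<and> set ws \<subseteq> ?D \<and>
      map h ws \<in> {[x, y, x \<oplus>\<^bsub>?R\<^esub> y] | x y. x \<in> carrier ?R \<and> y \<in> carrier ?R}}"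
  proof (rule rel[where \<phi> = "\<lambda>as. (as ! 2 = 1) \<noteq> ((as ! 0 = 1) \<noteq> (as ! 1 = 1))"])
    fix ws :: "(nat list \<Rightarrow> nat) list" assume "length ws = 3"
    then obtain u v x where ws: "ws = [u, v, x]"
      using len3 by blast
    have sub: "sym_diff (U u) (U v) \<subseteq> omega_pow_set n"
      using U by blast
    have "h u \<oplus>\<^bsub>?R\<^esub> h v = omega_pow_class n (sym_diff (U u) (U v))"
      using add_omega_pow_class[OF U U] by (simp add: h_def)
    then have "h x = h u \<oplus>\<^bsub>?R\<^esub> h v \<longleftrightarrow> omega_small n {p. (x p = 1) \<noteq> ((u p = 1) \<noteq> (v p = 1))}"
      by (simp add: h_eq[OF sub])
        (auto simp: U_def omega_pow_set_def intro!: omega_small_cong)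
    then show "map h ws \<in> {[x, y, x \<oplus>\<^bsub>?R\<^esub> y] | x y. x \<in> carrier ?R \<and> y \<in> carrier ?R}
      \<longleftrightarrow> omega_small n {p. (map (\<lambda>w. w p) ws ! 2 = 1) \<noteq>
            ((map (\<lambda>w. w p) ws ! 0 = 1) \<noteq> (map (\<lambda>w. w p) ws ! 1 = 1))}"
      using hc by (auto simp: ws)
  qed
  moreover have "regular_rel n ?\<Sigma> 3 {ws. length ws = 3 \<and> set ws \<subseteq> ?D \<and>
      map h ws \<in> {[x, y, x \<otimes>\<^bsub>?R\<^esub> y] | x y. x \<in> carrier ?R \<and> y \<in> carrier ?R}}"
  proof (rule rel[where \<phi> = "\<lambda>as. (as ! 2 = 1) \<noteq> ((as ! 0 = 1) \<and> (as ! 1 = 1))"])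
    fix ws :: "(nat list \<Rightarrow> nat) list" assume "length ws = 3"
    then obtain u v x where ws: "ws = [u, v, x]"
      using len3 by blast
    have sub: "U u \<inter> U v \<subseteq> omega_pow_set n"
      using U by blast
    have "h u \<otimes>\<^bsub>?R\<^esub> h v = omega_pow_class n (U u \<inter> U v)"
      using mult_omega_pow_class[OF U U] by (simp add: h_def)
    then have "h x = h u \<otimes>\<^bsub>?R\<^esub> h v \<longleftrightarrow> omega_small n {p. (x p = 1) \<noteq> ((u p = 1) \<and> (v p = 1))}"
      by (simp add: h_eq[OF sub])
        (auto simp: U_def omega_pow_set_def intro!: omega_small_cong)
    then show "map h ws \<in> {[x, y, x \<otimes>\<^bsub>?R\<^esub> y] | x y. x \<in> carrier ?R \<and> y \<in> carrier ?R}
      \<longleftrightarrow> omega_small n {p. (map (\<lambda>w. w p) ws ! 2 = 1) \<noteq>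
            ((map (\<lambda>w. w p) ws ! 0 = 1) \<and> (map (\<lambda>w. w p) ws ! 1 = 1))}"
      using hc by (auto simp: ws)
  qed
  moreover have "regular_rel n ?\<Sigma> 1 {ws. length ws = 1 \<and> set ws \<subseteq> ?D \<and> map h ws \<in> {[\<one>\<^bsub>?R\<^esub>]}}"
  proof (rule rel[where \<phi> = "\<lambda>as. as ! 0 \<noteq> 1"])
    fix ws :: "(nat list \<Rightarrow> nat) list" assume "length ws = 1"
    then obtain u where ws: "ws = [u]"
      by (auto simp: length_Suc_conv)
    have "h u = \<one>\<^bsub>?R\<^esub> \<longleftrightarrow> omega_small n {p. u p \<noteq> 1}"
      by (simp add: one_omega_pow_ring h_eq) (auto simp: omega_pow_set_def intro!: omega_small_cong)
    then show "map h ws \<in> {[\<one>\<^bsub>?R\<^esub>]} \<longleftrightarrow> omega_small n {p. map (\<lambda>w. w p) ws ! 0 \<noteq> 1}"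
      by (simp add: ws)
  qed
  ultimately show ?thesis
    unfolding omega_pow_automatic_def ring_relations_def using fin hD
    by (intro exI[of _ ?\<Sigma>] exI[of _ ?D] exI[of _ h]) auto
qed

section \<open>The Borel complexity of the ideals\<close>

text \<open>Clopenness in the product topology: the finite support may depend on \<open>X\<close>,
  and as it fixes membership and non-membership alike, both \<open>A\<close> and its complement are
  open.\<close>

definition clopen_sets :: "'a set set \<Rightarrow> bool"
  where "clopen_sets A \<longleftrightarrow>
    (\<forall>X. \<exists>S. finite S \<and> (\<forall>Y. Y \<inter> S = X \<inter> S \<longrightarrow> (Y \<in> A \<longleftrightarrow> X \<in> A)))"

text \<open>Continuity into a product of two-point discrete spaces, tested on the
  coordinates.\<close>

definition continuous_sets :: "('a set \<Rightarrow> 'b set) \<Rightarrow> bool"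
  where "continuous_sets F \<longleftrightarrow> (\<forall>q. clopen_sets {X. q \<in> F X})"

lemma clopen_setsD:
  assumes "clopen_sets A"
  obtains S where "finite S" "\<forall>Y. Y \<inter> S = X \<inter> S \<longrightarrow> (Y \<in> A \<longleftrightarrow> X \<in> A)"
  using assms unfolding clopen_sets_def by meson

lemma clopen_sets_const [simp]: "clopen_sets {}" "clopen_sets UNIV"
  by (auto simp: clopen_sets_def intro!: exI[of _ "{}"])

lemma clopen_sets_Compl: "clopen_sets A \<Longrightarrow> clopen_sets (- A)"
  unfolding clopen_sets_def Compl_iff by meson

lemma clopen_sets_member: "clopen_sets {X. q \<in> X}"
  unfolding clopen_sets_def by (intro allI exI[of _ "{q}"]) auto

lemma clopen_sets_Un:
  assumes "clopen_sets A" "clopen_sets B"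
  shows "clopen_sets (A \<union> B)"
  unfolding clopen_sets_def
proof
  fix X
  obtain S where S: "finite S" "\<forall>Y. Y \<inter> S = X \<inter> S \<longrightarrow> (Y \<in> A \<longleftrightarrow> X \<in> A)"
    using assms(1) by (rule clopen_setsD)
  obtain T where T: "finite T" "\<forall>Y. Y \<inter> T = X \<inter> T \<longrightarrow> (Y \<in> B \<longleftrightarrow> X \<in> B)"
    using assms(2) by (rule clopen_setsD)
  show "\<exists>S. finite S \<and> (\<forall>Y. Y \<inter> S = X \<inter> S \<longrightarrow> (Y \<in> A \<union> B \<longleftrightarrow> X \<in> A \<union> B))"
  proof (intro exI conjI allI impI)
    show "finite (S \<union> T)"
      using S T by simp
    fix Y assume "Y \<inter> (S \<union> T) = X \<inter> (S \<union> T)"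
    then have "Y \<inter> S = X \<inter> S" "Y \<inter> T = X \<inter> T"
      by blast+
    then show "Y \<in> A \<union> B \<longleftrightarrow> X \<in> A \<union> B"
      using S T by blast
  qed
qed

text \<open>Finitely many output coordinates decide membership in \<open>A\<close>, and each of them
  is decided by finitely many input coordinates.\<close>

lemma clopen_sets_vimage:
  assumes F: "continuous_sets F" and A: "clopen_sets A"
  shows "clopen_sets (F -` A)"
  unfolding clopen_sets_def
proof
  fix X
  obtain T where T: "finite T" "\<forall>Y. Y \<inter> T = F X \<inter> T \<longrightarrow> (Y \<in> A \<longleftrightarrow> F X \<in> A)"
    using A by (rule clopen_setsD)
  have "\<forall>q. \<exists>S. finite S \<and> (\<forall>Y. Y \<inter> S = X \<inter> S \<longrightarrow> (q \<in> F Y \<longleftrightarrow> q \<in> F X))"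
    using F unfolding continuous_sets_def clopen_sets_def mem_Collect_eq by blast
  then obtain S where S: "\<forall>q. finite (S q)"
    "\<forall>q Y. Y \<inter> S q = X \<inter> S q \<longrightarrow> (q \<in> F Y \<longleftrightarrow> q \<in> F X)"
    by metis
  show "\<exists>S. finite S \<and> (\<forall>Y. Y \<inter> S = X \<inter> S \<longrightarrow> (Y \<in> F -` A \<longleftrightarrow> X \<in> F -` A))"
  proof (intro exI conjI allI impI)
    show "finite (\<Union>q\<in>T. S q)"
      using T(1) S(1) by simp
    fix Y assume Y: "Y \<inter> (\<Union>q\<in>T. S q) = X \<inter> (\<Union>q\<in>T. S q)"
    have "q \<in> F Y \<longleftrightarrow> q \<in> F X" if "q \<in> T" for q
    proof -
      have "Y \<inter> S q = X \<inter> S q"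
        using Y that by blast
      then show ?thesis
        using S(2) by blast
    qed
    then have "F Y \<inter> T = F X \<inter> T"
      by blast
    then show "Y \<in> F -` A \<longleftrightarrow> X \<in> F -` A"
      using T(2)[rule_format, of "F Y"] by simp
  qed
qed

lemma continuous_sets_comp:
  assumes "continuous_sets F" "continuous_sets G"
  shows "continuous_sets (G \<circ> F)"
  unfolding continuous_sets_def
proof
  fix q
  have "clopen_sets (F -` {X. q \<in> G X})"
    using assms(2) by (intro clopen_sets_vimage[OF assms(1)]) (simp add: continuous_sets_def)
  then show "clopen_sets {X. q \<in> (G \<circ> F) X}"
    by (simp add: vimage_def)
qed

text \<open>The finite levels of the Borel hierarchy: \<open>sigma_level j\<close> is \<open>\<Sigma>\<^sup>0\<^sub>j\<close> for \<open>j \<ge> 1\<close>.\<close>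

primrec sigma_level :: "nat \<Rightarrow> 'a set set set"
  where
    "sigma_level 0 = {A. clopen_sets A}"
  | "sigma_level (Suc j) = {\<Union>k. - A k | A :: nat \<Rightarrow> _. range A \<subseteq> sigma_level j}"

lemma sigma_level_UN_Compl:
  "(\<And>k :: nat. A k \<in> sigma_level j) \<Longrightarrow> (\<Union>k. - A k) \<in> sigma_level (Suc j)"
  by auto

lemma sigma_level_SucE:
  assumes "A \<in> sigma_level (Suc j)"
  obtains B :: "nat \<Rightarrow> _" where "\<forall>k. B k \<in> sigma_level j" "A = (\<Union>k. - B k)"
  using assms by (auto simp: image_subset_iff)

declare sigma_level.simps(2) [simp del]

lemma sigma_level_Compl: "A \<in> sigma_level j \<Longrightarrow> - A \<in> sigma_level (Suc j)"
  using sigma_level_UN_Compl[of "\<lambda>_. A" j] by simp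

lemma sigma_level_Suc: "A \<in> sigma_level j \<Longrightarrow> A \<in> sigma_level (Suc j)"
proof (induction j arbitrary: A)
  case 0
  then have "- A \<in> sigma_level 0"
    by (simp add: clopen_sets_Compl)
  then show ?case
    using sigma_level_Compl by fastforce
next
  case (Suc j)
  obtain B :: "nat \<Rightarrow> _" where B: "\<And>k. B k \<in> sigma_level j" "A = (\<Union>k. - B k)"
    using Suc.prems by (rule sigma_level_SucE) blast
  then show ?case
    using sigma_level_UN_Compl[of B "Suc j"] Suc.IH by simp
qed

lemma sigma_level_mono: "i \<le> j \<Longrightarrow> A \<in> sigma_level i \<Longrightarrow> A \<in> sigma_level j"
  by (induction rule: dec_induct) (auto intro: sigma_level_Suc)

lemma sigma_level_UN:
  assumes "\<And>k :: nat. A k \<in> sigma_level (Suc j)"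
  shows "(\<Union>k. A k) \<in> sigma_level (Suc j)"
proof -
  have "\<forall>k. \<exists>B :: nat \<Rightarrow> _. (\<forall>i. B i \<in> sigma_level j) \<and> A k = (\<Union>i. - B i)"
  proof
    fix k
    obtain B :: "nat \<Rightarrow> _" where "\<And>i. B i \<in> sigma_level j" "A k = (\<Union>i. - B i)"
      using assms[of k] by (rule sigma_level_SucE) blast
    then show "\<exists>B :: nat \<Rightarrow> _. (\<forall>i. B i \<in> sigma_level j) \<and> A k = (\<Union>i. - B i)"
      by blast
  qed
  from choice[OF this] obtain B :: "nat \<Rightarrow> nat \<Rightarrow> _"
    where B': "\<forall>k. (\<forall>i. B k i \<in> sigma_level j) \<and> A k = (\<Union>i. - B k i)" ..
  have B: "B k i \<in> sigma_level j" "A k = (\<Union>i. - B k i)" for k i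
    using B'[rule_format, of k] by simp_all
  have "X \<in> (\<Union>k. A k) \<longleftrightarrow> X \<in> (\<Union>l. - (case prod_decode l of (k, i) \<Rightarrow> B k i))" for X
  proof
    assume "X \<in> (\<Union>k. A k)"
    then obtain k i where "X \<notin> B k i"
      by (auto simp: B(2))
    then show "X \<in> (\<Union>l. - (case prod_decode l of (k, i) \<Rightarrow> B k i))"
      by (intro UN_I[of "prod_encode (k, i)"]) auto
  next
    assume "X \<in> (\<Union>l. - (case prod_decode l of (k, i) \<Rightarrow> B k i))"
    then obtain l where l: "X \<notin> (case prod_decode l of (k, i) \<Rightarrow> B k i)"
      by (rule UN_E) simp
    obtain k i where "prod_decode l = (k, i)"
      by (cases "prod_decode l")
    then show "X \<in> (\<Union>k. A k)"
      using l by (auto simp: B(2))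
  qed
  then have "(\<Union>k. A k) = (\<Union>l. - (case prod_decode l of (k, i) \<Rightarrow> B k i))"
    by (rule Set.set_eqI)
  moreover have "(case prod_decode l of (k, i) \<Rightarrow> B k i) \<in> sigma_level j" for l
    using B(1) by (simp split: prod.split)
  ultimately show ?thesis
    using sigma_level_UN_Compl[of "\<lambda>l. case prod_decode l of (k, i) \<Rightarrow> B k i" j] by simp
qed

lemma sigma_level_Un:
  assumes "A \<in> sigma_level j" "B \<in> sigma_level j"
  shows "A \<union> B \<in> sigma_level j"
proof (cases j)
  case 0
  then show ?thesis
    using assms clopen_sets_Un by auto
next
  case (Suc i)
  have "(\<Union>k. if k = (0 :: nat) then A else B) \<in> sigma_level j"
    using assms sigma_level_UN[of "\<lambda>k. if k = 0 then A else B" i] Suc by simp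
  moreover have "(\<Union>k. if k = (0 :: nat) then A else B) = A \<union> B"
    by (auto split: if_splits)
  ultimately show ?thesis by simp
qed

lemma sigma_level_const [simp]: "{} \<in> sigma_level j" "UNIV \<in> sigma_level j"
  using sigma_level_mono[of 0 j "{}"] sigma_level_mono[of 0 j UNIV] by simp_all

lemma sigma_level_finite_UN:
  "finite S \<Longrightarrow> (\<And>i. i \<in> S \<Longrightarrow> A i \<in> sigma_level j) \<Longrightarrow> (\<Union>i\<in>S. A i) \<in> sigma_level j"
  by (induction S rule: finite_induct) (auto intro: sigma_level_Un)

lemma sigma_level_vimage:
  "continuous_sets F \<Longrightarrow> A \<in> sigma_level j \<Longrightarrow> F -` A \<in> sigma_level j"
proof (induction j arbitrary: A)
  case 0
  then show ?case
    by (simp add: clopen_sets_vimage)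
next
  case (Suc j)
  obtain B :: "nat \<Rightarrow> _" where B: "\<And>k. B k \<in> sigma_level j" "A = (\<Union>k. - B k)"
    using Suc.prems(2) by (rule sigma_level_SucE) blast
  have "F -` A = (\<Union>k. - (F -` B k))"
    by (auto simp: B(2))
  then show ?case
    using sigma_level_UN_Compl[of "\<lambda>k. F -` B k" j] Suc.IH[OF Suc.prems(1) B(1)] by simp
qed

text \<open>Disjoint pieces give every point of \<open>A\<close> a unique witness, and the counting
  in \<open>sigma_level_reducible_omega_small\<close> depends on this.\<close>

lemma sigma_level_disjoint_Suc:
  fixes A :: "'a set set"
  assumes A: "A \<in> sigma_level (Suc j)"
    and disj: "\<And>B :: 'a set set. B \<in> sigma_level j \<Longrightarrow>
      \<exists>C :: nat \<Rightarrow> _. (\<forall>l. - C l \<in> sigma_level j) \<and> disjoint_family C \<and> B = (\<Union>l. C l)"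
  shows "\<exists>P :: nat \<Rightarrow> _. (\<forall>k. - P k \<in> sigma_level j) \<and> disjoint_family P \<and> A = (\<Union>k. P k)"
proof -
  obtain B :: "nat \<Rightarrow> _" where B: "\<And>k. B k \<in> sigma_level j" "A = (\<Union>k. - B k)"
    using A by (rule sigma_level_SucE) blast
  have "\<forall>k. \<exists>C :: nat \<Rightarrow> _. (\<forall>l. - C l \<in> sigma_level j) \<and> disjoint_family C \<and> B k = (\<Union>l. C l)"
    by (intro allI disj B(1))
  from choice[OF this] obtain C :: "nat \<Rightarrow> nat \<Rightarrow> _"
    where C': "\<forall>k. (\<forall>l. - C k l \<in> sigma_level j) \<and> disjoint_family (C k) \<and> B k = (\<Union>l. C k l)" ..
  have C: "- C k l \<in> sigma_level j" "disjoint_family (C k)" "B k = (\<Union>l. C k l)" for k l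
    using C'[rule_format, of k] by simp_all
  \<comment> \<open>\<open>A\<close> is cut up according to the first \<open>k\<close> with \<open>X \<notin> B k\<close> and the pieces of the \<open>B i\<close>, \<open>i < k\<close>, that
    contain \<open>X\<close>.\<close>
  define P where "P ls = - B (length ls) \<inter> (\<Inter>i<length ls. C i (ls ! i))" for ls
  have "- P (list_decode k) \<in> sigma_level j" for k
  proof -
    have "- P ls = B (length ls) \<union> (\<Union>i<length ls. - C i (ls ! i))" for ls
      by (auto simp: P_def)
    then show ?thesis
      using B(1) C(1) by (simp add: sigma_level_Un sigma_level_finite_UN)
  qed
  moreover have "disjoint_family (\<lambda>k. P (list_decode k))"
  proof -
    have eq: "ls = ls'" if X: "X \<in> P ls" "X \<in> P ls'" for X ls ls'
    proof -
      have "\<not> length us < length vs" if "X \<in> P us" "X \<in> P vs" for us vs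
      proof
        assume "length us < length vs"
        then have "X \<in> C (length us) (vs ! length us)"
          using that(2) by (auto simp: P_def)
        then show False
          using that(1) C(3) by (auto simp: P_def)
      qed
      then have len: "length ls = length ls'"
        using X by (meson linorder_neqE_nat)
      moreover have "ls ! i = ls' ! i" if "i < length ls" for i
      proof (rule ccontr)
        assume "ls ! i \<noteq> ls' ! i"
        then have "C i (ls ! i) \<inter> C i (ls' ! i) = {}"
          using C(2)[of i] by (simp add: disjoint_family_on_def)
        then show False
          using X that len by (auto simp: P_def)
      qed
      ultimately show ?thesis
        by (simp add: list_eq_iff_nth_eq)
    qed
    show ?thesis
      unfolding disjoint_family_on_def using eq list_decode_eq by blast
  qed
  moreover have "A = (\<Union>k. P (list_decode k))"
  proof -
    have "X \<in> A \<longleftrightarrow> (\<exists>ls. X \<in> P ls)" for X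
    proof
      assume "\<exists>ls. X \<in> P ls"
      then show "X \<in> A"
        by (auto simp: P_def B(2))
    next
      assume "X \<in> A"
      then have ex: "\<exists>k. X \<notin> B k"
        by (auto simp: B(2))
      define k where "k = (LEAST k. X \<notin> B k)"
      have k: "X \<notin> B k" "\<And>i. i < k \<Longrightarrow> X \<in> B i"
        unfolding k_def using LeastI_ex[OF ex] not_less_Least by blast+
      have "\<forall>i<k. \<exists>l. X \<in> C i l"
        using k(2) C(3) by blast
      then obtain l where "\<forall>i<k. X \<in> C i (l i)"
        by metis
      then have "X \<in> P (map l [0..<k])"
        using k(1) by (simp add: P_def)
      then show "\<exists>ls. X \<in> P ls" ..
    qed
    moreover have "(\<exists>ls. X \<in> P ls) \<longleftrightarrow> (\<exists>k. X \<in> P (list_decode k))" for X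
      by (metis list_encode_inverse)
    ultimately show ?thesis
      by blast
  qed
  ultimately show ?thesis
    by (intro exI[of _ "\<lambda>k. P (list_decode k)"]) blast
qed

text \<open>The induction carries only the weak form, in which the complements of the pieces are at
  the level of \<open>A\<close> itself. Fed into \<open>sigma_level_disjoint_Suc\<close>, it gives
  pieces one level lower.\<close>

lemma sigma_level_disjoint:
  "A \<in> sigma_level j \<Longrightarrow>
    \<exists>C :: nat \<Rightarrow> _. (\<forall>l. - C l \<in> sigma_level j) \<and> disjoint_family C \<and> A = (\<Union>l. C l)"
proof (induction j arbitrary: A)
  case 0
  define C where "C l = (if l = (0 :: nat) then A else {})" for l
  have "- C l \<in> sigma_level 0" for l
    using 0 by (simp add: C_def clopen_sets_Compl)
  moreover have "disjoint_family C" "A = (\<Union>l. C l)"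
    by (auto simp: C_def disjoint_family_on_def split: if_splits)
  ultimately show ?case by blast
next
  case (Suc j)
  show ?case
    using sigma_level_disjoint_Suc[OF Suc.prems Suc.IH] sigma_level_Suc by blast
qed

text \<open>\<open>A\<close> is the union of the complements of the \<open>B b\<close>, and each
  \<open>B b\<close> is a disjoint union of pieces. By disjointness a point has at most one list of
  witnesses for membership in \<open>B 0\<close>, ..., \<open>B (l - 1)\<close> for each length
  \<open>l\<close>, so it has finitely many witness lists iff it leaves some \<open>B b\<close>,
  that is, iff it is in \<open>A\<close>. The induction hypothesis makes the section coded by a list
  non-small exactly when that list is a witness.\<close>

lemma sigma_level_reducible_omega_small:
  "A \<in> sigma_level (2 * m) \<Longrightarrow> \<exists>G. continuous_sets G \<and> (\<forall>X. X \<in> A \<longleftrightarrow> omega_small m (G X))"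
proof (induction m arbitrary: A)
  case 0
  define G where "G X = (if X \<in> A then {} else {[] :: nat list})" for X
  have "{X. q \<in> G X} = (if q = [] then - A else {})" for q
    by (auto simp: G_def)
  then have "continuous_sets G"
    using 0 by (simp add: continuous_sets_def clopen_sets_Compl)
  moreover have "X \<in> A \<longleftrightarrow> omega_small 0 (G X)" for X
    by (simp add: G_def)
  ultimately show ?case
    by blast
next
  case (Suc m)
  have "A \<in> sigma_level (Suc (Suc (2 * m)))"
    using Suc.prems by simp
  then obtain B :: "nat \<Rightarrow> _" where B: "\<And>b. B b \<in> sigma_level (Suc (2 * m))" "A = (\<Union>b. - B b)"
    by (rule sigma_level_SucE) blast
  have "\<forall>b. \<exists>P :: nat \<Rightarrow> _. (\<forall>k. - P k \<in> sigma_level (2 * m)) \<and> disjoint_family P \<and> B b = (\<Union>k. P k)"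
    by (intro allI sigma_level_disjoint_Suc[OF B(1) sigma_level_disjoint])
  from choice[OF this] obtain P :: "nat \<Rightarrow> nat \<Rightarrow> _"
    where P': "\<forall>b. (\<forall>k. - P b k \<in> sigma_level (2 * m)) \<and> disjoint_family (P b) \<and> B b = (\<Union>k. P b k)" ..
  have P: "- P b k \<in> sigma_level (2 * m)" "disjoint_family (P b)" "B b = (\<Union>k. P b k)" for b k
    using P'[rule_format, of b] by simp_all
  \<comment> \<open>\<open>Q ls\<close> collects the points for which \<open>ls\<close> is a list of
    witnesses.\<close>
  define Q where "Q ls = (\<Inter>i<length ls. P i (ls ! i))" for ls
  have "\<exists>G. continuous_sets G \<and> (\<forall>X. X \<in> - Q ls \<longleftrightarrow> omega_small m (G X))" for ls
  proof (rule Suc.IH)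
    have "- Q ls = (\<Union>i<length ls. - P i (ls ! i))"
      by (auto simp: Q_def)
    then show "- Q ls \<in> sigma_level (2 * m)"
      using P(1) by (simp add: sigma_level_finite_UN)
  qed
  from choice[OF allI[OF this]] obtain g
    where g': "\<forall>ls. continuous_sets (g ls) \<and> (\<forall>X. X \<in> - Q ls \<longleftrightarrow> omega_small m (g ls X))" ..
  have g: "continuous_sets (g ls)" "X \<notin> Q ls \<longleftrightarrow> omega_small m (g ls X)" for ls X
    using g'[rule_format, of ls] by simp_all
  define G where "G X = {a # p | a p. p \<in> g (list_decode a) X}" for X
  have "continuous_sets G"
    unfolding continuous_sets_def
  proof
    fix q :: "nat list"
    show "clopen_sets {X. q \<in> G X}"
    proof (cases q)
      case (Cons a p)
      then have "{X. q \<in> G X} = {X. p \<in> g (list_decode a) X}"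
        by (auto simp: G_def)
      then show ?thesis
        using g(1) by (simp add: continuous_sets_def)
    qed (simp add: G_def)
  qed
  moreover have "X \<in> A \<longleftrightarrow> omega_small (Suc m) (G X)" for X
  proof -
    have unique: "k = l" if "X \<in> P i k" "X \<in> P i l" for i k l
      using P(2)[of i] that by (auto simp: disjoint_family_on_def)
    define u where "u i = (SOME k. X \<in> P i k)" for i
    have u: "X \<in> P i (u i)" if "X \<in> B i" for i
      using that P(3) by (auto simp: u_def intro: someI)
    have ls_eq: "ls = map u [0..<length ls]" if "X \<in> Q ls" for ls
    proof (rule nth_equalityI)
      fix i assume i: "i < length ls"
      then have "X \<in> P i (ls ! i)"
        using that by (auto simp: Q_def)
      moreover from this have "X \<in> P i (u i)"
        by (auto simp: u_def intro: someI)
      ultimately show "ls ! i = map u [0..<length ls] ! i"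
        using unique i by simp
    qed simp
    have "finite {ls. X \<in> Q ls} \<longleftrightarrow> X \<in> A"
    proof
      assume "X \<in> A"
      then obtain b where b: "X \<notin> B b"
        by (auto simp: B(2))
      have "{ls. X \<in> Q ls} \<subseteq> (\<lambda>l. map u [0..<l]) ` {..b}"
      proof
        fix ls assume ls: "ls \<in> {ls. X \<in> Q ls}"
        have "length ls \<le> b"
        proof (rule ccontr)
          assume "\<not> length ls \<le> b"
          then have "X \<in> P b (ls ! b)"
            using ls by (auto simp: Q_def)
          then show False
            using b P(3) by auto
        qed
        then show "ls \<in> (\<lambda>l. map u [0..<l]) ` {..b}"
          using ls_eq[of ls] ls by blast
      qed
      then show "finite {ls. X \<in> Q ls}"
        using finite_subset by blast
    next
      assume fin: "finite {ls. X \<in> Q ls}"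
      show "X \<in> A"
      proof (rule ccontr)
        assume "X \<notin> A"
        then have "X \<in> P i (u i)" for i
          using u by (auto simp: B(2))
        then have "(\<lambda>l. map u [0..<l]) ` UNIV \<subseteq> {ls. X \<in> Q ls}"
          by (auto simp: Q_def)
        then have "finite (range (\<lambda>l. map u [0..<l]))"
          using fin finite_subset by blast
        moreover have "inj (\<lambda>l. map u [0..<l])"
          by (rule inj_on_inverseI[where g = length]) simp
        ultimately show False
          using finite_imageD infinite_UNIV_nat by blast
      qed
    qed
    moreover have "finite {ls. X \<in> Q ls} \<longleftrightarrow> finite {a. X \<in> Q (list_decode a)}"
    proof -
      have "{ls. X \<in> Q ls} = list_decode ` {a. X \<in> Q (list_decode a)}"
        by (auto simp: image_iff) (metis list_encode_inverse)
      then show ?thesis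
        by (simp add: finite_image_iff inj_list_decode)
    qed
    moreover have "{p. a # p \<in> G X} = g (list_decode a) X" for a
      by (auto simp: G_def)
    ultimately show ?thesis
      by (simp add: g(2)[symmetric])
  qed
  ultimately show ?case by blast
qed

text \<open>Each exponent adds "from some \<open>b\<close> on all sections are small", that is, one
  countable union and one countable intersection.\<close>

lemma omega_small_sigma_level: "{X. omega_small n X} \<in> sigma_level (2 * n)"
proof (induction n)
  case 0
  have "{X :: nat list set. [] \<notin> X} = - {X. [] \<in> X}"
    by auto
  then show ?case
    using clopen_sets_Compl[OF clopen_sets_member] by simp
next
  case (Suc n)
  define A where "A a = {X. omega_small n {p. a # p \<in> X}}" for a
  have A: "A a \<in> sigma_level (2 * n)" for a
  proof -
    have "continuous_sets (\<lambda>X. {p. a # p \<in> X})"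
      by (simp add: continuous_sets_def clopen_sets_member)
    from sigma_level_vimage[OF this Suc.IH] show ?thesis
      by (simp add: A_def vimage_def)
  qed
  \<comment> \<open>The filler \<open>UNIV\<close> turns the intersection over
    \<open>a \<ge> b\<close> into one over all \<open>a\<close>.\<close>
  have "X \<in> {X. omega_small (Suc n) X} \<longleftrightarrow> X \<in> (\<Union>b. - (\<Union>a. - (if a < b then UNIV else A a)))" for X
  proof -
    have "omega_small (Suc n) X \<longleftrightarrow> finite {a. X \<notin> A a}"
      by (simp add: A_def)
    also have "\<dots> \<longleftrightarrow> (\<exists>b. \<forall>a\<ge>b. X \<in> A a)"
      using infinite_nat_iff_unbounded_le[of "{a. X \<notin> A a}"] by auto
    also have "\<dots> \<longleftrightarrow> X \<in> (\<Union>b. - (\<Union>a. - (if a < b then UNIV else A a)))"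
      by (auto simp: not_less)
    finally show ?thesis by simp
  qed
  then have "{X. omega_small (Suc n) X} = (\<Union>b. - (\<Union>a. - (if a < b then UNIV else A a)))"
    by blast
  moreover have "(\<Union>b. - (\<Union>a. - (if a < b then UNIV else A a))) \<in> sigma_level (Suc (Suc (2 * n)))"
    by (intro sigma_level_UN_Compl) (simp add: A)
  ultimately show ?case by simp
qed

text \<open>Above a fixed prefix only the number of last coordinates counts, and an injection
  preserves whether it is finite. As \<open>\<sigma>\<close> reads the whole list, the new
  coordinate can depend on the stage at which the list is treated.\<close>

lemma omega_small_replace_last:
  assumes "inj \<sigma>"
  shows "omega_small (Suc n) {butlast p @ [\<sigma> p] | p. p \<in> Y \<and> length p = Suc n} \<longleftrightarrow> omega_small (Suc n) Y"
  using assms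
proof (induction n arbitrary: Y \<sigma>)
  case 0
  have "{a. \<not> omega_small 0 {q. a # q \<in> {butlast p @ [\<sigma> p] | p. p \<in> Y \<and> length p = Suc 0}}}
      = (\<lambda>b. \<sigma> [b]) ` {b. [b] \<in> Y}"
    by (auto simp: length_Suc_conv)
  moreover have "inj (\<lambda>b. \<sigma> [b])"
    using 0 by (auto simp: inj_def)
  ultimately show ?case
    by (simp add: finite_image_iff inj_on_subset)
next
  case (Suc n)
  have "{q. a # q \<in> {butlast p @ [\<sigma> p] | p. p \<in> Y \<and> length p = Suc (Suc n)}}
      = {butlast p @ [\<sigma> (a # p)] | p. p \<in> {q. a # q \<in> Y} \<and> length p = Suc n}" for a
  proof (intro subset_antisym subsetI)
    fix q assume "q \<in> {q. a # q \<in> {butlast p @ [\<sigma> p] | p. p \<in> Y \<and> length p = Suc (Suc n)}}"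
    then obtain p where p: "a # q = butlast p @ [\<sigma> p]" "p \<in> Y" "length p = Suc (Suc n)"
      by blast
    then obtain b p' where "p = b # p'" "length p' = Suc n"
      by (cases p) auto
    then show "q \<in> {butlast p @ [\<sigma> (a # p)] | p. p \<in> {q. a # q \<in> Y} \<and> length p = Suc n}"
      using p by (auto split: if_splits)
  next
    fix q assume "q \<in> {butlast p @ [\<sigma> (a # p)] | p. p \<in> {q. a # q \<in> Y} \<and> length p = Suc n}"
    then obtain p where "q = butlast p @ [\<sigma> (a # p)]" "a # p \<in> Y" "length p = Suc n"
      by blast
    then show "q \<in> {q. a # q \<in> {butlast p @ [\<sigma> p] | p. p \<in> Y \<and> length p = Suc (Suc n)}}"
      by (auto intro!: exI[of _ "a # p"])
  qed
  moreover have "inj (\<lambda>p. \<sigma> (a # p))" for a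
    using Suc.prems by (auto simp: inj_def)
  ultimately show ?case
    using Suc.IH by (simp only: omega_small.simps(2))
qed

text \<open>
  A strategy argument: \<open>X\<close> copies the output \<open>\<Phi> X\<close> while it is being computed; a membership that is
  decided late is copied to a position whose last coordinate is still free.
\<close>

lemma continuous_sets_omega_small_agree:
  assumes cont: "continuous_sets \<Phi>"
  shows "\<exists>X. omega_small (Suc n) X \<longleftrightarrow> omega_small (Suc n) (\<Phi> X)"
proof -
  define new where "new j s = butlast (list_decode j) @ [s]" for j s :: nat
  define hit where "hit j X \<longleftrightarrow> list_decode j \<in> \<Phi> X \<and> length (list_decode j) = Suc n" for j X
  \<comment> \<open>A stage consists of the positions put into the set so far and the finitely many
    positions whose membership is settled.\<close>
  define P where "P z \<longleftrightarrow> finite (snd z) \<and> fst z \<subseteq> snd z" for z :: "nat list set \<times> nat list set"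
  \<comment> \<open>Stage \<open>j\<close> settles enough positions to force whether the
    \<open>j\<close>-th list is in the output. A hit is copied to \<open>new j s\<close>, whose last
    coordinate exceeds those of all settled positions.\<close>
  define R where "R j s z z' \<longleftrightarrow> snd z \<subseteq> snd z' \<and> (\<forall>c\<in>snd z. last c < s) \<and> new j s \<in> snd z' \<and>
      fst z' = (if hit j (fst z) then insert (new j s) (fst z) else fst z) \<and>
      (\<forall>Y. Y \<inter> snd z' = fst z' \<inter> snd z' \<longrightarrow> (hit j Y \<longleftrightarrow> hit j (fst z)))" for j s z z'
  have step: "\<exists>z'. P z' \<and> (\<exists>s. R j s z z')" if "P z" for z j
  proof -
    obtain X C where z: "z = (X, C)"
      by (cases z)
    obtain S where S: "finite S"
      "\<forall>Y. Y \<inter> S = X \<inter> S \<longrightarrow> (Y \<in> {X. list_decode j \<in> \<Phi> X} \<longleftrightarrow> X \<in> {X. list_decode j \<in> \<Phi> X})"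
      using cont unfolding continuous_sets_def by (meson clopen_setsD)
    have "finite (last ` (C \<union> S))"
      using that z S by (simp add: P_def)
    then obtain s where s: "\<forall>c\<in>last ` (C \<union> S). c < s"
      by (metis finite_nat_set_iff_bounded)
    define C' where "C' = insert (new j s) (C \<union> S)"
    define X' where "X' = (if hit j X then insert (new j s) X else X)"
    have "new j s \<notin> S"
      using s by (force simp: new_def)
    \<comment> \<open>The new position avoids the support \<open>S\<close>, so copying the answer
      cannot change the answer.\<close>
    then have X'S: "X' \<inter> S = X \<inter> S"
      by (auto simp: X'_def)
    have "hit j Y \<longleftrightarrow> hit j X" if "Y \<inter> C' = X' \<inter> C'" for Y
    proof -
      have "Y \<inter> S = X' \<inter> S"
        using that by (auto simp: C'_def)
      then show ?thesis
        using S(2)[rule_format, of Y] X'S by (simp add: hit_def)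
    qed
    moreover have "C \<subseteq> C'" "\<forall>c\<in>C. last c < s" "new j s \<in> C'"
      using s by (auto simp: C'_def)
    ultimately have "R j s z (X', C')"
      unfolding R_def z fst_conv snd_conv X'_def by blast
    moreover have "P (X', C')"
      using that S(1) by (auto simp: P_def z C'_def X'_def)
    ultimately show ?thesis by blast
  qed
  have "P ({}, {})"
    by (simp add: P_def)
  then have "\<exists>z. \<forall>j. (P (z j) \<and> (j = 0 \<longrightarrow> z j = ({}, {}))) \<and> (\<exists>s. R j s (z j) (z (Suc j)))"
    using step by (intro dependent_nat_choice) auto
  then obtain z where z: "\<And>j. P (z j)" "\<And>j. \<exists>s. R j s (z j) (z (Suc j))" "z 0 = ({}, {})"
    by blast
  from choice[OF allI[OF z(2)]] obtain s where R: "\<forall>j. R j (s j) (z j) (z (Suc j))" ..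
  define C where "C j = snd (z j)" for j
  define X where "X j = fst (z j)" for j
  have XC: "X j \<subseteq> C j" for j
    using z(1)[of j] by (simp add: P_def X_def C_def)
  have C_Suc: "C j \<subseteq> C (Suc j)" and fresh: "\<And>c. c \<in> C j \<Longrightarrow> last c < s j"
    and new_C: "new j (s j) \<in> C (Suc j)"
    and X_Suc: "X (Suc j) = (if hit j (X j) then insert (new j (s j)) (X j) else X j)"
    and hit_X: "\<And>Y. Y \<inter> C (Suc j) = X (Suc j) \<inter> C (Suc j) \<Longrightarrow> hit j Y \<longleftrightarrow> hit j (X j)" for j
    using R[rule_format, of j] unfolding R_def X_def C_def by blast+
  have C_mono: "C i \<subseteq> C j" if "i \<le> j" for i j
    using C_Suc that by (rule lift_Suc_mono_le)
  have X_mono: "X i \<subseteq> X j" if "i \<le> j" for i j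
    using that by (rule lift_Suc_mono_le[rotated]) (auto simp: X_Suc)
  have X_C: "X i \<inter> C j = X j" if "j \<le> i" for i j
    using that
  proof (induction i rule: dec_induct)
    case base
    then show ?case
      using XC by blast
  next
    case (step i)
    have "new i (s i) \<notin> C j"
      using fresh[of "new i (s i)" i] C_mono[OF step.hyps(1)] by (auto simp: new_def)
    then show ?case
      using step.IH by (auto simp: X_Suc)
  qed
  define Z where "Z = (\<Union>j. X j)"
  have ZC: "Z \<inter> C j = X j" for j
  proof (intro subset_antisym subsetI)
    fix c assume "c \<in> Z \<inter> C j"
    then obtain i where "c \<in> X i" "c \<in> C j"
      by (auto simp: Z_def)
    then have "c \<in> X (max i j) \<inter> C j"
      using X_mono[of i "max i j"] by auto
    then show "c \<in> X j"
      using X_C[of j "max i j"] by simp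
  qed (use XC in \<open>auto simp: Z_def\<close>)
  have hit_Z: "hit j Z \<longleftrightarrow> hit j (X j)" for j
    using hit_X ZC X_C by (metis order_refl)
  have Z_iff: "c \<in> Z \<longleftrightarrow> (\<exists>j. hit j Z \<and> c = new j (s j))" for c
  proof
    assume "c \<in> Z"
    then obtain i where "c \<in> X i"
      by (auto simp: Z_def)
    then show "\<exists>j. hit j Z \<and> c = new j (s j)"
    proof (induction i)
      case 0
      then show ?case
        using z(3) by (simp add: X_def)
    next
      case (Suc i)
      then show ?case
        by (auto simp: X_Suc hit_Z split: if_splits)
    qed
  next
    assume "\<exists>j. hit j Z \<and> c = new j (s j)"
    then obtain j where "hit j (X j)" "c = new j (s j)"
      using hit_Z by blast
    then have "c \<in> X (Suc j)"
      by (simp add: X_Suc)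
    then show "c \<in> Z"
      by (auto simp: Z_def)
  qed
  \<comment> \<open>\<open>new j (s j)\<close> is settled after stage \<open>j\<close> and has last
    coordinate \<open>s j\<close>, which the next choice must exceed.\<close>
  have "s j < s (Suc j)" for j
    using fresh[OF new_C] by (simp add: new_def)
  then have "strict_mono s"
    by (simp add: strict_mono_Suc_iff)
  then have inj: "inj (\<lambda>p. s (list_encode p))"
    by (auto simp: inj_def strict_mono_eq list_encode_eq)
  \<comment> \<open>\<open>Z\<close> is a fixed point of the map up to the injective change of last
    coordinates.\<close>
  have "Z = {butlast p @ [s (list_encode p)] | p. p \<in> \<Phi> Z \<and> length p = Suc n}"
  proof (intro subset_antisym subsetI)
    fix c assume "c \<in> Z"
    then obtain j where "hit j Z" "c = new j (s j)"
      using Z_iff by blast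
    then show "c \<in> {butlast p @ [s (list_encode p)] | p. p \<in> \<Phi> Z \<and> length p = Suc n}"
      by (intro CollectI exI[of _ "list_decode j"]) (simp add: hit_def new_def)
  next
    fix c assume "c \<in> {butlast p @ [s (list_encode p)] | p. p \<in> \<Phi> Z \<and> length p = Suc n}"
    then obtain p where "p \<in> \<Phi> Z" "length p = Suc n" "c = butlast p @ [s (list_encode p)]"
      by blast
    then show "c \<in> Z"
      unfolding Z_iff by (intro exI[of _ "list_encode p"]) (simp add: hit_def new_def)
  qed
  then show ?thesis
    using omega_small_replace_last[OF inj, of n "\<Phi> Z"] by metis
qed

lemma no_continuous_reduction:
  assumes "n < m" "n \<ge> 1" "continuous_sets F"
  shows "\<exists>X. \<not> (omega_small m X \<longleftrightarrow> omega_small n (F X))"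
proof (rule ccontr)
  assume neg: "\<not> ?thesis"
  \<comment> \<open>From \<open>n < m\<close>: the complement is at level \<open>2 * n + 1\<close>,
    which is below \<open>2 * m\<close>.\<close>
  have "- {X. omega_small n X} \<in> sigma_level (2 * m)"
    using sigma_level_mono[OF _ sigma_level_Compl[OF omega_small_sigma_level[of n]]] assms(1) by simp
  then obtain G where G: "continuous_sets G" "\<And>X. \<not> omega_small n X \<longleftrightarrow> omega_small m (G X)"
    using sigma_level_reducible_omega_small by fastforce
  have "continuous_sets (F \<circ> G)"
    using continuous_sets_comp G(1) assms(3) by blast
  then obtain X where "omega_small n X \<longleftrightarrow> omega_small n ((F \<circ> G) X)"
    using continuous_sets_omega_small_agree[of "F \<circ> G" "n - 1"] assms(2) by auto
  moreover have "omega_small m (G X) \<longleftrightarrow> omega_small n (F (G X))"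
    using neg by blast
  ultimately show False
    using G(2)[of X] by simp
qed

section \<open>Non-isomorphism under AT\<close>

text \<open>Skolem form of the nested quantifiers: \<open>g\<close> gives at each prefix a threshold
  from which on the sections are small. One existential over functions, followed by a condition on
  each list separately, is the shape needed for analyticity.\<close>

lemma omega_small_iff_bound:
  "omega_small n Y \<longleftrightarrow> (\<exists>g. \<forall>p\<in>Y. length p = n \<longrightarrow> (\<exists>i<n. p ! i < g (take i p)))"
proof (induction n arbitrary: Y)
  case (Suc n)
  show ?case
  proof
    assume "omega_small (Suc n) Y"
    then obtain b where b: "\<forall>a\<in>{a. \<not> omega_small n {p. a # p \<in> Y}}. a < b"
      by (metis finite_nat_set_iff_bounded omega_small.simps(2))
    have "\<forall>a. \<exists>g. b \<le> a \<longrightarrow> (\<forall>p\<in>{p. a # p \<in> Y}. length p = n \<longrightarrow> (\<exists>i<n. p ! i < g (take i p)))"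
      using b Suc.IH by (metis (mono_tags, lifting) mem_Collect_eq not_le)
    from choice[OF this] obtain g where
      g: "\<forall>a. b \<le> a \<longrightarrow> (\<forall>p\<in>{p. a # p \<in> Y}. length p = n \<longrightarrow> (\<exists>i<n. p ! i < g a (take i p)))" ..
    \<comment> \<open>Threshold \<open>b\<close> at the root, and above head \<open>a\<close> the
      function for the section at \<open>a\<close>.\<close>
    define h where "h q = (case q of [] \<Rightarrow> b | a # q' \<Rightarrow> g a q')" for q
    have "\<exists>i<Suc n. p ! i < h (take i p)" if p: "p \<in> Y" "length p = Suc n" for p
    proof -
      obtain a q where aq: "p = a # q"
        using p(2) by (cases p) auto
      show ?thesis
      proof (cases "a < b")
        case True
        then show ?thesis
          by (intro exI[of _ 0]) (simp add: aq h_def)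
      next
        case False
        then obtain i where "i < n" "q ! i < g a (take i q)"
          using g[rule_format, of a q] p aq by auto
        then show ?thesis
          by (intro exI[of _ "Suc i"]) (simp add: aq h_def)
      qed
    qed
    then show "\<exists>g. \<forall>p\<in>Y. length p = Suc n \<longrightarrow> (\<exists>i<Suc n. p ! i < g (take i p))"
      by blast
  next
    assume "\<exists>g. \<forall>p\<in>Y. length p = Suc n \<longrightarrow> (\<exists>i<Suc n. p ! i < g (take i p))"
    then obtain g where g: "\<forall>p\<in>Y. length p = Suc n \<longrightarrow> (\<exists>i<Suc n. p ! i < g (take i p))" ..
    have "omega_small n {p. a # p \<in> Y}" if a: "a \<ge> g []" for a
      unfolding Suc.IH
    proof (intro exI[of _ "\<lambda>q. g (a # q)"] ballI impI)
      fix p assume p: "p \<in> {p. a # p \<in> Y}" "length p = n"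
      then obtain i where i: "i < Suc n" "(a # p) ! i < g (take i (a # p))"
        using g[rule_format, of "a # p"] by auto
      then show "\<exists>i<n. p ! i < g (a # take i p)"
        using a by (cases i) auto
    qed
    then have "{a. \<not> omega_small n {p. a # p \<in> Y}} \<subseteq> {..<g []}"
      by (auto simp: not_le[symmetric])
    then show "omega_small (Suc n) Y"
      using finite_subset by auto
  qed
qed (auto intro: ccontr)

section \<open>Topological continuity and analyticity\<close>

lemma continuous_map_cantor_member:
  "continuous_map cantor_topology (discrete_topology UNIV) (\<lambda>X. k \<in> X)"
proof -
  have "continuous_map (product_topology (\<lambda>_. discrete_topology UNIV) UNIV) (discrete_topology UNIV)
      (\<lambda>f :: nat \<Rightarrow> bool. f k)"
    by (rule continuous_map_product_projection) simp
  then have "continuous_map cantor_topology (discrete_topology UNIV) ((\<lambda>f. f k) \<circ> (\<lambda>X n. n \<in> X))"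
    unfolding cantor_topology_def by (rule continuous_map_pullback)
  then show ?thesis
    by (simp add: comp_def)
qed

lemma topspace_cantor_topology [simp]: "topspace cantor_topology = UNIV"
  by (simp add: cantor_topology_def topspace_pullback_topology)

lemma topspace_baire_topology [simp]: "topspace baire_topology = UNIV"
  by (simp add: baire_topology_def)

lemma continuous_map_baire_component:
  "continuous_map baire_topology (discrete_topology UNIV) (\<lambda>g. g k)"
  unfolding baire_topology_def by (rule continuous_map_product_projection) simp

text \<open>The bounding function, read on codes of prefixes, is the point of Baire space that is
  projected away. For a fixed list the condition on the set and the function involves finitely many
  coordinates; the intersection over all lists is closed.\<close>

lemma analytic_omega_small: "analytic {X. omega_small n (list_decode ` X)}"
proof -
  let ?T = "prod_topology cantor_topology baire_topology"
  have mem: "closedin ?T {z. (list_encode p \<in> fst z) \<in> B}" for p B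
  proof -
    have "continuous_map ?T (discrete_topology UNIV) ((\<lambda>X. list_encode p \<in> X) \<circ> fst)"
      using continuous_map_fst continuous_map_cantor_member by (rule continuous_map_compose)
    from closedin_continuous_map_preimage[OF this, of B] show ?thesis
      by simp
  qed
  have comp: "closedin ?T {z. snd z k \<in> B}" for k B
  proof -
    have "continuous_map ?T (discrete_topology UNIV) ((\<lambda>g. g k) \<circ> snd)"
      using continuous_map_snd continuous_map_baire_component by (rule continuous_map_compose)
    from closedin_continuous_map_preimage[OF this, of B] show ?thesis
      by simp
  qed
  define C where "C p = {z. (list_encode p \<in> fst z) \<in> {False}} \<union>
    (\<Union>i<n. {z. snd z (list_encode (take i p)) \<in> {p ! i<..}})" for p
  have "closedin ?T (C p)" for p
    unfolding C_def
  proof (intro closedin_Un mem closedin_Union)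
    fix D :: "(nat set \<times> (nat \<Rightarrow> nat)) set"
    assume "D \<in> (\<lambda>i. {z. snd z (list_encode (take i p)) \<in> {p ! i<..}}) ` {..<n}"
    then show "closedin ?T D"
      using comp by blast
  qed simp
  then have "closedin ?T (\<Inter>p\<in>{p. length p = n}. C p)"
    by (intro closedin_Inter) (auto intro: exI[of _ "replicate n 0"])
  moreover have "{X. omega_small n (list_decode ` X)} = fst ` (\<Inter>p\<in>{p. length p = n}. C p)"
  proof (intro subset_antisym subsetI)
    fix X assume "X \<in> {X. omega_small n (list_decode ` X)}"
    then obtain g where g: "\<forall>p\<in>list_decode ` X. length p = n \<longrightarrow> (\<exists>i<n. p ! i < g (take i p))"
      unfolding omega_small_iff_bound by blast
    have "(X, g \<circ> list_decode) \<in> C p" if p: "length p = n" for p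
    proof (cases "list_encode p \<in> X")
      case True
      then have "p \<in> list_decode ` X"
        by (metis image_eqI list_encode_inverse)
      then obtain i where "i < n" "p ! i < g (take i p)"
        using g p by blast
      then show ?thesis
        by (auto simp: C_def)
    qed (simp add: C_def)
    then show "X \<in> fst ` (\<Inter>p\<in>{p. length p = n}. C p)"
      by (intro image_eqI[of _ _ "(X, g \<circ> list_decode)"]) auto
  next
    fix X assume "X \<in> fst ` (\<Inter>p\<in>{p. length p = n}. C p)"
    then obtain g where g: "\<forall>p. length p = n \<longrightarrow> (X, g) \<in> C p"
      by auto
    have "\<exists>i<n. p ! i < g (list_encode (take i p))" if "p \<in> list_decode ` X" "length p = n" for p
    proof -
      have "list_encode p \<in> X"
        using that(1) by auto
      then show ?thesis
        using g[rule_format, OF that(2)] by (auto simp: C_def)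
    qed
    then show "X \<in> {X. omega_small n (list_decode ` X)}"
      unfolding omega_small_iff_bound mem_Collect_eq
      by (intro exI[of _ "\<lambda>q. g (list_encode q)"]) blast
  qed
  ultimately show ?thesis
    unfolding analytic_def by blast
qed

text \<open>Passes to the combinatorial form of continuity: a basic open set of the product
  restricts only finitely many coordinates.\<close>

lemma continuous_map_cantor_finite_support:
  assumes cont: "continuous_map (subtopology cantor_topology (Pow A)) cantor_topology F"
    and Z: "Z \<subseteq> A"
  shows "\<exists>S. finite S \<and> (\<forall>Z'\<subseteq>A. Z' \<inter> S = Z \<inter> S \<longrightarrow> (k \<in> F Z' \<longleftrightarrow> k \<in> F Z))"
proof -
  let ?P = "product_topology (\<lambda>_ :: nat. discrete_topology (UNIV :: bool set)) UNIV"
  have "continuous_map (subtopology cantor_topology (Pow A)) (discrete_topology UNIV) ((\<lambda>X. k \<in> X) \<circ> F)"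
    using cont continuous_map_cantor_member by (rule continuous_map_compose)
  then have "openin (subtopology cantor_topology (Pow A))
      {X \<in> topspace (subtopology cantor_topology (Pow A)). ((\<lambda>X. k \<in> X) \<circ> F) X \<in> {k \<in> F Z}}"
    by (rule openin_continuous_map_preimage) simp
  then obtain U where U: "openin cantor_topology U" "{X \<in> Pow A. (k \<in> F X) = (k \<in> F Z)} = U \<inter> Pow A"
    by (auto simp: openin_subtopology)
  then obtain W where W: "openin ?P W" "U = (\<lambda>X n. n \<in> X) -` W"
    by (auto simp: cantor_topology_def openin_pullback_topology)
  have "Z \<in> U"
    using U(2) Z by blast
  then have "(\<lambda>n. n \<in> Z) \<in> W"
    using W(2) by simp
  then obtain V where V: "finite {i. V i \<noteq> UNIV}" "(\<lambda>n. n \<in> Z) \<in> Pi\<^sub>E UNIV V" "Pi\<^sub>E UNIV V \<subseteq> W"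
    using product_topology_open_contains_basis[OF W(1)] by (auto; metis)
  have "k \<in> F Z' \<longleftrightarrow> k \<in> F Z" if Z': "Z' \<subseteq> A" "Z' \<inter> {i. V i \<noteq> UNIV} = Z \<inter> {i. V i \<noteq> UNIV}" for Z'
  proof -
    have "(i \<in> Z') \<in> V i" for i
    proof (cases "V i = UNIV")
      case False
      then have "i \<in> Z' \<longleftrightarrow> i \<in> Z"
        using Z'(2) by blast
      then show ?thesis
        using V(2) by (simp add: PiE_iff)
    qed simp
    then have "(\<lambda>n. n \<in> Z') \<in> W"
      using V(3) by (auto simp: PiE_iff)
    then have "Z' \<in> U \<inter> Pow A"
      using W(2) Z'(1) by simp
    then show ?thesis
      using U(2) by blast
  qed
  then show ?thesis
    using V(1) by blast
qed

text \<open>Codes of the finite initial segments of the characteristic sequence of \<open>x\<close>: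
  the branches of the binary tree, an almost disjoint family of size continuum.\<close>

definition branch :: "nat set \<Rightarrow> nat set"
  where "branch x = range (\<lambda>j. list_encode (map (\<lambda>i. of_bool (i \<in> x)) [0..<j]))"

lemma infinite_branch: "infinite (branch x)"
proof -
  have "inj (\<lambda>j. list_encode (map (\<lambda>i. of_bool (i \<in> x)) [0..<j]))"
    by (rule inj_on_inverseI[where g = "length \<circ> list_decode"]) simp
  then show ?thesis
    unfolding branch_def using finite_imageD infinite_UNIV_nat by blast
qed

text \<open>A common code is the same segment of both sequences, so its length is at most any place
  where they differ.\<close>

lemma finite_branch_Int:
  assumes "x \<noteq> y"
  shows "finite (branch x \<inter> branch y)"
proof -
  obtain i where i: "(i \<in> x) \<noteq> (i \<in> y)"
    using assms by blast
  let ?e = "\<lambda>x j. list_encode (map (\<lambda>i. of_bool (i \<in> x)) [0..<j])"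
  have "branch x \<inter> branch y \<subseteq> ?e x ` {..i}"
  proof
    fix c assume "c \<in> branch x \<inter> branch y"
    then have "\<exists>j. c = ?e x j" "\<exists>k. c = ?e y k"
      by (auto simp: branch_def)
    then obtain j k where jk: "c = ?e x j" "c = ?e y k"
      by blast
    then have maps: "map (\<lambda>i. of_bool (i \<in> x) :: nat) [0..<j] = map (\<lambda>i. of_bool (i \<in> y)) [0..<k]"
      by (simp only: list_encode_eq)
    then have "j = k"
      using map_eq_imp_length_eq by fastforce
    then have "\<forall>l<j. (l \<in> x) = (l \<in> y)"
      using maps by (auto simp: map_eq_conv of_bool_eq_iff)
    then have "j \<le> i"
      using i by (meson not_le)
    then show "c \<in> ?e x ` {..i}"
      using jk(1) by blast
  qed
  then show ?thesis
    using finite_subset by blast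
qed

lemma uncountable_UNIV_nat_set: "uncountable (UNIV :: nat set set)"
  using Cantors_theorem[of "UNIV :: nat set"]
  by (metis Pow_UNIV empty_not_UNIV uncountable_def)

text \<open>Since AT does not say which member of the family it returns, all members must code sets
  of full type in exponent \<open>m\<close>.\<close>

definition branch_power :: "nat \<Rightarrow> nat set \<Rightarrow> nat set"
  where "branch_power m x = list_encode ` {p. length p = m \<and> set p \<subseteq> branch x}"

text \<open>A list in two powers has its \<open>m\<close> entries in the finite intersection of the
  two branches.\<close>

lemma almost_disjoint_branch_powers:
  assumes m: "m \<ge> 1"
  shows "almost_disjoint_family (range (branch_power m))" "uncountable (range (branch_power m))"
proof -
  have fin: "finite (branch_power m x \<inter> branch_power m y)" if "x \<noteq> y" for x y
  proof -
    have "branch_power m x \<inter> branch_power m y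
        \<subseteq> list_encode ` {p. set p \<subseteq> branch x \<inter> branch y \<and> length p = m}"
      unfolding branch_power_def image_Int[OF inj_list_encode, symmetric] by (intro image_mono) auto
    then show ?thesis
      by (rule finite_subset) (intro finite_imageI finite_lists_length_eq finite_branch_Int that)
  qed
  have inf: "infinite (branch_power m x)" for x
  proof
    assume "finite (branch_power m x)"
    then have "finite {p. length p = m \<and> set p \<subseteq> branch x}"
      unfolding branch_power_def by (rule finite_imageD) (simp add: inj_on_def list_encode_eq)
    then show False
      using omega_small_finite[OF _ m] not_omega_small_power[OF infinite_branch] by blast
  qed
  show "almost_disjoint_family (range (branch_power m))"
    unfolding almost_disjoint_family_def
  proof (intro conjI ballI impI)
    fix A B assume "A \<in> range (branch_power m)" "B \<in> range (branch_power m)" "A \<noteq> B"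
    then obtain x y where "A = branch_power m x" "B = branch_power m y" "x \<noteq> y"
      by blast
    then show "finite (A \<inter> B)"
      using fin by simp
  qed (use inf in auto)
  have "inj (branch_power m)"
    using inf fin by (metis injI inf.idem)
  then show "uncountable (range (branch_power m))"
    using uncountable_UNIV_nat_set countable_image_inj_on by blast
qed

lemma AT_not_isomorphic:
  assumes AT: axiom_AT and mn: "n < m" "n \<ge> 1"
  shows "\<not> omega_pow_ring m \<simeq> omega_pow_ring n"
proof
  assume "omega_pow_ring m \<simeq> omega_pow_ring n"
  then obtain h where h: "h \<in> ring_iso (omega_pow_ring m) (omega_pow_ring n)"
    by (auto simp: is_ring_iso_def)
  let ?Rm = "omega_pow_ring m" and ?Rn = "omega_pow_ring n"
  have hom: "h \<in> ring_hom ?Rm ?Rn" and inj: "inj_on h (carrier ?Rm)"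
    using h by (auto simp: ring_iso_def bij_betw_def)
  have hzero: "h (omega_pow_class m {}) = omega_pow_class n {}"
    using ring_hom_zero[OF hom] cring_omega_pow_ring cring.axioms(1) zero_omega_pow_ring by metis
  define I where "I = {X. omega_small n (list_decode ` X)}"
  \<comment> \<open>Codes of lists of other lengths denote no position and are cut off.\<close>
  define U where "U X = list_decode ` X \<inter> omega_pow_set m" for X
  have U: "U X \<subseteq> omega_pow_set m" for X
    by (simp add: U_def)
  have Uc: "omega_pow_class m (U X) \<in> carrier ?Rm" for X
    using U by (auto simp: carrier_omega_pow_ring)
  \<comment> \<open>Representatives chosen for the values of \<open>h\<close> give a map on sets
    that preserves intersections modulo the ideal, as AT requires.\<close>
  have "\<forall>X. \<exists>B. B \<subseteq> omega_pow_set n \<and> h (omega_pow_class m (U X)) = omega_pow_class n B"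
  proof
    fix X
    have "h (omega_pow_class m (U X)) \<in> carrier ?Rn"
      using ring_hom_closed[OF hom Uc] .
    then show "\<exists>B. B \<subseteq> omega_pow_set n \<and> h (omega_pow_class m (U X)) = omega_pow_class n B"
      by (auto simp: carrier_omega_pow_ring)
  qed
  from choice[OF this] obtain B
    where B': "\<forall>X. B X \<subseteq> omega_pow_set n \<and> h (omega_pow_class m (U X)) = omega_pow_class n (B X)" ..
  have B: "B X \<subseteq> omega_pow_set n" "h (omega_pow_class m (U X)) = omega_pow_class n (B X)" for X
    using B'[rule_format, of X] by simp_all
  define H where "H X = list_encode ` B X" for X
  have dec_H: "list_decode ` H X = B X" for X
    by (simp add: H_def image_image)
  have dec_diff: "list_decode ` (X - Y) = list_decode ` X - list_decode ` Y"
    and dec_Int: "list_decode ` (X \<inter> Y) = list_decode ` X \<inter> list_decode ` Y" for X Y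
    using inj_list_decode by (auto intro: image_set_diff image_Int)
  have ideal: "set_ideal I"
    unfolding set_ideal_def I_def
    by (auto simp: image_Un omega_small_Un intro: omega_small_subset)
  have analytic: "analytic I"
    unfolding I_def by (rule analytic_omega_small)
  have pres: "preserves_inter_mod I H"
    unfolding preserves_inter_mod_def
  proof (intro conjI allI impI)
    fix X Y :: "nat set" assume fin: "finite (sym_diff X Y)"
    have "sym_diff (U X) (U Y) \<subseteq> list_decode ` (sym_diff X Y)"
      by (auto simp: U_def)
    then have "omega_small m (sym_diff (U X) (U Y))"
      using fin mn by (intro omega_small_finite) (auto intro: finite_subset)
    then have "omega_pow_class n (B X) = omega_pow_class n (B Y)"
      using omega_pow_class_eq_iff[OF U U] B(2) by metis
    then show "sym_diff (H X) (H Y) \<in> I"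
      using omega_pow_class_eq_iff[OF B(1) B(1)] by (simp add: I_def image_Un dec_diff dec_H)
  next
    fix X Y :: "nat set"
    have "U (X \<inter> Y) = U X \<inter> U Y"
      by (auto simp: U_def dec_Int)
    then have "omega_pow_class n (B (X \<inter> Y)) = h (omega_pow_class m (U X) \<otimes>\<^bsub>?Rm\<^esub> omega_pow_class m (U Y))"
      using B(2)[of "X \<inter> Y"] mult_omega_pow_class[OF U U] by simp
    also have "\<dots> = omega_pow_class n (B X) \<otimes>\<^bsub>?Rn\<^esub> omega_pow_class n (B Y)"
      using ring_hom_mult[OF hom Uc Uc] B(2) by simp
    also have "\<dots> = omega_pow_class n (B X \<inter> B Y)"
      using mult_omega_pow_class[OF B(1) B(1)] .
    finally have "omega_small n (sym_diff (B (X \<inter> Y)) (B X \<inter> B Y))"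
      using omega_pow_class_eq_iff[of "B (X \<inter> Y)" n "B X \<inter> B Y"] B(1) by (simp add: le_infI1)
    then show "sym_diff (H (X \<inter> Y)) (H X \<inter> H Y) \<in> I"
      by (simp add: I_def image_Un dec_diff dec_H dec_Int)
  qed
  have m: "m \<ge> 1"
    using mn by simp
  obtain A k and As :: "nat \<Rightarrow> nat set" and F :: "nat \<Rightarrow> nat set \<Rightarrow> nat set"
    where A: "A \<in> range (branch_power m)" "A = (\<Union>i<k. As i)"
      and F: "\<forall>i<k. continuous_map (subtopology cantor_topology (Pow (As i))) cantor_topology (F i) \<and>
               (\<forall>X. X \<subseteq> As i \<longrightarrow> sym_diff (F i X) (H X) \<in> I)"
    using AT[unfolded axiom_AT_def, rule_format, of I H "range (branch_power m)"]
      ideal analytic pres almost_disjoint_branch_powers[OF m] by metis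
  \<comment> \<open>A full set is no finite union of small ones, so one piece of the decomposition
    is full.\<close>
  obtain i where i: "i < k" "\<not> omega_small m (list_decode ` As i)"
  proof -
    obtain x where "A = branch_power m x"
      using A(1) by blast
    then have "list_decode ` A = {p. length p = m \<and> set p \<subseteq> branch x}"
      by (simp add: branch_power_def image_image)
    then have "\<not> omega_small m (\<Union>i<k. list_decode ` As i)"
      using not_omega_small_power[OF infinite_branch, of m x] A(2) by (simp add: image_UN)
    then show thesis
      using that by (auto simp: omega_small_UN)
  qed
  obtain e where e: "\<forall>p. length p = m \<longrightarrow> e p \<in> list_decode ` As i \<and> length (e p) = m"
    "\<forall>p q. (p, q) \<in> lexn less_than m \<longrightarrow> (e p, e q) \<in> lexn less_than m"
    "\<forall>X. omega_small m (e ` (X \<inter> omega_pow_set m)) \<longleftrightarrow> omega_small m X"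
    using not_omega_small_embedding[OF i(2)] by blast
  have e_inj: "inj_on e (omega_pow_set m)"
    unfolding inj_on_def
  proof (intro ballI impI)
    fix p q assume pq: "p \<in> omega_pow_set m" "q \<in> omega_pow_set m" "e p = e q"
    then show "p = q"
      using e(2) lexn_less_than_total[of p m q] lexn_less_than_not_refl by (metis mem_Collect_eq omega_pow_set_def)
  qed
  \<comment> \<open>The continuous lifting is only available below \<open>As i\<close>;
    \<open>Z\<close> copies arbitrary sets into this piece without changing smallness.\<close>
  define Z where "Z X = list_encode ` e ` (X \<inter> omega_pow_set m)" for X
  have Z_sub: "Z X \<subseteq> As i" for X
  proof
    fix c assume "c \<in> Z X"
    then obtain p where "length p = m" "c = list_encode (e p)"
      by (auto simp: Z_def omega_pow_set_def)
    then show "c \<in> As i"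
      using e(1) by auto
  qed
  have UZ: "U (Z X) = e ` (X \<inter> omega_pow_set m)" for X
    using e(1) by (auto simp: U_def Z_def image_image omega_pow_set_def)
  define G where "G X = list_decode ` F i (Z X)" for X
  have "continuous_sets G"
    unfolding continuous_sets_def clopen_sets_def
  proof (intro allI)
    fix q X
    obtain S where S: "finite S"
      "\<forall>Z'\<subseteq>As i. Z' \<inter> S = Z X \<inter> S \<longrightarrow> (list_encode q \<in> F i Z' \<longleftrightarrow> list_encode q \<in> F i (Z X))"
      using continuous_map_cantor_finite_support[of "As i" "F i" "Z X" "list_encode q"] F i(1) Z_sub by blast
    \<comment> \<open>The support lies among codes in the piece; its pullback along the injective
      \<open>e\<close> is still finite.\<close>
    define T where "T = {p \<in> omega_pow_set m. list_encode (e p) \<in> S}"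
    have "inj_on (\<lambda>p. list_encode (e p)) T"
      using e_inj by (auto simp: inj_on_def T_def list_encode_eq)
    moreover have "(\<lambda>p. list_encode (e p)) ` T \<subseteq> S"
      by (auto simp: T_def)
    ultimately have "finite T"
      using S(1) by (metis finite_imageD finite_subset)
    moreover have "Y \<in> {X. q \<in> G X} \<longleftrightarrow> X \<in> {X. q \<in> G X}" if "Y \<inter> T = X \<inter> T" for Y
    proof -
      have "Z Y \<inter> S = Z X \<inter> S"
      proof -
        have "Z V \<inter> S = (\<lambda>p. list_encode (e p)) ` (V \<inter> T)" for V
          by (auto simp: Z_def T_def)
        then show ?thesis
          using that by simp
      qed
      then have "list_encode q \<in> F i (Z Y) \<longleftrightarrow> list_encode q \<in> F i (Z X)"
        using S(2) Z_sub by blast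
      moreover have "q \<in> G V \<longleftrightarrow> list_encode q \<in> F i (Z V)" for V
        unfolding G_def by (metis image_iff list_decode_inverse list_encode_inverse)
      ultimately show ?thesis by simp
    qed
    ultimately show "\<exists>S. finite S \<and> (\<forall>Y. Y \<inter> S = X \<inter> S \<longrightarrow> (Y \<in> {X. q \<in> G X} \<longleftrightarrow> X \<in> {X. q \<in> G X}))"
      by blast
  qed
  \<comment> \<open>Injectivity of \<open>h\<close> is used here: only the zero class goes to zero,
    so smallness is also reflected.\<close>
  moreover have "omega_small m X \<longleftrightarrow> omega_small n (G X)" for X
  proof -
    have "sym_diff (F i (Z X)) (H (Z X)) \<in> I"
      using F i(1) Z_sub by blast
    then have diff: "omega_small n (sym_diff (G X) (B (Z X)))"
      by (simp add: I_def G_def image_Un dec_diff dec_H)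
    have "omega_small n (G X) \<longleftrightarrow> omega_small n (B (Z X))"
    proof
      assume "omega_small n (G X)"
      then have "omega_small n (G X \<union> sym_diff (G X) (B (Z X)))"
        using diff by (simp add: omega_small_Un)
      then show "omega_small n (B (Z X))"
        by (rule omega_small_subset) auto
    next
      assume "omega_small n (B (Z X))"
      then have "omega_small n (B (Z X) \<union> sym_diff (G X) (B (Z X)))"
        using diff by (simp add: omega_small_Un)
      then show "omega_small n (G X)"
        by (rule omega_small_subset) auto
    qed
    also have "\<dots> \<longleftrightarrow> omega_pow_class n (B (Z X)) = omega_pow_class n {}"
      using omega_pow_class_eq_iff[OF B(1), of "{}" "Z X"] by simp
    also have "\<dots> \<longleftrightarrow> h (omega_pow_class m (U (Z X))) = h (omega_pow_class m {})"
      by (simp add: B(2) hzero)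
    also have "\<dots> \<longleftrightarrow> omega_pow_class m (U (Z X)) = omega_pow_class m {}"
      using inj_on_eq_iff[OF inj Uc, of "omega_pow_class m {}"] by (simp add: carrier_omega_pow_ring)
    also have "\<dots> \<longleftrightarrow> omega_small m (U (Z X))"
      using omega_pow_class_eq_iff[OF U, of "{}" "Z X"] by simp
    also have "\<dots> \<longleftrightarrow> omega_small m X"
      using e(3) by (simp add: UZ)
    finally show ?thesis by simp
  qed
  ultimately show False
    using no_continuous_reduction[OF mn] by blast
qed

section \<open>Isomorphism under the continuum hypothesis\<close>

text \<open>
  Modulo the ideals such a relation is a partial isomorphism; \<open>\<T>\<close> ranges over the Boolean combinations
  of the members of \<open>F\<close>.
\<close>

definition small_preserving :: "nat \<Rightarrow> nat \<Rightarrow> (nat list set \<times> nat list set) set \<Rightarrow> bool"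
  where "small_preserving m n R \<longleftrightarrow>
    (\<forall>F \<T>. finite F \<and> F \<subseteq> R \<longrightarrow>
      (omega_small m {p. {i \<in> F. p \<in> fst i} \<in> \<T>} \<longleftrightarrow> omega_small n {p. {i \<in> F. p \<in> snd i} \<in> \<T>}))"

lemma small_preservingD:
  assumes "small_preserving m n R" "finite F" "F \<subseteq> R"
  shows "omega_small m {p. {i \<in> F. p \<in> fst i} \<in> \<T>} \<longleftrightarrow> omega_small n {p. {i \<in> F. p \<in> snd i} \<in> \<T>}"
  using assms unfolding small_preserving_def by blast

text \<open>Lets the back step of the construction reuse the forth step.\<close>

lemma small_preserving_converse:
  "small_preserving m n (R\<inverse>) \<longleftrightarrow> small_preserving n m R"
proof -
  have *: "small_preserving n m (R\<inverse>)" if R: "small_preserving m n R" for m n R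
    unfolding small_preserving_def
  proof (intro allI impI)
    fix F \<T> assume F: "finite F \<and> F \<subseteq> R\<inverse>"
    have swap: "{i \<in> F. p \<in> fst i} = prod.swap ` {i \<in> prod.swap ` F. p \<in> snd i}"
      "{i \<in> F. p \<in> snd i} = prod.swap ` {i \<in> prod.swap ` F. p \<in> fst i}" for p
      by force+
    have "prod.swap ` F \<subseteq> R" "finite (prod.swap ` F)"
      using F by auto
    then have "omega_small m {p. {i \<in> prod.swap ` F. p \<in> fst i} \<in> (\<lambda>\<sigma>. prod.swap ` \<sigma>) -` \<T>} \<longleftrightarrow>
        omega_small n {p. {i \<in> prod.swap ` F. p \<in> snd i} \<in> (\<lambda>\<sigma>. prod.swap ` \<sigma>) -` \<T>}"
      using small_preservingD[OF R] by blast
    then show "omega_small n {p. {i \<in> F. p \<in> fst i} \<in> \<T>} \<longleftrightarrow> omega_small m {p. {i \<in> F. p \<in> snd i} \<in> \<T>}"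
      unfolding swap by simp
  qed
  show ?thesis
    using *[of m n "R\<inverse>"] *[of n m R] by auto
qed

text \<open>A Boolean combination is a finite union of cells, and such a union is small iff all its
  members are.\<close>

lemma small_preservingI_cells:
  assumes "\<And>F \<sigma>. finite F \<Longrightarrow> F \<subseteq> R \<Longrightarrow> \<sigma> \<subseteq> F \<Longrightarrow>
    omega_small m {p. {i \<in> F. p \<in> fst i} = \<sigma>} \<longleftrightarrow> omega_small n {p. {i \<in> F. p \<in> snd i} = \<sigma>}"
  shows "small_preserving m n R"
  unfolding small_preserving_def
proof (intro allI impI)
  fix F :: "(nat list set \<times> nat list set) set" and \<T>
  assume F: "finite F \<and> F \<subseteq> R"
  have split: "{p. {i \<in> F. p \<in> f i} \<in> \<T>} = (\<Union>\<sigma>\<in>Pow F \<inter> \<T>. {p. {i \<in> F. p \<in> f i} = \<sigma>})"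
    for f :: "nat list set \<times> nat list set \<Rightarrow> nat list set"
    by auto
  show "omega_small m {p. {i \<in> F. p \<in> fst i} \<in> \<T>} \<longleftrightarrow> omega_small n {p. {i \<in> F. p \<in> snd i} \<in> \<T>}"
    unfolding split using F assms by (subst (1 2) omega_small_UN) auto
qed

section \<open>Extending a countable partial isomorphism by one set\<close>

lemma infinitely_often_in_blocks:
  fixes T :: "nat \<Rightarrow> nat"
  assumes "strict_mono T" "\<And>k. k \<ge> k0 \<Longrightarrow> \<exists>t. T k \<le> t \<and> t < T (Suc k) \<and> Q t"
  shows "infinite {t. Q t}"
  unfolding infinite_nat_iff_unbounded_le
proof
  fix a
  obtain t where "T (max a k0) \<le> t" "Q t"
    using assms(2)[of "max a k0"] by auto
  moreover have "a \<le> T (max a k0)"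
    using strict_mono_imp_increasing[OF assms(1), of "max a k0"] by simp
  ultimately show "\<exists>t\<ge>a. t \<in> {t. Q t}"
    by (intro exI[of _ t]) auto
qed

text \<open>In every cell of every finite subalgebra, \<open>b'\<close> must be null, co-null or
  splitting as \<open>b\<close> is. Non-null means infinitely many non-null sections, so one section
  inside and one outside \<open>b'\<close> in each block suffice for a split cell, and a subalgebra
  may be disregarded in the finitely many blocks that precede its treatment.\<close>

lemma small_preserving_extend:
  assumes good: "small_preserving m n R" and R: "countable R" and n: "n \<ge> 1"
  shows "\<exists>b' \<subseteq> omega_pow_set n. small_preserving m n (insert (b, b') R)"
proof -
  obtain n' where n': "n = Suc n'"
    using n by (cases n) auto
  \<comment> \<open>An increasing exhaustion of \<open>R\<close> by finite sets; the cells of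
    \<open>Fs k\<close> refine those of every \<open>F \<subseteq> Fs k\<close>.\<close>
  obtain Fs :: "nat \<Rightarrow> (nat list set \<times> nat list set) set"
    where Fs: "\<And>k. finite (Fs k)" "\<And>k. Fs k \<subseteq> R" "\<And>k. Fs k \<subseteq> Fs (Suc k)"
      "\<And>F. finite F \<Longrightarrow> F \<subseteq> R \<Longrightarrow> \<exists>k. F \<subseteq> Fs k"
  proof (cases "R = {}")
    case True
    then show thesis
      by (intro that[of "\<lambda>_. {}"]) auto
  next
    case False
    then have range: "range (from_nat_into R) = R"
      using R by (rule range_from_nat_into)
    show thesis
    proof (rule that[of "\<lambda>k. from_nat_into R ` {..<k}"])
      show "from_nat_into R ` {..<k} \<subseteq> R" for k
        using range by blast
      fix F assume "finite F" "F \<subseteq> R"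
      then obtain N where "finite N" "F = from_nat_into R ` N"
        using range by (metis finite_subset_image)
      then show "\<exists>k. F \<subseteq> from_nat_into R ` {..<k}"
        by (metis finite_nat_set_iff_bounded image_mono lessThan_iff subsetI)
    qed auto
  qed
  have Fs_mono: "Fs j \<subseteq> Fs k" if "j \<le> k" for j k
    using Fs(3) that by (rule lift_Suc_mono_le)
  define pat where "pat k p = {i \<in> Fs k. p \<in> fst i}" for k p
  define pat' where "pat' k p = {i \<in> Fs k. p \<in> snd i}" for k p
  have cell: "omega_small m {p. pat k p = \<sigma>} \<longleftrightarrow> omega_small n {p. pat' k p = \<sigma>}" for k \<sigma>
    using small_preservingD[OF good Fs(1) Fs(2), of k "{\<sigma>}"] by (simp add: pat_def pat'_def)
  define sec where "sec k \<sigma> t = {p. pat' k (t # p) = \<sigma>}" for k \<sigma> t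
  have small_sec: "omega_small n {p. pat' k p = \<sigma>} \<longleftrightarrow> finite {t. \<not> omega_small n' (sec k \<sigma> t)}" for k \<sigma>
    by (simp add: n' sec_def)
  text \<open>Block \<open>[T k, T (k + 1))\<close> of first coordinates treats the algebra generated by \<open>Fs k\<close>: its null
    cells have only null sections there, and each other cell has at least two sections that are not.\<close>
  define start where "start k t \<longleftrightarrow> (\<forall>\<sigma>\<subseteq>Fs k. omega_small n {p. pat' k p = \<sigma>} \<longrightarrow>
      (\<forall>u\<ge>t. omega_small n' (sec k \<sigma> u)))" for k t
  define hits where "hits k t t' \<longleftrightarrow> (\<forall>\<sigma>\<subseteq>Fs k. \<not> omega_small n {p. pat' k p = \<sigma>} \<longrightarrow>
      (\<exists>u v. t \<le> u \<and> u < v \<and> v < t' \<and> \<not> omega_small n' (sec k \<sigma> u) \<and> \<not> omega_small n' (sec k \<sigma> v)))"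
    for k t t'
  have start_ex: "\<exists>t0. \<forall>t\<ge>t0. start k t" for k
  proof -
    have "\<exists>t0. \<forall>u\<ge>t0. omega_small n' (sec k \<sigma> u)" if "omega_small n {p. pat' k p = \<sigma>}" for \<sigma>
    proof -
      have "finite {t. \<not> omega_small n' (sec k \<sigma> t)}"
        using that small_sec by blast
      then show ?thesis
        using infinite_nat_iff_unbounded_le[of "{t. \<not> omega_small n' (sec k \<sigma> t)}"] by auto
    qed
    then have "\<forall>\<sigma>. \<exists>t0. omega_small n {p. pat' k p = \<sigma>} \<longrightarrow> (\<forall>u\<ge>t0. omega_small n' (sec k \<sigma> u))"
      by blast
    from choice[OF this] obtain f where
      f: "\<forall>\<sigma>. omega_small n {p. pat' k p = \<sigma>} \<longrightarrow> (\<forall>u\<ge>f \<sigma>. omega_small n' (sec k \<sigma> u))" ..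
    have "start k t" if t: "t \<ge> (\<Sum>\<sigma>\<in>Pow (Fs k). f \<sigma>)" for t
      unfolding start_def
    proof (intro allI impI)
      fix \<sigma> u assume *: "\<sigma> \<subseteq> Fs k" "omega_small n {p. pat' k p = \<sigma>}" "t \<le> u"
      have "f \<sigma> \<le> (\<Sum>\<sigma>\<in>Pow (Fs k). f \<sigma>)"
        using *(1) Fs(1) by (intro member_le_sum) auto
      then show "omega_small n' (sec k \<sigma> u)"
        using f * t by auto
    qed
    then show ?thesis by blast
  qed
  have hits_ex: "\<exists>t0. \<forall>t'\<ge>t0. hits k t t'" for k t
  proof -
    have "\<exists>v. \<exists>u\<ge>t. u < v \<and> \<not> omega_small n' (sec k \<sigma> u) \<and> \<not> omega_small n' (sec k \<sigma> v)"
      if "\<not> omega_small n {p. pat' k p = \<sigma>}" for \<sigma>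
    proof -
      have inf: "\<forall>a. \<exists>u\<ge>a. \<not> omega_small n' (sec k \<sigma> u)"
        using that small_sec infinite_nat_iff_unbounded_le[of "{t. \<not> omega_small n' (sec k \<sigma> t)}"] by auto
      obtain u where u: "u \<ge> t" "\<not> omega_small n' (sec k \<sigma> u)"
        using inf by blast
      obtain v where "v \<ge> Suc u" "\<not> omega_small n' (sec k \<sigma> v)"
        using inf by blast
      then show ?thesis
        using u by (intro exI[of _ v] exI[of _ u]) auto
    qed
    then have "\<forall>\<sigma>. \<exists>v. \<not> omega_small n {p. pat' k p = \<sigma>} \<longrightarrow>
        (\<exists>u\<ge>t. u < v \<and> \<not> omega_small n' (sec k \<sigma> u) \<and> \<not> omega_small n' (sec k \<sigma> v))"
      by blast
    from choice[OF this] obtain f where f: "\<forall>\<sigma>. \<not> omega_small n {p. pat' k p = \<sigma>} \<longrightarrow>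
        (\<exists>u\<ge>t. u < f \<sigma> \<and> \<not> omega_small n' (sec k \<sigma> u) \<and> \<not> omega_small n' (sec k \<sigma> (f \<sigma>)))" ..
    have "hits k t t'" if t': "t' \<ge> Suc (\<Sum>\<sigma>\<in>Pow (Fs k). f \<sigma>)" for t'
      unfolding hits_def
    proof (intro allI impI)
      fix \<sigma> assume *: "\<sigma> \<subseteq> Fs k" "\<not> omega_small n {p. pat' k p = \<sigma>}"
      have "f \<sigma> \<le> (\<Sum>\<sigma>\<in>Pow (Fs k). f \<sigma>)"
        using *(1) Fs(1) by (intro member_le_sum) auto
      moreover obtain u where "u \<ge> t" "u < f \<sigma>" "\<not> omega_small n' (sec k \<sigma> u)"
        "\<not> omega_small n' (sec k \<sigma> (f \<sigma>))"
        using f *(2) by blast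
      ultimately show "\<exists>u v. t \<le> u \<and> u < v \<and> v < t' \<and>
          \<not> omega_small n' (sec k \<sigma> u) \<and> \<not> omega_small n' (sec k \<sigma> v)"
        using t' by (intro exI[of _ u] exI[of _ "f \<sigma>"]) auto
    qed
    then show ?thesis by blast
  qed
  have "\<exists>T. \<forall>k. start k (T k) \<and> (T k < T (Suc k) \<and> hits k (T k) (T (Suc k)))"
  proof (rule dependent_nat_choice)
    show "\<exists>t. start 0 t"
      using start_ex[of 0] by blast
    fix t k assume "start k t"
    obtain t1 where t1: "\<forall>t\<ge>t1. start (Suc k) t"
      using start_ex by blast
    obtain t2 where t2: "\<forall>t'\<ge>t2. hits k t t'"
      using hits_ex by blast
    show "\<exists>y. start (Suc k) y \<and> t < y \<and> hits k t y"
      using t1 t2 by (intro exI[of _ "max (Suc t) (max t1 t2)"]) auto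
  qed
  then obtain T where T: "\<forall>k. start k (T k) \<and> (T k < T (Suc k) \<and> hits k (T k) (T (Suc k)))" ..
  have T_mono: "strict_mono T"
    using T by (simp add: strict_mono_Suc_iff)
  define kk where "kk t = (GREATEST k. T k \<le> t)" for t
  have kk: "kk t = k" if "T k \<le> t" "t < T (Suc k)" for k t
    unfolding kk_def
  proof (rule Greatest_equality)
    show "l \<le> k" if "T l \<le> t" for l
    proof (rule ccontr)
      assume "\<not> l \<le> k"
      then have "T (Suc k) \<le> T l"
        using T_mono by (simp add: strict_mono_less_eq)
      then show False
        using that \<open>t < T (Suc k)\<close> by simp
    qed
  qed (use that in simp)
  have block: "\<exists>k\<ge>j. T k \<le> t \<and> t < T (Suc k)" if "T j \<le> t" for j t
  proof -
    have "t < T (Suc t)"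
      using strict_mono_imp_increasing[OF T_mono, of "Suc t"] by simp
    then have ex: "\<exists>l. t < T l" ..
    define l where "l = (LEAST l. t < T l)"
    have l: "t < T l" "\<And>l'. l' < l \<Longrightarrow> T l' \<le> t"
      unfolding l_def using LeastI_ex[OF ex] not_less_Least by (auto simp: not_less[symmetric])
    have "j < l"
      using l(1) that T_mono by (metis leD leI le_less_trans strict_mono_less_eq)
    then obtain k where "l = Suc k" "j \<le> k"
      by (cases l) auto
    then show ?thesis
      using l by auto
  qed
  text \<open>A cell that \<open>b\<close> splits is put into \<open>b'\<close> only at its first non-null section in the block.\<close>
  define first where "first k \<sigma> = (LEAST t. T k \<le> t \<and> \<not> omega_small n' (sec k \<sigma> t))" for k \<sigma>
  define sel where "sel k t \<sigma> \<longleftrightarrow> \<not> omega_small m ({p. pat k p = \<sigma>} \<inter> b) \<and>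
      (omega_small m ({p. pat k p = \<sigma>} - b) \<or> t = first k \<sigma>)" for k t \<sigma>
  define b' where "b' = {t # p | t p. length p = n' \<and> sel (kk t) t (pat' (kk t) (t # p))}"
  have b'_iff: "t # p \<in> b' \<longleftrightarrow> sel k t (pat' k (t # p))"
    if "T k \<le> t" "t < T (Suc k)" "length p = n'" for k t p
    using kk[OF that(1,2)] that(3) by (auto simp: b'_def)
  have cell_hit: "\<exists>u v. T k \<le> u \<and> u < T (Suc k) \<and> T k \<le> v \<and> v < T (Suc k) \<and> u = first k \<sigma> \<and> v \<noteq> u \<and>
      \<not> omega_small n' (sec k \<sigma> u) \<and> \<not> omega_small n' (sec k \<sigma> v)"
    if \<sigma>: "\<sigma> \<subseteq> Fs k" "\<not> omega_small m {p. pat k p = \<sigma>}" for k \<sigma>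
  proof -
    have "hits k (T k) (T (Suc k))"
      using T by blast
    then obtain u v where uv: "T k \<le> u" "u < v" "v < T (Suc k)"
      "\<not> omega_small n' (sec k \<sigma> u)" "\<not> omega_small n' (sec k \<sigma> v)"
      using \<sigma> cell unfolding hits_def by blast
    have "T k \<le> first k \<sigma> \<and> \<not> omega_small n' (sec k \<sigma> (first k \<sigma>))"
      unfolding first_def by (rule LeastI[of _ u]) (use uv in simp)
    moreover have "first k \<sigma> \<le> u"
      unfolding first_def by (rule Least_le) (use uv in simp)
    ultimately show ?thesis
      using uv by (intro exI[of _ "first k \<sigma>"] exI[of _ v]) auto
  qed
  have restrict_pat: "pat k p \<inter> F = {i \<in> F. p \<in> fst i}" "pat' k p \<inter> F = {i \<in> F. p \<in> snd i}"
    if "F \<subseteq> Fs k" for F k p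
    using that by (auto simp: pat_def pat'_def)
  have pat_sub: "pat k p \<subseteq> Fs k" "pat' k p \<subseteq> Fs k" for k p
    by (auto simp: pat_def pat'_def)
  \<comment> \<open>\<open>s\<close> chooses the side of \<open>b\<close>. From the block at which
    \<open>F \<subseteq> Fs k\<close> on, each cell of \<open>F\<close> is a finite union of cells
    \<open>\<tau>\<close> that the block treats.\<close>
  have main: "omega_small m {p. {i \<in> F. p \<in> fst i} = \<sigma> \<and> (p \<in> b) = s}
      \<longleftrightarrow> omega_small n {p. {i \<in> F. p \<in> snd i} = \<sigma> \<and> (p \<in> b') = s}"
    if F: "finite F" "F \<subseteq> R" for F \<sigma> s
  proof -
    obtain k0 where k0: "F \<subseteq> Fs k0"
      using Fs(4) F by blast
    have Fk: "F \<subseteq> Fs k" if "k \<ge> k0" for k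
      using k0 Fs_mono[OF that] by blast
    define X where "X = {p. {i \<in> F. p \<in> fst i} = \<sigma> \<and> (p \<in> b) = s}"
    define Y where "Y = {p. {i \<in> F. p \<in> snd i} = \<sigma> \<and> (p \<in> b') = s}"
    have X_split: "X = (\<Union>\<tau>\<in>{\<tau>. \<tau> \<subseteq> Fs k \<and> \<tau> \<inter> F = \<sigma>}. {p. pat k p = \<tau> \<and> (p \<in> b) = s})"
      if "k \<ge> k0" for k
    proof (rule Set.set_eqI)
      fix p
      have "p \<in> X \<longleftrightarrow> pat k p \<inter> F = \<sigma> \<and> (p \<in> b) = s"
        using restrict_pat(1)[OF Fk[OF that], of p] by (simp add: X_def)
      then show "p \<in> X \<longleftrightarrow>
          p \<in> (\<Union>\<tau>\<in>{\<tau>. \<tau> \<subseteq> Fs k \<and> \<tau> \<inter> F = \<sigma>}. {p. pat k p = \<tau> \<and> (p \<in> b) = s})"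
        using pat_sub(1)[of k p] by simp
    qed
    have fin: "finite {\<tau>. \<tau> \<subseteq> Fs k \<and> \<tau> \<inter> F = \<sigma>}" for k
      using Fs(1) by (rule finite_subset[rotated, OF finite_Pow_iff[THEN iffD2]]) auto
    show ?thesis
      unfolding X_def[symmetric] Y_def[symmetric]
    proof
      assume small: "omega_small m X"
      have "omega_small n' {p. t # p \<in> Y}" if "t \<ge> T k0" for t
      proof -
        from block[OF that] obtain k where k: "k \<ge> k0" "T k \<le> t" "t < T (Suc k)"
          by blast
        have X\<tau>: "omega_small m {p. pat k p = \<tau> \<and> (p \<in> b) = s}" if "\<tau> \<subseteq> Fs k" "\<tau> \<inter> F = \<sigma>" for \<tau>
        proof -
          have "{p. pat k p = \<tau> \<and> (p \<in> b) = s} \<subseteq> X"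
            using X_split[OF k(1)] that by blast
          then show ?thesis
            using small omega_small_subset by blast
        qed
        have Y_small: "omega_small n' {p. length p = n' \<and> pat' k (t # p) = \<tau> \<and> (t # p \<in> b') = s}"
          if \<tau>: "\<tau> \<subseteq> Fs k" "\<tau> \<inter> F = \<sigma>" for \<tau>
        proof (cases "omega_small m {p. pat k p = \<tau>}")
          case True
          have "start k (T k)"
            using T by blast
          then have "omega_small n' (sec k \<tau> t)"
            using True cell \<tau>(1) k(2) unfolding start_def by blast
          then show ?thesis
            by (rule omega_small_subset) (auto simp: sec_def)
        next
          case False
          have split: "{p. pat k p = \<tau>} = ({p. pat k p = \<tau>} \<inter> b) \<union> ({p. pat k p = \<tau>} - b)"
            by auto
          have not_both: "\<not> (omega_small m ({p. pat k p = \<tau>} \<inter> b) \<and> omega_small m ({p. pat k p = \<tau>} - b))"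
            using False split omega_small_Un by metis
          \<comment> \<open>The cell is not null but its side \<open>s\<close> is, so the selection
            is constant throughout the block and puts the cell on the other side.\<close>
          have "sel k t \<tau> \<longleftrightarrow> \<not> s"
          proof (cases s)
            case True
            have "{p. pat k p = \<tau>} \<inter> b = {p. pat k p = \<tau> \<and> (p \<in> b) = s}"
              using True by auto
            then show ?thesis
              using X\<tau>[OF \<tau>] True by (simp add: sel_def)
          next
            case False
            have "{p. pat k p = \<tau>} - b = {p. pat k p = \<tau> \<and> (p \<in> b) = s}"
              using False by auto
            then show ?thesis
              using X\<tau>[OF \<tau>] False not_both by (simp add: sel_def)
          qed
          then have "{p. length p = n' \<and> pat' k (t # p) = \<tau> \<and> (t # p \<in> b') = s} = {}"
            using b'_iff[OF k(2,3)] by auto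
          then show ?thesis
            by (simp only: omega_small_empty)
        qed
        have "omega_small n' (\<Union>\<tau>\<in>{\<tau>. \<tau> \<subseteq> Fs k \<and> \<tau> \<inter> F = \<sigma>}.
            {p. length p = n' \<and> pat' k (t # p) = \<tau> \<and> (t # p \<in> b') = s})"
          using Y_small by (subst omega_small_UN[OF fin]) blast
        moreover have "{p. t # p \<in> Y} \<inter> omega_pow_set n' \<subseteq> (\<Union>\<tau>\<in>{\<tau>. \<tau> \<subseteq> Fs k \<and> \<tau> \<inter> F = \<sigma>}.
            {p. length p = n' \<and> pat' k (t # p) = \<tau> \<and> (t # p \<in> b') = s})"
        proof
          fix p assume p: "p \<in> {p. t # p \<in> Y} \<inter> omega_pow_set n'"
          then have "pat' k (t # p) \<inter> F = \<sigma>" "length p = n'" "(t # p \<in> b') = s"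
            using restrict_pat(2)[OF Fk[OF k(1)], of "t # p"] by (auto simp: Y_def omega_pow_set_def)
          then show "p \<in> (\<Union>\<tau>\<in>{\<tau>. \<tau> \<subseteq> Fs k \<and> \<tau> \<inter> F = \<sigma>}.
              {p. length p = n' \<and> pat' k (t # p) = \<tau> \<and> (t # p \<in> b') = s})"
            using pat_sub(2)[of k "t # p"] by simp
        qed
        ultimately have "omega_small n' ({p. t # p \<in> Y} \<inter> omega_pow_set n')"
          by (rule omega_small_subset)
        then show ?thesis
          by (simp add: omega_small_Int_set)
      qed
      then have "{t. \<not> omega_small n' {p. t # p \<in> Y}} \<subseteq> {..<T k0}"
        by (auto simp: not_le[symmetric])
      then show "omega_small n Y"
        using finite_subset by (auto simp: n')
    next
      assume Y: "omega_small n Y"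
      show "omega_small m X"
      proof (rule ccontr)
        assume X: "\<not> omega_small m X"
        have "\<exists>t. T k \<le> t \<and> t < T (Suc k) \<and> \<not> omega_small n' {p. t # p \<in> Y}" if k: "k \<ge> k0" for k
        proof -
          obtain \<tau> where \<tau>: "\<tau> \<subseteq> Fs k" "\<tau> \<inter> F = \<sigma>"
            "\<not> omega_small m {p. pat k p = \<tau> \<and> (p \<in> b) = s}"
            using X unfolding X_split[OF k] omega_small_UN[OF fin] by blast
          have "\<not> omega_small m {p. pat k p = \<tau>}"
            using \<tau>(3) omega_small_subset[of m "{p. pat k p = \<tau>}" "{p. pat k p = \<tau> \<and> (p \<in> b) = s}"]
            by auto
          then obtain u v where uv: "T k \<le> u" "u < T (Suc k)" "T k \<le> v" "v < T (Suc k)"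
            "u = first k \<tau>" "v \<noteq> u" "\<not> omega_small n' (sec k \<tau> u)" "\<not> omega_small n' (sec k \<tau> v)"
            using cell_hit[OF \<tau>(1)] by blast
          \<comment> \<open>The first non-null section \<open>u\<close> serves the side inside
            \<open>b'\<close>, the second one \<open>v\<close> the side outside.\<close>
          have "\<exists>t\<in>{u, v}. sel k t \<tau> \<longleftrightarrow> s"
          proof (cases s)
            case True
            have "{p. pat k p = \<tau>} \<inter> b = {p. pat k p = \<tau> \<and> (p \<in> b) = s}"
              using True by auto
            then show ?thesis
              using \<tau>(3) True uv(5) by (auto simp: sel_def)
          next
            case False
            have "{p. pat k p = \<tau>} - b = {p. pat k p = \<tau> \<and> (p \<in> b) = s}"
              using False by auto
            then show ?thesis
              using \<tau>(3) False uv(5,6) by (auto simp: sel_def)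
          qed
          then obtain t where t: "T k \<le> t" "t < T (Suc k)" "sel k t \<tau> \<longleftrightarrow> s" "\<not> omega_small n' (sec k \<tau> t)"
            using uv by blast
          have "sec k \<tau> t \<inter> omega_pow_set n' \<subseteq> {p. t # p \<in> Y}"
          proof
            fix p assume "p \<in> sec k \<tau> t \<inter> omega_pow_set n'"
            then show "p \<in> {p. t # p \<in> Y}"
              using b'_iff[OF t(1,2), of p] t(3) restrict_pat(2)[OF Fk[OF k], of "t # p"] \<tau>(2)
              by (simp add: sec_def Y_def omega_pow_set_def)
          qed
          then have "\<not> omega_small n' {p. t # p \<in> Y}"
            using t(4) omega_small_subset omega_small_Int_set by blast
          then show ?thesis
            using t by blast
        qed
        then have "infinite {t. \<not> omega_small n' {p. t # p \<in> Y}}"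
          by (rule infinitely_often_in_blocks[OF T_mono])
        then show False
          using Y by (simp add: n')
      qed
    qed
  qed
  have "small_preserving m n (insert (b, b') R)"
  proof (rule small_preservingI_cells)
    fix F \<sigma> assume F: "finite F" "F \<subseteq> insert (b, b') R" "\<sigma> \<subseteq> F"
    show "omega_small m {p. {i \<in> F. p \<in> fst i} = \<sigma>} \<longleftrightarrow> omega_small n {p. {i \<in> F. p \<in> snd i} = \<sigma>}"
    proof (cases "(b, b') \<in> F")
      case True
      let ?z = "(b, b')"
      have "{p. {i \<in> F. p \<in> f i} = \<sigma>}
          = {p. {i \<in> F - {?z}. p \<in> f i} = \<sigma> - {?z} \<and> (p \<in> f ?z) = (?z \<in> \<sigma>)}"
        for f :: "nat list set \<times> nat list set \<Rightarrow> nat list set"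
        using True by blast
      moreover have "F - {?z} \<subseteq> R" "finite (F - {?z})"
        using F by auto
      ultimately show ?thesis
        using main[of "F - {?z}" "\<sigma> - {?z}" "?z \<in> \<sigma>"] by (simp only: fst_conv snd_conv)
    next
      case False
      then have "F \<subseteq> R"
        using F(2) by blast
      then show ?thesis
        using small_preservingD[OF good F(1), of "{\<sigma>}"] by simp
    qed
  qed
  moreover have "b' \<subseteq> omega_pow_set n"
    by (auto simp: b'_def omega_pow_set_def n')
  ultimately show ?thesis by blast
qed

text \<open>The forth step handles \<open>x\<close>; the same lemma for the converse relation
  handles \<open>y\<close>.\<close>

lemma small_preserving_extend_both:
  assumes R: "small_preserving m n R" "countable R" and mn: "m \<ge> 1" "n \<ge> 1"
  shows "\<exists>a b. a \<subseteq> omega_pow_set m \<and> b \<subseteq> omega_pow_set n \<and> small_preserving m n ({(x, b), (a, y)} \<union> R)"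
proof -
  obtain b where b: "b \<subseteq> omega_pow_set n" "small_preserving m n (insert (x, b) R)"
    using small_preserving_extend[OF R mn(2)] by blast
  then have "small_preserving n m ((insert (x, b) R)\<inverse>)"
    using small_preserving_converse by blast
  moreover have "(insert (x, b) R)\<inverse> = prod.swap ` insert (x, b) R"
    by force
  then have "countable ((insert (x, b) R)\<inverse>)"
    using R(2) by (metis countable_image countable_insert)
  ultimately obtain a where a: "a \<subseteq> omega_pow_set m" "small_preserving n m (insert (y, a) ((insert (x, b) R)\<inverse>))"
    using small_preserving_extend mn(1) by blast
  moreover have "insert (y, a) ((insert (x, b) R)\<inverse>) = ({(x, b), (a, y)} \<union> R)\<inverse>"
    by auto
  ultimately show ?thesis
    using b(1) small_preserving_converse by metis
qed

section \<open>Transfinite back-and-forth under CH\<close>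

lemma CH_well_order:
  assumes continuum_hypothesis
  obtains r :: "nat set rel" where "wf r" "trans r" "total r" "\<And>x. countable {y. (y, x) \<in> r}"
proof -
  let ?c = "|UNIV :: nat set set|"
  have wo: "Well_order ?c"
    by (rule card_of_Well_order)
  have Fld: "Field ?c = UNIV"
    by (rule Field_card_of)
  have "countable {y. (y, x) \<in> ?c - Id}" for x
  proof -
    \<comment> \<open>Proper initial segments of a cardinal are smaller than it, and smaller than
      the successor of \<open>natLeq\<close> means countable.\<close>
    have "|underS ?c x| <o ?c"
      using card_of_underS[OF card_of_Card_order, of x UNIV] Fld by simp
    then have "|underS ?c x| <o cardSuc natLeq"
      using assms unfolding continuum_hypothesis_def by (rule ordLess_ordIso_trans)
    then have "|underS ?c x| \<le>o natLeq"
      using cardSuc_ordLeq_ordLess[OF natLeq_Card_order card_of_Card_order] by blast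
    then have "|underS ?c x| \<le>o |UNIV :: nat set|"
      by (rule ordLeq_ordIso_trans[OF _ ordIso_symmetric[OF card_of_nat]])
    then obtain f :: "nat set \<Rightarrow> nat" where "inj_on f (underS ?c x)"
      unfolding card_of_ordLeq[symmetric] by blast
    then have "countable (underS ?c x)"
      by (rule countableI)
    moreover have "{y. (y, x) \<in> ?c - Id} = underS ?c x"
      by (auto simp: underS_def)
    ultimately show ?thesis by simp
  qed
  moreover have "wf (?c - Id)" "trans (?c - Id)" "total (?c - Id)"
    using wo Fld by (auto simp: order_on_defs total_on_def intro: trans_diff_Id)
  ultimately show thesis
    using that by blast
qed

text \<open>Of finitely many indices one is the largest, and everything added up to and including it
  covers \<open>F\<close>.\<close>

lemma finite_subset_chain:
  assumes r: "trans r" "total r" and "finite F" "F \<subseteq> (\<Union>y\<in>D. f y)"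
  shows "F = {} \<or> (\<exists>z\<in>D. F \<subseteq> f z \<union> (\<Union>y\<in>{y. (y, z) \<in> r}. f y))"
  using assms(3,4)
proof (induction F rule: finite_induct)
  case (insert a F)
  obtain y where y: "y \<in> D" "a \<in> f y"
    using insert.prems by blast
  show ?case
  proof (cases "F = {}")
    case False
    then obtain z where z: "z \<in> D" "F \<subseteq> f z \<union> (\<Union>y\<in>{y. (y, z) \<in> r}. f y)"
      using insert by blast
    consider "y = z" | "(y, z) \<in> r" | "(z, y) \<in> r"
      using r(2) by (auto simp: total_on_def)
    then show ?thesis
    proof cases
      case 3
      have "{y'. (y', z) \<in> r} \<subseteq> {y'. (y', y) \<in> r}"
        using 3 r(1) by (auto dest: transD)
      then have "insert a F \<subseteq> f y \<union> (\<Union>y'\<in>{y'. (y', y) \<in> r}. f y')"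
        using z(2) y(2) 3 by blast
      then show ?thesis
        using y(1) by blast
    qed (use z y in blast)+
  qed (use y in blast)
qed simp

text \<open>Without generators a Boolean combination is everything or nothing, and everything is
  small on neither side.\<close>

lemma small_preserving_empty: "small_preserving m n {}"
  unfolding small_preserving_def
proof (intro allI impI)
  fix F :: "(nat list set \<times> nat list set) set" and \<T>
  assume "finite F \<and> F \<subseteq> {}"
  moreover have "\<not> omega_small k UNIV" for k
    using not_omega_small_set omega_small_subset by blast
  ultimately show "omega_small m {p. {i \<in> F. p \<in> fst i} \<in> \<T>} \<longleftrightarrow>
      omega_small n {p. {i \<in> F. p \<in> snd i} \<in> \<T>}"
    by (cases "{} \<in> \<T>") auto
qed

text \<open>\<open>small_preserving\<close> has finite character, so it passes to unions along the
  well-order.\<close>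

lemma small_preserving_chain_union:
  assumes r: "trans r" "total r"
    and good: "\<And>z. z \<in> D \<Longrightarrow> small_preserving m n (f z \<union> (\<Union>y\<in>{y. (y, z) \<in> r}. f y))"
  shows "small_preserving m n (\<Union>y\<in>D. f y)"
  unfolding small_preserving_def
proof (intro allI impI)
  fix F \<T> assume F: "finite F \<and> F \<subseteq> (\<Union>y\<in>D. f y)"
  then have "F = {} \<or> (\<exists>z\<in>D. F \<subseteq> f z \<union> (\<Union>y\<in>{y. (y, z) \<in> r}. f y))"
    by (intro finite_subset_chain[OF r]) auto
  then obtain S where "F \<subseteq> S" "small_preserving m n S"
    using good small_preserving_empty by blast
  then show "omega_small m {p. {i \<in> F. p \<in> fst i} \<in> \<T>} \<longleftrightarrow>
      omega_small n {p. {i \<in> F. p \<in> snd i} \<in> \<T>}"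
    using F small_preservingD by blast
qed

lemma CH_small_preserving_total:
  assumes CH: continuum_hypothesis and mn: "m \<ge> 1" "n \<ge> 1"
  shows "\<exists>R. small_preserving m n R \<and> (\<forall>a \<subseteq> omega_pow_set m. \<exists>b \<subseteq> omega_pow_set n. (a, b) \<in> R)
    \<and> (\<forall>b \<subseteq> omega_pow_set n. \<exists>a \<subseteq> omega_pow_set m. (a, b) \<in> R)"
proof -
  obtain r :: "nat set rel" where r: "wf r" "trans r" "total r" "\<And>x. countable {y. (y, x) \<in> r}"
    using CH_well_order[OF CH] by blast
  \<comment> \<open>A set of naturals is both the index of a stage and, decoded, the set that
    receives a partner on each side at that stage.\<close>
  define dec where "dec x = list_decode ` x" for x
  define ok where "ok S x A \<longleftrightarrow> (\<exists>a b. a \<subseteq> omega_pow_set m \<and> b \<subseteq> omega_pow_set n \<and>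
      A = {(dec x, b), (a, dec x)} \<and> small_preserving m n (A \<union> S))" for S x A
  \<comment> \<open>The recursion picks any admissible extension of what was added before. That one
    exists is shown afterwards by induction, since the earlier part is countable and
    \<open>small_preserving\<close>.\<close>
  define added where "added = wfrec r (\<lambda>f x. SOME A. ok (\<Union>y\<in>{y. (y, x) \<in> r}. f y) x A)"
  define below where "below x = (\<Union>y\<in>{y. (y, x) \<in> r}. added y)" for x
  have added_eq: "added x = (SOME A. ok (below x) x A)" for x
  proof -
    have "added x = (SOME A. ok (\<Union>y\<in>{y. (y, x) \<in> r}. cut added r x y) x A)"
      unfolding added_def by (subst wfrec[OF r(1)]) simp
    moreover have "(\<Union>y\<in>{y. (y, x) \<in> r}. cut added r x y) = below x"
      unfolding below_def by (auto simp: cut_def)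
    ultimately show ?thesis by simp
  qed
  have ok: "ok (below x) x (added x)" for x
    using r(1)
  proof (induction x)
    case (less x)
    have fin_added: "finite (added y)" if "(y, x) \<in> r" for y
      using less.IH[OF that] by (auto simp: ok_def)
    have cnt: "countable (below x)"
      unfolding below_def using r(4) fin_added by (auto intro: countable_finite)
    have good: "small_preserving m n (below x)"
      unfolding below_def
    proof (rule small_preserving_chain_union[OF r(2,3)])
      fix z assume "z \<in> {y. (y, x) \<in> r}"
      then show "small_preserving m n (added z \<union> (\<Union>y\<in>{y. (y, z) \<in> r}. added y))"
        using less.IH[of z] by (auto simp: ok_def below_def)
    qed
    obtain a b where "a \<subseteq> omega_pow_set m" "b \<subseteq> omega_pow_set n"
      "small_preserving m n ({(dec x, b), (a, dec x)} \<union> below x)"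
      using small_preserving_extend_both[OF good cnt mn, of "dec x" "dec x"] by blast
    then have "ok (below x) x {(dec x, b), (a, dec x)}"
      unfolding ok_def by blast
    then show ?case
      unfolding added_eq by (rule someI)
  qed
  define R where "R = (\<Union>x. added x)"
  have pair: "\<exists>a b. a \<subseteq> omega_pow_set m \<and> b \<subseteq> omega_pow_set n \<and> (c, b) \<in> R \<and> (a, c) \<in> R" for c
  proof -
    have "dec (list_encode ` c) = c"
      by (simp add: dec_def image_image)
    then obtain a b where ab: "a \<subseteq> omega_pow_set m" "b \<subseteq> omega_pow_set n"
      "added (list_encode ` c) = {(c, b), (a, c)}"
      using ok[of "list_encode ` c"] unfolding ok_def by metis
    then have "(c, b) \<in> R" "(a, c) \<in> R"
      unfolding R_def by blast+
    then show ?thesis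
      using ab by blast
  qed
  have "small_preserving m n R"
    unfolding R_def
  proof (rule small_preserving_chain_union[OF r(2,3)])
    show "small_preserving m n (added z \<union> (\<Union>y\<in>{y. (y, z) \<in> r}. added y))" for z
      using ok[of z] by (auto simp: ok_def below_def)
  qed
  moreover have "\<exists>b \<subseteq> omega_pow_set n. (c, b) \<in> R" "\<exists>a \<subseteq> omega_pow_set m. (a, c) \<in> R" for c
    using pair[of c] by blast+
  ultimately show ?thesis
    by (intro exI[of _ R] conjI allI impI)
qed

text \<open>\<open>R\<close> may relate one set to many. As smallness of symmetric differences
  transfers in both directions, it still induces a well-defined injective map on classes.\<close>

lemma CH_isomorphic:
  assumes CH: continuum_hypothesis and mn: "m \<ge> 1" "n \<ge> 1"
  shows "omega_pow_ring m \<simeq> omega_pow_ring n"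
proof -
  let ?Rm = "omega_pow_ring m" and ?Rn = "omega_pow_ring n"
  let ?Sm = "omega_pow_set m" and ?Sn = "omega_pow_set n"
  obtain R where R: "small_preserving m n R"
    and total: "\<forall>a \<subseteq> ?Sm. \<exists>b \<subseteq> ?Sn. (a, b) \<in> R" and onto: "\<forall>b \<subseteq> ?Sn. \<exists>a \<subseteq> ?Sm. (a, b) \<in> R"
    using CH_small_preserving_total[OF CH mn] by blast
  \<comment> \<open>The homomorphism identities compare an operation on two sets with a third set,
    so Boolean combinations of three pairs suffice.\<close>
  have transfer3: "omega_small m {p. Q (p \<in> fst i) (p \<in> fst j) (p \<in> fst k)} \<longleftrightarrow>
      omega_small n {p. Q (p \<in> snd i) (p \<in> snd j) (p \<in> snd k)}"
    if "i \<in> R" "j \<in> R" "k \<in> R" for Q i j k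
    using small_preservingD[OF R, of "{i, j, k}" "{\<sigma>. Q (i \<in> \<sigma>) (j \<in> \<sigma>) (k \<in> \<sigma>)}"] that by simp
  from total have "\<forall>a. \<exists>b. a \<subseteq> ?Sm \<longrightarrow> b \<subseteq> ?Sn \<and> (a, b) \<in> R"
    by blast
  from choice[OF this] obtain f where f': "\<forall>a. a \<subseteq> ?Sm \<longrightarrow> f a \<subseteq> ?Sn \<and> (a, f a) \<in> R" ..
  have f: "f a \<subseteq> ?Sn" "(a, f a) \<in> R" if "a \<subseteq> ?Sm" for a
    using f' that by auto
  define h where "h x = omega_pow_class n (f (SOME a. a \<subseteq> ?Sm \<and> x = omega_pow_class m a))" for x
  have class_eq: "omega_pow_class m a = omega_pow_class m a' \<longleftrightarrow> omega_pow_class n b = omega_pow_class n b'"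
    if "(a, b) \<in> R" "(a', b') \<in> R" "a \<subseteq> ?Sm" "a' \<subseteq> ?Sm" "b \<subseteq> ?Sn" "b' \<subseteq> ?Sn" for a a' b b'
  proof -
    have "sym_diff c d = {p. (p \<in> c) \<noteq> (p \<in> d)}" for c d :: "nat list set"
      by auto
    then show ?thesis
      using transfer3[OF that(1,2,2), of "\<lambda>x y z. x \<noteq> y"] that by (simp add: omega_pow_class_eq_iff)
  qed
  have h: "h (omega_pow_class m a) = omega_pow_class n b" if "(a, b) \<in> R" "a \<subseteq> ?Sm" "b \<subseteq> ?Sn" for a b
  proof -
    define c where "c = (SOME c. c \<subseteq> ?Sm \<and> omega_pow_class m a = omega_pow_class m c)"
    have c: "c \<subseteq> ?Sm \<and> omega_pow_class m a = omega_pow_class m c"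
      unfolding c_def by (rule someI[of _ a]) (use that in simp)
    have "h (omega_pow_class m a) = omega_pow_class n (f c)"
      by (simp only: h_def c_def)
    moreover have "omega_pow_class n b = omega_pow_class n (f c)"
      using class_eq[OF that(1) f(2)[of c]] that f(1)[of c] c by simp
    ultimately show ?thesis
      by simp
  qed
  have h_f: "h (omega_pow_class m a) = omega_pow_class n (f a)" if "a \<subseteq> ?Sm" for a
    using h f that by simp
  have "h \<in> ring_hom ?Rm ?Rn"
  proof (rule ring_hom_memI)
    fix x assume "x \<in> carrier ?Rm"
    then show "h x \<in> carrier ?Rn"
      using h_f f(1) by (auto simp: carrier_omega_pow_ring)
  next
    fix x y assume "x \<in> carrier ?Rm" "y \<in> carrier ?Rm"
    then obtain a b where ab: "a \<subseteq> ?Sm" "b \<subseteq> ?Sm" "x = omega_pow_class m a" "y = omega_pow_class m b"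
      by (auto simp: carrier_omega_pow_ring)
    have sub: "a \<inter> b \<subseteq> ?Sm" "sym_diff a b \<subseteq> ?Sm" "f a \<inter> f b \<subseteq> ?Sn" "sym_diff (f a) (f b) \<subseteq> ?Sn"
      using ab f(1) by auto
    have "sym_diff (f (a \<inter> b)) (f a \<inter> f b) = {p. (p \<in> f (a \<inter> b)) \<noteq> (p \<in> f a \<and> p \<in> f b)}"
      by auto
    moreover have "omega_small n {p. (p \<in> f (a \<inter> b)) \<noteq> (p \<in> f a \<and> p \<in> f b)}"
      using transfer3[OF f(2)[OF sub(1)] f(2)[OF ab(1)] f(2)[OF ab(2)], of "\<lambda>u v w. u \<noteq> (v \<and> w)"] by simp
    ultimately have "omega_pow_class n (f (a \<inter> b)) = omega_pow_class n (f a \<inter> f b)"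
      using omega_pow_class_eq_iff[OF f(1)[OF sub(1)] sub(3)] by simp
    then show "h (x \<otimes>\<^bsub>?Rm\<^esub> y) = h x \<otimes>\<^bsub>?Rn\<^esub> h y"
      using ab sub(1) f(1) by (simp add: mult_omega_pow_class h_f)
    have "sym_diff (f (sym_diff a b)) (sym_diff (f a) (f b))
        = {p. (p \<in> f (sym_diff a b)) \<noteq> ((p \<in> f a) \<noteq> (p \<in> f b))}"
      by auto
    moreover have "{p. (p \<in> sym_diff a b) \<noteq> ((p \<in> a) \<noteq> (p \<in> b))} = {}"
      by auto
    then have "omega_small n {p. (p \<in> f (sym_diff a b)) \<noteq> ((p \<in> f a) \<noteq> (p \<in> f b))}"
      using transfer3[OF f(2)[OF sub(2)] f(2)[OF ab(1)] f(2)[OF ab(2)], of "\<lambda>u v w. u \<noteq> (v \<noteq> w)"]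
      by (simp only: fst_conv snd_conv omega_small_empty)
    ultimately have "omega_pow_class n (f (sym_diff a b)) = omega_pow_class n (sym_diff (f a) (f b))"
      using omega_pow_class_eq_iff[OF f(1)[OF sub(2)] sub(4)] by simp
    then show "h (x \<oplus>\<^bsub>?Rm\<^esub> y) = h x \<oplus>\<^bsub>?Rn\<^esub> h y"
      using ab sub(2) f(1) by (simp add: add_omega_pow_class h_f)
  next
    have "omega_small m {p. p \<notin> ?Sm}"
      using omega_small_cong[of m "{p. p \<notin> ?Sm}" "{}"] by (simp add: omega_pow_set_def)
    then have "omega_small n {p. p \<notin> f ?Sm}"
      using transfer3[OF f(2) f(2) f(2), of ?Sm ?Sm ?Sm "\<lambda>u v w. \<not> u"] by simp
    then have "omega_small n (sym_diff (f ?Sm) ?Sn)"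
      by (rule omega_small_subset) (use f(1)[of ?Sm] in auto)
    then have "omega_pow_class n (f ?Sm) = omega_pow_class n ?Sn"
      using omega_pow_class_eq_iff f(1) by blast
    then show "h \<one>\<^bsub>?Rm\<^esub> = \<one>\<^bsub>?Rn\<^esub>"
      by (simp add: one_omega_pow_ring h_f)
  qed
  moreover have "bij_betw h (carrier ?Rm) (carrier ?Rn)"
    unfolding bij_betw_def
  proof
    show "inj_on h (carrier ?Rm)"
    proof (rule inj_onI)
      fix x y assume "x \<in> carrier ?Rm" "y \<in> carrier ?Rm" and eq: "h x = h y"
      then obtain a b where ab: "a \<subseteq> ?Sm" "b \<subseteq> ?Sm" "x = omega_pow_class m a" "y = omega_pow_class m b"
        by (auto simp: carrier_omega_pow_ring)
      then show "x = y"
        using eq class_eq[OF f(2) f(2) _ _ f(1) f(1), of a b] by (simp add: h_f)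
    qed
    show "h ` carrier ?Rm = carrier ?Rn"
    proof (intro subset_antisym subsetI)
      fix x assume "x \<in> h ` carrier ?Rm"
      then show "x \<in> carrier ?Rn"
        using h_f f(1) by (auto simp: carrier_omega_pow_ring)
    next
      fix x assume "x \<in> carrier ?Rn"
      then obtain b where b: "b \<subseteq> ?Sn" "x = omega_pow_class n b"
        by (auto simp: carrier_omega_pow_ring)
      then obtain a where a: "a \<subseteq> ?Sm" "(a, b) \<in> R"
        using onto by blast
      then have "x = h (omega_pow_class m a)" "omega_pow_class m a \<in> carrier ?Rm"
        using h b by (auto simp: carrier_omega_pow_ring)
      then show "x \<in> h ` carrier ?Rm"
        by (rule image_eqI)
    qed
  qed
  ultimately show ?thesis
    unfolding is_ring_iso_def ring_iso_def by blast
qed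

theorem theorem6p6:
  shows "(\<forall>n\<ge>1. cring (omega_pow_ring n) \<and>
            omega_pow_automatic n (carrier (omega_pow_ring n)) (ring_relations (omega_pow_ring n))) \<and>
         (continuum_hypothesis \<longrightarrow>
            (\<forall>m\<ge>1. \<forall>n\<ge>1. omega_pow_ring m \<simeq> omega_pow_ring n)) \<and>
         (axiom_AT \<longrightarrow>
            (\<forall>m\<ge>1. \<forall>n\<ge>1. m \<noteq> n \<longrightarrow> \<not> (omega_pow_ring m \<simeq> omega_pow_ring n)))"
proof (intro conjI allI impI)
  fix n :: nat assume "1 \<le> n"
  then show "cring (omega_pow_ring n)"
    "omega_pow_automatic n (carrier (omega_pow_ring n)) (ring_relations (omega_pow_ring n))"
    using cring_omega_pow_ring omega_pow_automatic_ring by blast+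
next
  fix m n :: nat assume "continuum_hypothesis" "1 \<le> m" "1 \<le> n"
  then show "omega_pow_ring m \<simeq> omega_pow_ring n"
    by (rule CH_isomorphic)
next
  fix m n :: nat assume AT: "axiom_AT" and mn: "1 \<le> m" "1 \<le> n" "m \<noteq> n"
  show "\<not> omega_pow_ring m \<simeq> omega_pow_ring n"
  proof
    \<comment> \<open>\<open>AT_not_isomorphic\<close> takes the larger exponent as source; symmetry
      covers the other case.\<close>
    assume iso: "omega_pow_ring m \<simeq> omega_pow_ring n"
    then have "omega_pow_ring n \<simeq> omega_pow_ring m"
      using ring_iso_sym cring_omega_pow_ring cring.axioms(1) by blast
    then show False
      using iso AT_not_isomorphic[OF AT] mn by (meson linorder_neqE_nat)
  qed
qed

end
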